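(* Let $m\ge 1$ and $T\in(0,\infty)$ be fixed, and let $K,\beta,\gamma>0$. If $G\in\mathcal{G}_{K,\beta,\gamma}$, then there exists a constant $c=c(K,\beta,\gamma)<\infty$ (depending on $G$ only through $K,\beta,\gamma$, with $m,T$ fixed) such that $$P\big(G^{(\varepsilon)}\big)\le P(G)+c\,\varepsilon,\qquad \varepsilon>0.$$
   Context: $\mathbf{W}=\{\mathbf{W}_t\}_{t\ge 0}$ is the standard $m$-dimensional Brownian motion with $\mathbf{W}_0=\mathbf{0}$. For a set $H\subset[0,T]\times\mathbb{R}^m$ (first component is time), $P(H):=\mathbb{P}\big((t,\mathbf{W}_t)\in H,\ t\in(0,T)\big)$, i.e. the probability that $(t,\mathbf{W}_t)\in H$ for all $t\in(0,T)$, and $H_t:=\{\mathbf{x}\in\mathbb{R}^m:(t,\mathbf{x})\in H\}$ is the time-$t$ section of $H$. $\mathcal{G}$ is the class of open sets $G\subset(0,T)\times\mathbb{R}^m$ with $(0,\mathbf{0})\in\partial G$. $\|\cdot\|$ is the Euclidean norm, $\rho(\mathbf{x},A):=\inf_{\mathbf{y}\in A}\|\mathbf{x}-\mathbf{y}\|$, $A^c$ is the complement of $A$, and $B_r(\mathbf{x}):=\{\mathbf{y}\in\mathbb{R}^m:\|\mathbf{x}-\mathbf{y}\|<r\}$. For $A\subset\mathbb{R}^m$ and $v>0$, $A^{(v)}:=\{\mathbf{x}\in\mathbb{R}^m:\rho(\mathbf{x},A)<v\}$. For $H\subset[0,T]\times\mathbb{R}^m$ and $v>0$, $H^{(v)}:=\{(t,\mathbf{x}):t\in[0,T],\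 \mathbf{x}\in (H_t)^{(v)}\}$. For $A,\widetilde A\subset\mathbb{R}^m$: $\rho_h(A,\widetilde A):=\inf\{\varepsilon>0: A\subset\widetilde A^{(\varepsilon)}\text{ and }\widetilde A\subset A^{(\varepsilon)}\}$ and $\rho_H(A,\widetilde A):=\max\{\rho_h(A,\widetilde A),\rho_h(A^c,\widetilde A^c)\}$. $\mathcal{G}_{K,\beta,\gamma}$ is the class of sets $G\in\mathcal{G}$ satisfying the following three conditions: (1) $\rho_H(G_s,G_t)\le K(t-s)$ for all $0<s<t<T$; (2) for any $t\in(0,T)$ and $\mathbf{g}\in\partial G_t$ (boundary of the section $G_t$ in $\mathbb{R}^m$), there exists a ball $B_\beta(\mathbf{y})\subset G_t^c$ with $\mathbf{g}\in\partial B_\beta(\mathbf{y})$; (3) for any $t\in(0,T)$ there exists $v_0>0$ such that $\mathbb{E}\big(1+\|\mathbf{W}_t\|;\ 0<\rho(\mathbf{W}_t,G_t^c)<v\big)<\gamma v$ for all $0<v<v_0$, where $\mathbb{E}(X;A):=\mathbb{E}(X\mathbf{1}_A)$. *)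

theory Defs
  imports "HOL-Probability.Probability"
begin

section \<open>Standard Brownian motion\<close>

text \<open>
  All paths (not only almost all) are required to be continuous. For the sets considered below,
  this makes the non-crossing event measurable without completing the probability space.
\<close>

definition standard_brownian_motion ::
    "'w measure \<Rightarrow> (real \<Rightarrow> 'w \<Rightarrow> real ^ 'm) \<Rightarrow> bool" where
  "standard_brownian_motion M W \<longleftrightarrow>
     prob_space M \<and>
     (\<forall>t\<ge>0. W t \<in> borel_measurable M) \<and>
     (\<forall>\<omega>\<in>space M. W 0 \<omega> = 0) \<and>
     (\<forall>\<omega>\<in>space M. continuous_on {0..} (\<lambda>t. W t \<omega>)) \<and>
     (\<forall>s t. 0 \<le> s \<and> s < t \<longrightarrow>
        distributed M lborel (\<lambda>\<omega>. W t \<omega> - W s \<omega>)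
          (\<lambda>x. ennreal (\<Prod>i\<in>UNIV. normal_density 0 (sqrt (t - s)) (x $ i)))) \<and>
     (\<forall>(n::nat) \<tau>. 0 \<le> \<tau> 0 \<and> strict_mono_on {..n} \<tau> \<longrightarrow>
        prob_space.indep_vars M (\<lambda>_. borel) (\<lambda>i \<omega>. W (\<tau> (Suc i)) \<omega> - W (\<tau> i) \<omega>) {..<n})"


section \<open>Distances, neighbourhoods and sections\<close>

text \<open>
  Distances are extended reals, so that the infimum over the empty set is \<open>\<infinity>\<close>. The library's
  \<^const>\<open>infdist\<close> assigns the value 0 to the empty set, and would make the neighbourhood of the
  empty set the whole space.
\<close>

definition rho :: "'a::metric_space \<Rightarrow> 'a set \<Rightarrow> ereal" where
  "rho x A = (INF y\<in>A. ereal (dist x y))"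

definition nbhd :: "'a::metric_space set \<Rightarrow> real \<Rightarrow> 'a set" where
  "nbhd A v = {x. rho x A < ereal v}"

definition time_section :: "(real \<times> 'a) set \<Rightarrow> real \<Rightarrow> 'a set" where
  "time_section H t = {x. (t, x) \<in> H}"

definition tube_nbhd ::
    "real \<Rightarrow> (real \<times> 'a::metric_space) set \<Rightarrow> real \<Rightarrow> (real \<times> 'a) set" where
  "tube_nbhd T H v = {(t, x). t \<in> {0..T} \<and> x \<in> nbhd (time_section H t) v}"

definition rho_h :: "'a::metric_space set \<Rightarrow> 'a set \<Rightarrow> ereal" where
  "rho_h A B = Inf (ereal ` {\<epsilon>. \<epsilon> > 0 \<and> A \<subseteq> nbhd B \<epsilon> \<and> B \<subseteq> nbhd A \<epsilon>})"

definition rho_H :: "'a::metric_space set \<Rightarrow> 'a set \<Rightarrow> ereal" where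
  "rho_H A B = max (rho_h A B) (rho_h (- A) (- B))"


section \<open>Non-crossing probabilities and classes of sets\<close>

definition stay_prob ::
    "'w measure \<Rightarrow> (real \<Rightarrow> 'w \<Rightarrow> real ^ 'm) \<Rightarrow> real \<Rightarrow> (real \<times> (real ^ 'm)) set \<Rightarrow> real" where
  "stay_prob M W T H = measure M {\<omega> \<in> space M. \<forall>t\<in>{0<..<T}. (t, W t \<omega>) \<in> H}"

definition class_G :: "real \<Rightarrow> (real \<times> (real ^ 'm)) set set" where
  "class_G T = {G. open G \<and> G \<subseteq> {0<..<T} \<times> UNIV \<and> (0, 0) \<in> frontier G}"

definition class_G_params ::
    "'w measure \<Rightarrow> (real \<Rightarrow> 'w \<Rightarrow> real ^ 'm) \<Rightarrow> real \<Rightarrow> real \<Rightarrow> real \<Rightarrow> real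
      \<Rightarrow> (real \<times> (real ^ 'm)) set set" where
  "class_G_params M W T K \<beta> \<gamma> = {G \<in> class_G T.
     (\<forall>s t. 0 < s \<and> s < t \<and> t < T \<longrightarrow>
        rho_H (time_section G s) (time_section G t) \<le> ereal (K * (t - s))) \<and>
     (\<forall>t\<in>{0<..<T}. \<forall>g\<in>frontier (time_section G t).
        \<exists>y. ball y \<beta> \<subseteq> - time_section G t \<and> g \<in> frontier (ball y \<beta>)) \<and>
     (\<forall>t\<in>{0<..<T}. \<exists>v\<^sub>0>0. \<forall>v. 0 < v \<and> v < v\<^sub>0 \<longrightarrow>
        (LINT \<omega>:{\<omega> \<in> space M. 0 < rho (W t \<omega>) (- time_section G t) \<and>
                              rho (W t \<omega>) (- time_section G t) < ereal v}|M.
           1 + norm (W t \<omega>)) < \<gamma> * v)}"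

end

theory Submission
  imports Defs
begin

text \<open>
  A path that stays in \<open>G\<^bsup>(\<epsilon>)\<^esup>\<close> but leaves \<open>G\<close> is, when it leaves, within \<open>\<epsilon>\<close> of a ball of radius \<open>\<beta>\<close>
  outside the section. Since the sections move with speed \<open>K\<close>, the path then has to avoid a slowly
  shrinking ball, starting at distance \<open>O(\<epsilon>)\<close>; over a remaining time \<open>h\<close> this has probability
  \<open>O(\<epsilon> / \<surd>h)\<close>. The sum over the exit time converges because the exit time has a bounded density near \<open>T\<close>:
  run backwards from \<open>W\<^sub>t = x\<close>, the path is a bridge with drift of order \<open>1 + \<parallel>x\<parallel>\<close> that has to avoid
  a shrinking ball, so that being at distance \<open>v\<close> from the complement without having left \<open>G\<close>
  has probability \<open>O(v \<cdot> E(1 + \<parallel>W\<^sub>t\<parallel>; 0 < \<rho> < v)) = O(v\<^sup>2)\<close>, while an exit in the next \<open>h\<close> units of time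
  needs \<open>v = O(\<surd>h)\<close>.

  Everything is done on time grids. For a Gaussian chain \<open>X\<close> the squared distance to the centre of
  the ball has explicit increments, and a concave quadratic of it is an exact discrete supermartingale
  up to terms of second order in the step size; no stochastic calculus is needed.
\<close>

section \<open>Centred Gaussian measures\<close>

text \<open>The width \<open>v\<^sub>0\<close> up to which the strip condition of the class holds
  may depend on t in any way, so the exit rate at t is controlled only for h below a threshold that
  also depends on t. The Lipschitz bound on the staying probability is therefore drawn from its
  right Dini derivative, and this needs left continuity as well: a first exit at a fixed time must
  have probability 0. The weight 1 + norm x in the strip condition is what the reversed path costs.
  Given W_t = x, it is pulled to the origin with speed of order norm x / t, so the height r up to
  which noise dominates drift is of order 1 / (1 + norm x), and the survival probability v / r
  carries the weight. Times before T/2, where this pull is not uniformly bounded, are kept out of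
  the backward estimate: a path leaving that early has time of order T left, and the forward
  estimate alone costs a multiple of \<epsilon> there. Only upper bounds on staying probabilities
  are needed, and testing a path at finitely many times enlarges a staying event, so a bound on a
  grid is a bound for the path.\<close>

definition gauss :: "real \<Rightarrow> (real ^ 'm) measure" where
  "gauss \<sigma> = density lborel (\<lambda>x. ennreal (\<Prod>i\<in>UNIV. normal_density 0 \<sigma> (x $ i)))"

lemma sets_gauss [measurable_cong, simp]: "sets (gauss \<sigma>) = sets borel"
  by (simp add: gauss_def)

lemma space_gauss [simp]: "space (gauss \<sigma>) = UNIV"
  by (simp add: gauss_def)

section \<open>Coordinatewise integration and moments on R^m\<close>

lemma prod_Basis_vec:
  "(\<Prod>b\<in>(Basis :: (real ^ 'm) set). g b) = (\<Prod>i\<in>UNIV. g (axis i 1))"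
proof -
  have B: "(Basis :: (real ^ 'm) set) = range (\<lambda>i. axis i 1)"
    by (auto simp: Basis_vec_def)
  have I: "inj (\<lambda>i. axis i 1 :: real ^ 'm)"
    by (auto simp: inj_on_def axis_eq_axis)
  show ?thesis
    unfolding B by (subst prod.reindex[OF I]) (simp add: comp_def)
qed

lemma sum_Basis_vec:
  "(\<Sum>b\<in>(Basis :: (real ^ 'm) set). g b) = (\<Sum>i\<in>UNIV. g (axis i 1))"
proof -
  have B: "(Basis :: (real ^ 'm) set) = range (\<lambda>i. axis i 1)"
    by (auto simp: Basis_vec_def)
  have I: "inj (\<lambda>i. axis i 1 :: real ^ 'm)"
    by (auto simp: inj_on_def axis_eq_axis)
  show ?thesis
    unfolding B by (subst sum.reindex[OF I]) (simp add: comp_def)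
qed

lemma nn_integral_vec_prod:
  fixes f :: "'m::finite \<Rightarrow> real \<Rightarrow> ennreal"
  assumes [measurable]: "\<And>i. f i \<in> borel_measurable borel"
  shows "(\<integral>\<^sup>+x. (\<Prod>i\<in>UNIV. f i ((x :: real ^ 'm) $ i)) \<partial>lborel) = (\<Prod>i\<in>UNIV. \<integral>\<^sup>+x. f i x \<partial>lborel)"
proof -
  have "(\<integral>\<^sup>+x. (\<Prod>b\<in>Basis. f (axis_index b) ((x :: real ^ 'm) \<bullet> b)) \<partial>lborel)
      = (\<Prod>b\<in>(Basis :: (real ^ 'm) set). \<integral>\<^sup>+x. f (axis_index b) x \<partial>lborel)"
    by (rule nn_integral_lborel_prod) auto
  moreover have "axis_index (axis i 1 :: real ^ 'm) = i" for i
    using axis_index_axis by (metis)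
  ultimately show ?thesis
    by (simp add: prod_Basis_vec inner_axis)
qed

lemma nn_integral_gauss:
  fixes f :: "real ^ 'm \<Rightarrow> ennreal"
  assumes [measurable]: "f \<in> borel_measurable borel"
  shows "(\<integral>\<^sup>+x. f x \<partial>gauss \<sigma>) = (\<integral>\<^sup>+x. ennreal (\<Prod>i\<in>UNIV. normal_density 0 \<sigma> (x $ i)) * f x \<partial>lborel)"
  unfolding gauss_def by (rule nn_integral_density) auto

lemma nn_integral_gauss_coord:
  fixes f :: "real \<Rightarrow> ennreal" and i :: "'m::finite"
  assumes [measurable]: "f \<in> borel_measurable borel" and "\<sigma> > 0"
  shows "(\<integral>\<^sup>+x. f ((x :: real ^ 'm) $ i) \<partial>gauss \<sigma>) = (\<integral>\<^sup>+x. ennreal (normal_density 0 \<sigma> x) * f x \<partial>lborel)"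
proof -
  interpret prob_space "density lborel (normal_density 0 \<sigma>)"
    by (rule prob_space_normal_density) fact
  have one: "(\<integral>\<^sup>+x. ennreal (normal_density 0 \<sigma> x) \<partial>lborel) = 1"
    using emeasure_space_1 by (simp add: emeasure_density)
  \<comment> \<open>Only the factor at \<open>i\<close> carries \<open>f\<close>; every other factor
    integrates to 1.\<close>
  define F where "F j x = ennreal (normal_density 0 \<sigma> x) * (if j = i then f x else 1)" for j x
  have "(\<integral>\<^sup>+x. f ((x :: real ^ 'm) $ i) \<partial>gauss \<sigma>)
      = (\<integral>\<^sup>+x. (\<Prod>j\<in>UNIV. F j ((x :: real ^ 'm) $ j)) \<partial>lborel)"
    unfolding F_def
    by (subst nn_integral_gauss, simp)
       (intro nn_integral_cong, simp add: prod_ennreal prod.distrib)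
  also have "\<dots> = (\<Prod>j\<in>UNIV. \<integral>\<^sup>+x. F j x \<partial>lborel)"
    by (rule nn_integral_vec_prod) (auto simp: F_def)
  also have "\<dots> = (\<Prod>j\<in>UNIV. if j = i then (\<integral>\<^sup>+x. ennreal (normal_density 0 \<sigma> x) * f x \<partial>lborel) else 1)"
    by (intro prod.cong) (auto simp: F_def one)
  finally show ?thesis by simp
qed

lemma prob_space_gauss: "\<sigma> > 0 \<Longrightarrow> prob_space (gauss \<sigma> :: (real ^ 'm) measure)"
proof
  assume "\<sigma> > 0"
  interpret prob_space "density lborel (normal_density 0 \<sigma>)"
    by (rule prob_space_normal_density) fact
  have "(\<integral>\<^sup>+x. 1 \<partial>(gauss \<sigma> :: (real ^ 'm) measure)) = 1"
    using nn_integral_gauss_coord[of "\<lambda>_. 1" \<sigma>] \<open>\<sigma> > 0\<close> emeasure_space_1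
    by (simp add: emeasure_density)
  then show "emeasure (gauss \<sigma>) (space (gauss \<sigma> :: (real ^ 'm) measure)) = 1"
    by simp
qed

text \<open>One factor per coordinate, so that the same change of variables serves the dilation in
  \<open>nn_integral_gauss_scale\<close> and the sign changes in
  \<open>gauss_reflect\<close>.\<close>

lemma nn_integral_lborel_vec_scale:
  fixes f :: "real ^ 'm \<Rightarrow> ennreal" and c :: "'m \<Rightarrow> real"
  assumes [measurable]: "f \<in> borel_measurable borel" and c: "\<And>i. c i \<noteq> 0"
  shows "(\<integral>\<^sup>+x. f x \<partial>lborel) = ennreal (\<Prod>i\<in>UNIV. \<bar>c i\<bar>) * (\<integral>\<^sup>+x. f (\<chi> i. c i * x $ i) \<partial>lborel)"
proof -
  have ax: "axis_index (axis i 1 :: real ^ 'm) = i" for i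
    using axis_index_axis by metis
  have T: "(0 + (\<Sum>j\<in>Basis. (c (axis_index j) * (x \<bullet> j)) *\<^sub>R j)) = (\<chi> i. c i * x $ i)" for x :: "real ^ 'm"
    by (simp add: sum_Basis_vec ax inner_axis vec_eq_iff)
       (simp add: axis_def if_distrib cong: if_cong)
  have m [measurable]: "(\<lambda>x :: real ^ 'm. \<chi> i. c i * x $ i) \<in> borel_measurable borel"
    by (intro borel_measurable_continuous_onI continuous_intros)
  have D: "lborel = density (distr lborel borel (\<lambda>x :: real ^ 'm. \<chi> i. c i * x $ i)) (\<lambda>_. ennreal (\<Prod>i\<in>UNIV. \<bar>c i\<bar>))"
    using lborel_affine_euclidean[of "\<lambda>b. c (axis_index b)" "0 :: real ^ 'm"] c
    by (simp add: T[simplified] prod_Basis_vec ax)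
  have "(\<integral>\<^sup>+x. f x \<partial>lborel) = (\<integral>\<^sup>+x. f x \<partial>density (distr lborel borel (\<lambda>x :: real ^ 'm. \<chi> i. c i * x $ i)) (\<lambda>_. ennreal (\<Prod>i\<in>UNIV. \<bar>c i\<bar>)))"
    using D by simp
  also have "\<dots> = ennreal (\<Prod>i\<in>UNIV. \<bar>c i\<bar>) * (\<integral>\<^sup>+x. f (\<chi> i. c i * x $ i) \<partial>lborel)"
    by (simp add: nn_integral_density nn_integral_distr nn_integral_cmult)
  finally show ?thesis .
qed

lemma nn_integral_gauss_scale:
  fixes f :: "real ^ 'm \<Rightarrow> ennreal"
  assumes [measurable]: "f \<in> borel_measurable borel" and \<sigma>: "\<sigma> > 0"
  shows "(\<integral>\<^sup>+x. f x \<partial>gauss \<sigma>) = (\<integral>\<^sup>+x. f (\<sigma> *\<^sub>R x) \<partial>gauss 1)"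
proof -
  have dens: "\<sigma> * normal_density 0 \<sigma> (\<sigma> * y) = normal_density 0 1 y" for y
    using \<sigma> by (simp add: normal_density_def real_sqrt_mult power_mult_distrib)
  have "(\<integral>\<^sup>+x. f x \<partial>gauss \<sigma>)
      = ennreal (\<Prod>i\<in>(UNIV::'m set). \<bar>\<sigma>\<bar>) * (\<integral>\<^sup>+x. ennreal (\<Prod>i\<in>UNIV. normal_density 0 \<sigma> (\<sigma> * x $ i)) * f (\<sigma> *\<^sub>R x) \<partial>lborel)"
    using \<sigma> by (subst nn_integral_gauss, simp, subst nn_integral_lborel_vec_scale[where c="\<lambda>_. \<sigma>"])
      (auto simp: scaleR_vec_def)
  also have "\<dots> = (\<integral>\<^sup>+x. ennreal (\<Prod>i\<in>(UNIV::'m set). \<bar>\<sigma>\<bar>) * (ennreal (\<Prod>i\<in>UNIV. normal_density 0 \<sigma> (\<sigma> * x $ i)) * f (\<sigma> *\<^sub>R x)) \<partial>lborel)"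
    by (subst nn_integral_cmult) auto
  also have "\<dots> = (\<integral>\<^sup>+x. ennreal (\<Prod>i\<in>UNIV. normal_density 0 1 (x $ i)) * f (\<sigma> *\<^sub>R x) \<partial>lborel)"
  proof (intro nn_integral_cong)
    fix x :: "real ^ 'm"
    have "ennreal (\<Prod>i\<in>(UNIV::'m set). \<bar>\<sigma>\<bar>) * ennreal (\<Prod>i\<in>UNIV. normal_density 0 \<sigma> (\<sigma> * x $ i))
      = ennreal (\<Prod>i\<in>UNIV. normal_density 0 1 (x $ i))"
      using \<sigma> by (subst ennreal_mult[symmetric])
        (auto simp: prod_nonneg prod.distrib[symmetric] dens[symmetric] simp del: prod_constant)
    then show "ennreal (\<Prod>i\<in>(UNIV::'m set). \<bar>\<sigma>\<bar>) * (ennreal (\<Prod>i\<in>UNIV. normal_density 0 \<sigma> (\<sigma> * x $ i)) * f (\<sigma> *\<^sub>R x))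
       = ennreal (\<Prod>i\<in>UNIV. normal_density 0 1 (x $ i)) * f (\<sigma> *\<^sub>R x)"
      by (simp add: mult.assoc[symmetric])
  qed
  also have "\<dots> = (\<integral>\<^sup>+x. f (\<sigma> *\<^sub>R x) \<partial>gauss 1)"
    by (subst nn_integral_gauss) auto
  finally show ?thesis .
qed

lemma gauss_scale: "\<sigma> > 0 \<Longrightarrow> gauss \<sigma> = distr (gauss 1) borel (\<lambda>x :: real ^ 'm. \<sigma> *\<^sub>R x)"
proof (rule measure_eqI)
  fix A :: "(real ^ 'm) set"
  assume \<sigma>: "\<sigma> > 0" and "A \<in> sets (gauss \<sigma>)"
  then have [measurable]: "A \<in> sets borel" by simp
  have "emeasure (gauss \<sigma>) A = (\<integral>\<^sup>+x. indicator A x \<partial>gauss \<sigma>)"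
    by simp
  also have "\<dots> = (\<integral>\<^sup>+x. indicator A (\<sigma> *\<^sub>R x) \<partial>gauss 1)"
    by (rule nn_integral_gauss_scale) (use \<sigma> in auto)
  also have "\<dots> = (\<integral>\<^sup>+x. indicator A x \<partial>distr (gauss 1) borel (\<lambda>x :: real ^ 'm. \<sigma> *\<^sub>R x))"
    by (subst nn_integral_distr) auto
  finally show "emeasure (gauss \<sigma>) A = emeasure (distr (gauss 1) borel (\<lambda>x :: real ^ 'm. \<sigma> *\<^sub>R x)) A"
    by simp
qed simp

text \<open>Sign changes stand in for the computation of mixed moments: flipping all signs kills odd
  moments, flipping a single one isolates a coordinate in
  \<open>integral_gauss_inner_sq\<close>.\<close>

lemma gauss_reflect:
  fixes c :: "'m::finite \<Rightarrow> real"
  assumes c: "\<And>i. \<bar>c i\<bar> = 1"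
  shows "distr (gauss \<sigma>) borel (\<lambda>x. \<chi> i. c i * x $ i) = gauss \<sigma>"
proof (rule measure_eqI)
  fix A :: "(real ^ 'm) set"
  assume "A \<in> sets (distr (gauss \<sigma>) borel (\<lambda>x. \<chi> i. c i * x $ i))"
  then have [measurable]: "A \<in> sets borel" by simp
  have m [measurable]: "(\<lambda>x :: real ^ 'm. \<chi> i. c i * x $ i) \<in> borel_measurable borel"
    by (intro borel_measurable_continuous_onI continuous_intros)
  have dens: "normal_density 0 \<sigma> (c i * y) = normal_density 0 \<sigma> y" for i y
    using c[of i] by (auto simp: normal_density_def abs_if split: if_splits)
  have "c i \<noteq> 0" for i using c[of i] by auto
  then have "emeasure (gauss \<sigma>) A = (\<integral>\<^sup>+x. ennreal (\<Prod>i\<in>UNIV. normal_density 0 \<sigma> (c i * x $ i)) * indicator A (\<chi> i. c i * x $ i) \<partial>lborel)"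
    by (subst nn_integral_indicator[symmetric], simp)
       (subst nn_integral_gauss, simp, subst nn_integral_lborel_vec_scale[where c=c], auto simp: c)
  also have "\<dots> = (\<integral>\<^sup>+x. indicator A (\<chi> i. c i * x $ i) \<partial>gauss \<sigma>)"
    by (subst nn_integral_gauss) (auto simp: dens)
  also have "\<dots> = (\<integral>\<^sup>+x. indicator A x \<partial>distr (gauss \<sigma>) borel (\<lambda>x. \<chi> i. c i * x $ i))"
    by (subst nn_integral_distr) auto
  finally show "emeasure (distr (gauss \<sigma>) borel (\<lambda>x. \<chi> i. c i * x $ i)) A = emeasure (gauss \<sigma>) A"
    by simp
qed simp

lemma integral_gauss_reflect:
  fixes c :: "'m::finite \<Rightarrow> real" and f :: "real ^ 'm \<Rightarrow> real"
  assumes c: "\<And>i. \<bar>c i\<bar> = 1" and [measurable]: "f \<in> borel_measurable borel"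
  shows "(\<integral>x. f (\<chi> i. c i * x $ i) \<partial>gauss \<sigma>) = (\<integral>x. f x \<partial>gauss \<sigma>)"
proof -
  have m [measurable]: "(\<lambda>x :: real ^ 'm. \<chi> i. c i * x $ i) \<in> borel_measurable borel"
    by (intro borel_measurable_continuous_onI continuous_intros)
  have "(\<integral>x. f x \<partial>distr (gauss \<sigma>) borel (\<lambda>x. \<chi> i. c i * x $ i)) = (\<integral>x. f (\<chi> i. c i * x $ i) \<partial>gauss \<sigma>)"
    by (rule integral_distr) auto
  then show ?thesis
    by (simp add: gauss_reflect[OF c])
qed

lemma integral_gauss_uminus:
  fixes f :: "real ^ 'm \<Rightarrow> real"
  assumes "f \<in> borel_measurable borel"
  shows "(\<integral>x. f (- x) \<partial>gauss \<sigma>) = (\<integral>x. f x \<partial>gauss \<sigma>)"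
  using integral_gauss_reflect[of "\<lambda>_. -1" f \<sigma>] assms by (simp add: uminus_vec_def)

text \<open>A coordinate of largest modulus works. The lossy factor m is harmless, since all
  constants may depend on m.\<close>

lemma norm_le_card_coord:
  fixes x :: "real ^ 'm"
  obtains i where "norm x \<le> real CARD('m) * \<bar>x $ i\<bar>"
proof -
  have "\<exists>i. \<forall>j. \<bar>x $ j\<bar> \<le> \<bar>x $ i\<bar>"
  proof -
    have "Max (range (\<lambda>i. \<bar>x $ i\<bar>)) \<in> range (\<lambda>i. \<bar>x $ i\<bar>)"
      by (rule Max_in) auto
    then obtain i where "Max (range (\<lambda>i. \<bar>x $ i\<bar>)) = \<bar>x $ i\<bar>" by (rule rangeE)
    then show ?thesis by (metis Max_ge finite_class.finite_UNIV finite_imageI rangeI)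
  qed
  then obtain i where i: "\<And>j. \<bar>x $ j\<bar> \<le> \<bar>x $ i\<bar>" by blast
  have "norm x \<le> (\<Sum>j\<in>UNIV. \<bar>x $ j\<bar>)" by (rule norm_le_l1_cart)
  also have "\<dots> \<le> (\<Sum>j\<in>(UNIV::'m set). \<bar>x $ i\<bar>)" by (rule sum_mono) (use i in auto)
  finally show ?thesis using that by simp
qed

text \<open>Comparison with the largest coordinate bounds the power of the norm by a sum of powers
  of single coordinates, whose moments are one-dimensional.\<close>

lemma integrable_gauss_norm_power:
  assumes "\<sigma> > 0"
  shows "integrable (gauss \<sigma>) (\<lambda>x :: real ^ 'm. norm x ^ k)"
proof (rule integrableI_nonneg)
  have fin: "(\<integral>\<^sup>+x. ennreal (\<bar>(x :: real ^ 'm) $ i\<bar> ^ k) \<partial>gauss \<sigma>) < \<infinity>" for i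
  proof -
    have "(\<integral>\<^sup>+x. ennreal (\<bar>(x :: real ^ 'm) $ i\<bar> ^ k) \<partial>gauss \<sigma>)
        = (\<integral>\<^sup>+x. ennreal (normal_density 0 \<sigma> x * \<bar>x\<bar> ^ k) \<partial>lborel)"
      using assms by (subst nn_integral_gauss_coord) (auto simp: ennreal_mult)
    also have "\<dots> < \<infinity>"
      using integrable_normal_moment_abs[OF assms, of 0 k] by (simp add: integrable_iff_bounded)
    finally show ?thesis .
  qed
  have "(\<integral>\<^sup>+x. ennreal (norm (x :: real ^ 'm) ^ k) \<partial>gauss \<sigma>)
      \<le> (\<integral>\<^sup>+x. (\<Sum>i\<in>UNIV. ennreal (real CARD('m) ^ k) * ennreal (\<bar>(x :: real ^ 'm) $ i\<bar> ^ k)) \<partial>gauss \<sigma>)"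
  proof (intro nn_integral_mono)
    fix x :: "real ^ 'm"
    obtain i where i: "norm x \<le> real CARD('m) * \<bar>x $ i\<bar>" by (rule norm_le_card_coord)
    have "norm x ^ k \<le> real CARD('m) ^ k * \<bar>x $ i\<bar> ^ k"
      using power_mono[OF i] by (simp add: power_mult_distrib)
    then have "ennreal (norm x ^ k) \<le> ennreal (real CARD('m) ^ k) * ennreal (\<bar>x $ i\<bar> ^ k)"
      by (simp add: ennreal_mult[symmetric] ennreal_leI)
    also have "\<dots> \<le> (\<Sum>i\<in>UNIV. ennreal (real CARD('m) ^ k) * ennreal (\<bar>x $ i\<bar> ^ k))"
      by (rule member_le_sum) auto
    finally show "ennreal (norm x ^ k) \<le> \<dots>" .
  qed
  also have "\<dots> = (\<Sum>i\<in>UNIV. ennreal (real CARD('m) ^ k) * (\<integral>\<^sup>+x. ennreal (\<bar>(x :: real ^ 'm) $ i\<bar> ^ k) \<partial>gauss \<sigma>))"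
    by (subst nn_integral_sum) (auto simp: nn_integral_cmult)
  also have "\<dots> < \<infinity>"
    using fin by (auto simp: ennreal_mult_less_top)
  finally show "(\<integral>\<^sup>+x. ennreal (norm (x :: real ^ 'm) ^ k) \<partial>gauss \<sigma>) < \<infinity>" .
qed auto

text \<open>Absolute moments of the standard normal vector. They enter the final constant as
  symbols, which is legitimate because that constant may depend on m.\<close>

definition gmom :: "'m::finite itself \<Rightarrow> nat \<Rightarrow> real" where
  "gmom _ k = (\<integral>x. norm (x :: real ^ 'm) ^ k \<partial>gauss 1)"

lemma gmom_nonneg: "0 \<le> gmom TYPE('m::finite) k"
  by (simp add: gmom_def)

lemma integral_gauss_norm_power:
  assumes "\<sigma> > 0"
  shows "(\<integral>x. norm (x :: real ^ 'm) ^ k \<partial>gauss \<sigma>) = \<sigma> ^ k * gmom TYPE('m) k"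
proof -
  have "(\<integral>x. norm (x :: real ^ 'm) ^ k \<partial>gauss \<sigma>) = (\<integral>x. norm (\<sigma> *\<^sub>R (x :: real ^ 'm)) ^ k \<partial>gauss 1)"
    unfolding gauss_scale[OF assms] by (subst integral_distr) auto
  also have "\<dots> = \<sigma> ^ k * gmom TYPE('m) k"
    using assms by (simp add: power_mult_distrib gmom_def)
  finally show ?thesis .
qed

lemma integrable_gauss_bound:
  fixes f :: "real ^ 'm \<Rightarrow> real"
  assumes "\<sigma> > 0" and [measurable]: "f \<in> borel_measurable borel"
    and "\<And>x. \<bar>f x\<bar> \<le> a + b * norm x ^ k"
  shows "integrable (gauss \<sigma>) f"
proof (rule Bochner_Integration.integrable_bound)
  interpret prob_space "gauss \<sigma> :: (real ^ 'm) measure" by (rule prob_space_gauss) fact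
  show "integrable (gauss \<sigma>) (\<lambda>x :: real ^ 'm. a + b * norm x ^ k)"
    using integrable_gauss_norm_power[where 'm='m, OF assms(1), of k] by (intro Bochner_Integration.integrable_add integrable_mult_right) auto
  show "AE x in gauss \<sigma>. norm (f x) \<le> norm (a + b * norm x ^ k)"
    using assms(3) by (intro always_eventually allI) (metis abs_ge_self order_trans real_norm_def)
qed simp

lemma integrable_gauss_coord_sq:
  "\<sigma> > 0 \<Longrightarrow> integrable (gauss \<sigma>) (\<lambda>x :: real ^ 'm. (x $ i)\<^sup>2)"
  by (rule integrable_gauss_bound[where a=0 and b=1 and k=2])
     (auto simp: abs_le_square_iff[symmetric] component_le_norm_cart)

lemma integral_gauss_coord_sq:
  assumes "\<sigma> > 0"
  shows "(\<integral>x. ((x :: real ^ 'm) $ i)\<^sup>2 \<partial>gauss \<sigma>) = \<sigma>\<^sup>2"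
proof -
  have "ennreal (\<integral>x. ((x :: real ^ 'm) $ i)\<^sup>2 \<partial>gauss \<sigma>) = (\<integral>\<^sup>+x. ennreal (((x :: real ^ 'm) $ i)\<^sup>2) \<partial>gauss \<sigma>)"
    by (rule nn_integral_eq_integral[symmetric]) (use integrable_gauss_coord_sq[OF assms] in auto)
  also have "\<dots> = (\<integral>\<^sup>+x. ennreal (normal_density 0 \<sigma> x * x\<^sup>2) \<partial>lborel)"
    using assms nn_integral_gauss_coord[of "\<lambda>x. ennreal (x\<^sup>2)" \<sigma> i] by (auto simp: ennreal_mult)
  also have "\<dots> = ennreal (\<sigma>\<^sup>2)"
    using normal_moment_even[OF assms, of 0 1] assms
    by (subst nn_integral_eq_integral) (auto simp: has_bochner_integral_iff fact_numeral)
  finally show ?thesis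
    by (subst (asm) ennreal_inj) auto
qed

text \<open>Averaging over the reflection of the largest coordinate of \<open>e\<close> avoids computing the
  covariance matrix.\<close>

lemma integral_gauss_inner_sq:
  fixes e :: "real ^ 'm"
  assumes "\<sigma> > 0"
  shows "(norm e)\<^sup>2 * \<sigma>\<^sup>2 \<le> (real CARD('m))\<^sup>2 * (\<integral>x. (e \<bullet> x)\<^sup>2 \<partial>gauss \<sigma>)"
proof -
  obtain i where i: "norm e \<le> real CARD('m) * \<bar>e $ i\<bar>" by (rule norm_le_card_coord)
  define c where "c j = (if j = i then -1 else 1 :: real)" for j
  have int: "integrable (gauss \<sigma>) (\<lambda>x :: real ^ 'm. (u \<bullet> x)\<^sup>2)" for u
    by (rule integrable_gauss_bound[where a=0 and b="(norm u)\<^sup>2" and k=2])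
       (use assms Cauchy_Schwarz_ineq2 in \<open>auto simp: power_mult_distrib[symmetric] abs_le_square_iff[symmetric] abs_mult\<close>)
  have refl: "e \<bullet> (\<chi> j. c j * x $ j) = e \<bullet> x - 2 * (e $ i * x $ i)" for x
  proof -
    have "e \<bullet> (\<chi> j. c j * x $ j) = (\<Sum>j\<in>UNIV. e $ j * x $ j - (if j = i then 2 * (e $ j * x $ j) else 0))"
      by (simp add: inner_vec_def c_def) (intro sum.cong, auto)
    also have "\<dots> = e \<bullet> x - 2 * (e $ i * x $ i)"
      by (simp add: sum_subtractf inner_vec_def)
    finally show ?thesis .
  qed
  have int': "integrable (gauss \<sigma>) (\<lambda>x :: real ^ 'm. (e \<bullet> x - 2 * (e $ i * x $ i))\<^sup>2)"
  proof -
    have "(e \<bullet> x - 2 * (e $ i * x $ i)) = (\<chi> j. c j * e $ j) \<bullet> x" for x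
      unfolding refl[symmetric] by (simp add: inner_vec_def mult.assoc mult.left_commute)
    then show ?thesis using int by simp
  qed
  have eq: "(\<integral>x. (e \<bullet> x - 2 * (e $ i * x $ i))\<^sup>2 \<partial>gauss \<sigma>) = (\<integral>x. (e \<bullet> x)\<^sup>2 \<partial>gauss \<sigma>)"
    using integral_gauss_reflect[of c "\<lambda>x. (e \<bullet> x)\<^sup>2" \<sigma>] unfolding refl by (simp add: c_def)
  have "2 * ((e $ i)\<^sup>2 * \<sigma>\<^sup>2) = (\<integral>x. 2 * ((e $ i)\<^sup>2 * (x $ i)\<^sup>2) \<partial>(gauss \<sigma> :: (real ^ 'm) measure))"
    by (simp add: integral_gauss_coord_sq[OF assms])
  also have "\<dots> \<le> (\<integral>x. (e \<bullet> x)\<^sup>2 + (e \<bullet> x - 2 * (e $ i * x $ i))\<^sup>2 \<partial>gauss \<sigma>)"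
  proof (rule integral_mono)
    fix x :: "real ^ 'm"
    \<comment> \<open>With p = e . x and q = \<open>e $ i * x $ i\<close>: p^2 + (p - 2q)^2 = 2 q^2
      + 2 (p - q)^2.\<close>
    show "2 * ((e $ i)\<^sup>2 * (x $ i)\<^sup>2) \<le> (e \<bullet> x)\<^sup>2 + (e \<bullet> x - 2 * (e $ i * x $ i))\<^sup>2"
      using zero_le_power2[of "e \<bullet> x - e $ i * x $ i"] by (simp add: power2_eq_square algebra_simps)
  qed (use integrable_gauss_coord_sq[OF assms] int int' in auto)
  also have "\<dots> = 2 * (\<integral>x. (e \<bullet> x)\<^sup>2 \<partial>gauss \<sigma>)"
    using int int' by (simp add: eq)
  finally have *: "(e $ i)\<^sup>2 * \<sigma>\<^sup>2 \<le> (\<integral>x. (e \<bullet> x)\<^sup>2 \<partial>gauss \<sigma>)" by simp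
  have "(norm e)\<^sup>2 * \<sigma>\<^sup>2 \<le> (real CARD('m) * \<bar>e $ i\<bar>)\<^sup>2 * \<sigma>\<^sup>2"
    by (intro mult_right_mono power_mono i) auto
  also have "\<dots> = (real CARD('m))\<^sup>2 * ((e $ i)\<^sup>2 * \<sigma>\<^sup>2)"
    by (simp add: power_mult_distrib)
  also have "\<dots> \<le> (real CARD('m))\<^sup>2 * (\<integral>x. (e \<bullet> x)\<^sup>2 \<partial>gauss \<sigma>)"
    by (intro mult_left_mono *) auto
  finally show ?thesis .
qed

section \<open>Survival of a Gaussian chain outside a ball\<close>

text \<open>Probability that the chain X_(i+1) = \<open>a i\<close> X_i + noise of standard
  deviation \<open>s i\<close> per coordinate, started at \<open>x\<close> with index
  \<open>j\<close>, lies in \<open>H (j + 1)\<close>, ..., \<open>H (j + k)\<close>. The starting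
  point itself is not tested. Brownian motion on a grid has all \<open>a i\<close> equal to 1; run
  backwards from its endpoint it has \<open>a i < 1\<close>.\<close>

primrec surv :: "(nat \<Rightarrow> real) \<Rightarrow> (nat \<Rightarrow> real) \<Rightarrow> (nat \<Rightarrow> (real ^ 'm) set) \<Rightarrow> nat \<Rightarrow> nat \<Rightarrow> real ^ 'm \<Rightarrow> ennreal" where
  "surv a s H 0 = (\<lambda>j x. 1)"
| "surv a s H (Suc k) = (\<lambda>j x. \<integral>\<^sup>+\<xi>. indicator (H (Suc j)) (a j *\<^sub>R x + \<xi>) *
      surv a s H k (Suc j) (a j *\<^sub>R x + \<xi>) \<partial>gauss (s j))"

lemma measurable_surv:
  fixes H :: "nat \<Rightarrow> (real ^ 'm) set"
  assumes s: "\<And>i. i < n \<Longrightarrow> s i > 0" and H [measurable]: "\<And>i. H i \<in> sets borel" and "j + k \<le> n"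
  shows "surv a s H k j \<in> borel_measurable borel"
  using assms(3)
proof (induction k arbitrary: j)
  case (Suc k)
  then have [measurable]: "surv a s H k (Suc j) \<in> borel_measurable borel" by simp
  interpret prob_space "gauss (s j) :: (real ^ 'm) measure"
    using Suc.prems s by (intro prob_space_gauss) auto
  show ?case by simp
qed simp

lemma surv_le_1:
  fixes H :: "nat \<Rightarrow> (real ^ 'm) set"
  assumes s: "\<And>i. i < n \<Longrightarrow> s i > 0" and "j + k \<le> n"
  shows "surv a s H k j x \<le> 1"
  using assms(2)
proof (induction k arbitrary: j x)
  case (Suc k)
  interpret prob_space "gauss (s j) :: (real ^ 'm) measure"
    using Suc.prems s by (intro prob_space_gauss) auto
  have "surv a s H (Suc k) j x \<le> (\<integral>\<^sup>+\<xi>. 1 \<partial>(gauss (s j) :: (real ^ 'm) measure))"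
    unfolding surv.simps
  proof (rule nn_integral_mono)
    fix \<xi> :: "real ^ 'm"
    show "indicator (H (Suc j)) (a j *\<^sub>R x + \<xi>) * surv a s H k (Suc j) (a j *\<^sub>R x + \<xi>) \<le> 1"
      using Suc.IH[of "Suc j"] Suc.prems by (cases "a j *\<^sub>R x + \<xi> \<in> H (Suc j)") auto
  qed
  also have "\<dots> = 1" using emeasure_space_1 by simp
  finally show ?case .
qed simp

section \<open>Increments of the squared distance to the centre of a ball\<close>

lemma power4_sum3_le:
  fixes a b c :: real
  shows "(a + b + c) ^ 4 \<le> 27 * (a ^ 4 + b ^ 4 + c ^ 4)"
proof -
  have s: "(x + y + z)\<^sup>2 \<le> 3 * (x\<^sup>2 + y\<^sup>2 + z\<^sup>2)" for x y z :: real
    using zero_le_power2[of "x - y"] zero_le_power2[of "y - z"] zero_le_power2[of "x - z"]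
    by (simp add: power2_eq_square algebra_simps)
  have "(a + b + c) ^ 4 = ((a + b + c)\<^sup>2)\<^sup>2" by simp
  also have "\<dots> \<le> (3 * (a\<^sup>2 + b\<^sup>2 + c\<^sup>2))\<^sup>2" by (rule power_mono[OF s]) simp
  also have "\<dots> \<le> 9 * (3 * ((a\<^sup>2)\<^sup>2 + (b\<^sup>2)\<^sup>2 + (c\<^sup>2)\<^sup>2))"
    using s[of "a\<^sup>2" "b\<^sup>2" "c\<^sup>2"] unfolding power_mult_distrib by simp
  finally show ?thesis by simp
qed

text \<open>If \<open>e\<close> is the position relative to the centre before the noise
  \<open>x\<close> is added, the squared distance grows by 2 e . x + |x|^2; \<open>d\<close> is the
  deterministic remainder. The lower bound on the second moment is the noise that drives the chain
  into the ball. With \<open>d\<close> and \<open>\<sigma>\<^sup>2\<close> of the order of the step,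
  the fourth moment is of second order.\<close>

lemma
  fixes e :: "real ^ 'm" and d \<sigma> :: real
  assumes \<sigma>: "\<sigma> > 0"
  defines "\<Delta> \<equiv> \<lambda>x. d + 2 * (e \<bullet> x) + (norm x)\<^sup>2"
  shows integrable_increment: "integrable (gauss \<sigma>) \<Delta>" "integrable (gauss \<sigma>) (\<lambda>x. (\<Delta> x)\<^sup>2)" "integrable (gauss \<sigma>) (\<lambda>x. \<Delta> x ^ 4)"
    and increment_moment1: "(\<integral>x. \<Delta> x \<partial>gauss \<sigma>) = d + \<sigma>\<^sup>2 * gmom TYPE('m) 2"
    and increment_moment2: "4 * (norm e)\<^sup>2 * \<sigma>\<^sup>2 / (real CARD('m))\<^sup>2 \<le> (\<integral>x. (\<Delta> x)\<^sup>2 \<partial>gauss \<sigma>)"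
    and increment_moment4: "(\<integral>x. \<Delta> x ^ 4 \<partial>gauss \<sigma>) \<le>
           27 * (d ^ 4 + 16 * norm e ^ 4 * (\<sigma> ^ 4 * gmom TYPE('m) 4) + \<sigma> ^ 8 * gmom TYPE('m) 8)"
proof -
  interpret prob_space "gauss \<sigma> :: (real ^ 'm) measure" by (rule prob_space_gauss) fact
  have [measurable]: "\<Delta> \<in> borel_measurable borel" unfolding \<Delta>_def by measurable
  note N = integrable_gauss_norm_power[where 'm='m, OF \<sigma>]
  have ip: "integrable (gauss \<sigma>) (\<lambda>x. e \<bullet> x)"
    by (rule integrable_gauss_bound[where a=0 and b="norm e" and k=1])
       (use \<sigma> Cauchy_Schwarz_ineq2 in auto)
  have b4: "\<Delta> x ^ 4 \<le> 27 * (d ^ 4 + 16 * norm e ^ 4 * norm x ^ 4 + norm x ^ 8)" for x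
  proof -
    have "(2 * (e \<bullet> x)) ^ 4 = \<bar>2 * (e \<bullet> x)\<bar> ^ 4" by simp
    also have "\<dots> \<le> (2 * (norm e * norm x)) ^ 4"
      using Cauchy_Schwarz_ineq2[of e x] by (intro power_mono) (auto simp: abs_mult)
    finally have "(2 * (e \<bullet> x)) ^ 4 \<le> 16 * norm e ^ 4 * norm x ^ 4"
      by (simp add: power_mult_distrib)
    moreover have "((norm x)\<^sup>2) ^ 4 = norm x ^ 8" by (simp add: power_mult[symmetric])
    ultimately show ?thesis
      using power4_sum3_le[of d "2 * (e \<bullet> x)" "(norm x)\<^sup>2"] unfolding \<Delta>_def by simp
  qed
  have I4: "integrable (gauss \<sigma>) (\<lambda>x :: real ^ 'm. 27 * (d ^ 4 + 16 * norm e ^ 4 * norm x ^ 4 + norm x ^ 8))"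
    by (intro Bochner_Integration.integrable_add integrable_mult_right N) auto
  show i4: "integrable (gauss \<sigma>) (\<lambda>x. \<Delta> x ^ 4)"
    by (rule Bochner_Integration.integrable_bound[OF I4])
       (use b4 in \<open>auto intro!: always_eventually intro: order_trans[OF _ abs_ge_self]\<close>)
  have x24: "\<bar>u\<bar> \<le> 1 + u ^ 4" "u\<^sup>2 \<le> 1 + u ^ 4" for u :: real
  proof -
    have u4: "u ^ 4 = (u\<^sup>2)\<^sup>2" by simp
    show A: "u\<^sup>2 \<le> 1 + u ^ 4"
      using zero_le_power2[of "u\<^sup>2 - 1"] zero_le_power2[of u] unfolding u4 power2_diff by (smt (verit) mult_1_right one_power2)
    have "2 * \<bar>u\<bar> \<le> 1 + u\<^sup>2" using zero_le_power2[of "\<bar>u\<bar> - 1"] by (simp add: power2_diff)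
    moreover have "2 * u\<^sup>2 \<le> 1 + u ^ 4" 
      using zero_le_power2[of "u\<^sup>2 - 1"] unfolding u4 power2_diff by simp
    ultimately show "\<bar>u\<bar> \<le> 1 + u ^ 4" using zero_le_power2[of "u\<^sup>2"] unfolding u4 by linarith
  qed
  have I14: "integrable (gauss \<sigma>) (\<lambda>x. 1 + \<Delta> x ^ 4)" using i4 by auto
  show i1: "integrable (gauss \<sigma>) \<Delta>"
    by (rule Bochner_Integration.integrable_bound[OF I14])
       (use x24 in \<open>auto intro!: always_eventually intro: order_trans[OF _ abs_ge_self]\<close>)
  show i2: "integrable (gauss \<sigma>) (\<lambda>x. (\<Delta> x)\<^sup>2)"
    by (rule Bochner_Integration.integrable_bound[OF I14])
       (use x24 in \<open>auto intro!: always_eventually intro: order_trans[OF _ abs_ge_self]\<close>)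
  have e0: "(\<integral>x. e \<bullet> x \<partial>gauss \<sigma>) = 0"
    using integral_gauss_uminus[of "\<lambda>x. e \<bullet> x" \<sigma>] by simp
  show "(\<integral>x. \<Delta> x \<partial>gauss \<sigma>) = d + \<sigma>\<^sup>2 * gmom TYPE('m) 2"
    using ip N[of 2] prob_space integral_gauss_norm_power[where 'm='m, OF \<sigma>, of 2]
    unfolding \<Delta>_def by (simp add: e0)
  show "(\<integral>x. \<Delta> x ^ 4 \<partial>gauss \<sigma>) \<le>
           27 * (d ^ 4 + 16 * norm e ^ 4 * (\<sigma> ^ 4 * gmom TYPE('m) 4) + \<sigma> ^ 8 * gmom TYPE('m) 8)"
  proof -
    have "(\<integral>x. \<Delta> x ^ 4 \<partial>gauss \<sigma>) \<le> (\<integral>x. 27 * (d ^ 4 + 16 * norm e ^ 4 * norm x ^ 4 + norm (x :: real ^ 'm) ^ 8) \<partial>gauss \<sigma>)"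
      by (rule integral_mono[OF i4 I4]) (rule b4)
    also have "\<dots> = 27 * (d ^ 4 + 16 * norm e ^ 4 * (\<sigma> ^ 4 * gmom TYPE('m) 4) + \<sigma> ^ 8 * gmom TYPE('m) 8)"
      using N prob_space integral_gauss_norm_power[where 'm='m, OF \<sigma>] by simp
    finally show ?thesis .
  qed
  show "4 * (norm e)\<^sup>2 * \<sigma>\<^sup>2 / (real CARD('m))\<^sup>2 \<le> (\<integral>x. (\<Delta> x)\<^sup>2 \<partial>gauss \<sigma>)"
  proof -
    have isq: "integrable (gauss \<sigma>) (\<lambda>x :: real ^ 'm. (e \<bullet> x)\<^sup>2)"
      by (rule integrable_gauss_bound[where a=0 and b="(norm e)\<^sup>2" and k=2])
         (use assms Cauchy_Schwarz_ineq2 in \<open>auto simp: power_mult_distrib[symmetric] abs_le_square_iff[symmetric] abs_mult\<close>)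
    have "distr (gauss \<sigma>) borel uminus = (gauss \<sigma> :: (real ^ 'm) measure)"
      using gauss_reflect[where 'm='m, of "\<lambda>_. -1" \<sigma>] by (simp add: uminus_vec_def)
    then have i2': "integrable (gauss \<sigma>) (\<lambda>x. (\<Delta> (- x))\<^sup>2)"
      using i2 integrable_distr[of "uminus" "gauss \<sigma>" borel "\<lambda>x :: real ^ 'm. (\<Delta> x)\<^sup>2"] by auto
    \<comment> \<open>Averaging over x and -x removes the odd cross terms between e . x and the
      rest, which have no sign.\<close>
    have "8 * (\<integral>x. (e \<bullet> x)\<^sup>2 \<partial>gauss \<sigma>) = (\<integral>x. 8 * (e \<bullet> x)\<^sup>2 \<partial>gauss \<sigma>)" by simp
    also have "\<dots> \<le> (\<integral>x. (\<Delta> x)\<^sup>2 + (\<Delta> (- x))\<^sup>2 \<partial>gauss \<sigma>)"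
    proof (rule integral_mono)
      fix x :: "real ^ 'm"
      have "(\<Delta> x)\<^sup>2 + (\<Delta> (- x))\<^sup>2 = 8 * (e \<bullet> x)\<^sup>2 + 2 * (d + (norm x)\<^sup>2)\<^sup>2"
        unfolding \<Delta>_def by (simp add: power2_eq_square algebra_simps)
      then show "8 * (e \<bullet> x)\<^sup>2 \<le> (\<Delta> x)\<^sup>2 + (\<Delta> (- x))\<^sup>2" by simp
    qed (use isq i2 i2' in auto)
    also have "\<dots> = 2 * (\<integral>x. (\<Delta> x)\<^sup>2 \<partial>gauss \<sigma>)"
      using i2 i2' integral_gauss_uminus[of "\<lambda>x. (\<Delta> x)\<^sup>2" \<sigma>] by simp
    finally have "4 * (\<integral>x. (e \<bullet> x)\<^sup>2 \<partial>gauss \<sigma>) \<le> (\<integral>x. (\<Delta> x)\<^sup>2 \<partial>gauss \<sigma>)" by simp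
    moreover have "(norm e)\<^sup>2 * \<sigma>\<^sup>2 / (real CARD('m))\<^sup>2 \<le> (\<integral>x. (e \<bullet> x)\<^sup>2 \<partial>gauss \<sigma>)"
      using integral_gauss_inner_sq[OF \<sigma>, of e] by (simp add: divide_le_eq mult.commute)
    moreover have "4 * (norm e)\<^sup>2 * \<sigma>\<^sup>2 / (real CARD('m))\<^sup>2 = 4 * ((norm e)\<^sup>2 * \<sigma>\<^sup>2 / (real CARD('m))\<^sup>2)"
      by simp
    ultimately show ?thesis by linarith
  qed
qed

text \<open>Concave, with zeros at 0 and 3 and value 1 at 1 and 2. The argument is the height above
  the ball divided by \<open>r\<close>; the chain matters up to argument 1, and the interval from 1
  to 2 absorbs the overshoot. The second derivative -1 turns the second moment of the height
  increments into a decrease.\<close>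

definition barrier :: "real \<Rightarrow> real" where
  "barrier w = (3 * w - w\<^sup>2) / 2"

lemma barrier_nonneg: "0 \<le> w \<Longrightarrow> w \<le> 3 \<Longrightarrow> 0 \<le> barrier w"
proof -
  assume "0 \<le> w" "w \<le> 3"
  then have "0 \<le> w * (3 - w)" by simp
  then show ?thesis by (simp add: barrier_def power2_eq_square algebra_simps)
qed

lemma barrier_le: "0 \<le> w \<Longrightarrow> barrier w \<le> 2 * w"
proof -
  assume "0 \<le> w"
  then have "0 \<le> (w + w\<^sup>2) / 2" by simp
  moreover have "barrier w = 2 * w - (w + w\<^sup>2) / 2" by (simp add: barrier_def field_simps)
  ultimately show ?thesis by simp
qed

lemma barrier_ge_1: "1 \<le> w \<Longrightarrow> w \<le> 2 \<Longrightarrow> 1 \<le> barrier w"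
proof -
  assume "1 \<le> w" "w \<le> 2"
  then have "0 \<le> (w - 1) * (2 - w)" by simp
  then show ?thesis by (simp add: barrier_def power2_eq_square algebra_simps)
qed

lemma barrier_add:
  "barrier (w + t) = barrier w + (3 / 2 - w) * t - t\<^sup>2 / 2"
  by (simp add: barrier_def power2_eq_square field_simps)

text \<open>Jumps larger than \<open>\<eta>\<close> may leave the region where the quadratic is nonnegative; they are
  paid for by the fourth moment, which is of second order in the step size.\<close>

lemma barrier_step:
  fixes e :: "real ^ 'm" and d \<sigma> :: real and f :: "real ^ 'm \<Rightarrow> ennreal"
  defines "\<Delta> \<equiv> \<lambda>x. d + 2 * (e \<bullet> x) + (norm x)\<^sup>2"
  assumes \<sigma>: "\<sigma> > 0" "\<sigma>\<^sup>2 \<le> \<delta>" and \<delta>: "\<delta> \<le> 1" and r: "0 < r" and h: "0 < h"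
    and \<eta>: "0 < \<eta>" "\<eta> \<le> r / 2" and z: "0 \<le> z" "z \<le> r" and M: "0 \<le> M"
    and d: "d + \<sigma>\<^sup>2 * gmom TYPE('m) 2 \<le> M * \<delta>" "\<bar>d\<bar> \<le> M * \<delta>"
    and e: "V * \<delta> \<le> 4 * (norm e)\<^sup>2 * \<sigma>\<^sup>2 / (real CARD('m))\<^sup>2" "norm e \<le> E"
    and V: "6 * M * r \<le> V" "8 * r\<^sup>2 \<le> V * h"
    and C: "C = 1 / \<eta> ^ 4 + 3 / (2 * r * \<eta> ^ 3) + 1 / (2 * r\<^sup>2 * \<eta>\<^sup>2)"
       "C * (27 * (M ^ 4 + 16 * E ^ 4 * gmom TYPE('m) 4 + gmom TYPE('m) 8)) * \<delta> \<le> 1 / h"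
    and P: "0 \<le> P" "P \<le> 1"
    and f1: "\<And>x. f x \<le> 1"
    and f2: "\<And>x. \<bar>\<Delta> x\<bar> < \<eta> \<Longrightarrow> f x \<le> ennreal (barrier ((z + \<Delta> x + \<eta>) / r) + P)"
  shows "(\<integral>\<^sup>+x. f x \<partial>gauss \<sigma>) \<le> ennreal (barrier ((z + \<eta>) / r) + P - \<delta> / h)"
proof -
  interpret prob_space "gauss \<sigma> :: (real ^ 'm) measure" by (rule prob_space_gauss) fact
  have I: "integrable (gauss \<sigma>) \<Delta>" "integrable (gauss \<sigma>) (\<lambda>x. (\<Delta> x)\<^sup>2)" "integrable (gauss \<sigma>) (\<lambda>x. \<Delta> x ^ 4)"
    unfolding \<Delta>_def by (rule integrable_increment[OF \<sigma>(1)])+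
  have \<delta>0: "0 < \<delta>" using \<sigma> by (smt (verit) zero_less_power)
  define w where "w = (z + \<eta>) / r"
  \<comment> \<open>Up to 3/2 the slope \<open>3 / 2 - w\<close> of the barrier is nonnegative, so
    an upper bound on the mean increment is enough.\<close>
  have w: "0 \<le> w" "w \<le> 3 / 2" using z \<eta> r by (auto simp: w_def field_simps)
  have C0: "C \<ge> 0" unfolding C(1) using r \<eta> by auto
  \<comment> \<open>The exact expansion of the barrier, plus a multiple of the fourth power large
    enough that \<open>g\<close> stays nonnegative and dominates \<open>f\<close> for large jumps
    too.\<close>
  define g where "g x = barrier w + (3 / 2 - w) * (\<Delta> x / r) - (\<Delta> x / r)\<^sup>2 / 2 + P + C * \<Delta> x ^ 4" for x
  have bw: "barrier ((z + \<Delta> x + \<eta>) / r) = barrier w + (3 / 2 - w) * (\<Delta> x / r) - (\<Delta> x / r)\<^sup>2 / 2" for x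
    using barrier_add[of w "\<Delta> x / r"] r by (simp add: w_def field_simps)
  have g: "0 \<le> g x \<and> f x \<le> ennreal (g x)" for x
  proof (cases "\<bar>\<Delta> x\<bar> < \<eta>")
    case True
    have "0 \<le> barrier ((z + \<Delta> x + \<eta>) / r)"
      using True z \<eta> r by (intro barrier_nonneg) (auto simp: field_simps)
    moreover have "0 \<le> C * \<Delta> x ^ 4" using C0 by simp
    ultimately show ?thesis
      using f2[OF True] P unfolding g_def bw by (auto intro: order_trans ennreal_leI)
  next
    case False
    define u where "u = \<bar>\<Delta> x\<bar>"
    have u: "u \<ge> \<eta>" "u > 0" using False \<eta> by (auto simp: u_def)
    have u4: "\<Delta> x ^ 4 = u ^ 4" by (simp add: u_def)
    \<comment> \<open>The three summands of \<open>C\<close> are made for this case: as u is at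
      least \<open>\<eta>\<close>, they dominate in turn the value 1, the linear and the quadratic
      term.\<close>
    have p4: "1 \<le> 1 / \<eta> ^ 4 * u ^ 4"
      using power_mono[OF u(1), of 4] \<eta> by (simp add: field_simps)
    have p3: "3 / 2 * (u / r) \<le> 3 / (2 * r * \<eta> ^ 3) * u ^ 4"
    proof -
      have "u * \<eta> ^ 3 \<le> u * u ^ 3" using power_mono[OF u(1), of 3] \<eta> u by (intro mult_left_mono) auto
      then show ?thesis using \<eta> r by (simp add: field_simps power_numeral_reduce)
    qed
    have p2: "(\<Delta> x / r)\<^sup>2 / 2 \<le> 1 / (2 * r\<^sup>2 * \<eta>\<^sup>2) * u ^ 4"
    proof -
      have "u\<^sup>2 * \<eta>\<^sup>2 \<le> u\<^sup>2 * u\<^sup>2" using power_mono[OF u(1), of 2] \<eta> u by (intro mult_left_mono) auto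
      moreover have "(\<Delta> x)\<^sup>2 = u\<^sup>2" by (simp add: u_def)
      ultimately show ?thesis using \<eta> r by (simp add: field_simps power_divide)
    qed
    have p1: "- (3 / 2 * (u / r)) \<le> (3 / 2 - w) * (\<Delta> x / r)"
    proof -
      have "\<bar>(3 / 2 - w) * (\<Delta> x / r)\<bar> \<le> 3 / 2 * (u / r)"
        unfolding abs_mult using w r by (intro mult_mono) (auto simp: u_def abs_divide)
      then show ?thesis using abs_le_D2 minus_le_iff by blast
    qed
    have "0 \<le> barrier w" using w by (intro barrier_nonneg) auto
    have "C * \<Delta> x ^ 4 = 1 / \<eta> ^ 4 * u ^ 4 + 3 / (2 * r * \<eta> ^ 3) * u ^ 4 + 1 / (2 * r\<^sup>2 * \<eta>\<^sup>2) * u ^ 4"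
      unfolding u4 C(1) by (simp only: distrib_right)
    then have "1 \<le> g x" unfolding g_def using p1 p2 p3 p4 P \<open>0 \<le> barrier w\<close> by linarith
    then show ?thesis using f1[of x] by (auto intro: order_trans simp: ennreal_ge_1)
  qed
  have ig: "integrable (gauss \<sigma>) g"
    unfolding g_def power_divide
    by (intro Bochner_Integration.integrable_add Bochner_Integration.integrable_diff integrable_mult_right integrable_divide I) auto
  have m4: "(\<integral>x. \<Delta> x ^ 4 \<partial>gauss \<sigma>) \<le> 27 * (M ^ 4 + 16 * E ^ 4 * gmom TYPE('m) 4 + gmom TYPE('m) 8) * \<delta>\<^sup>2"
  proof -
    have s4: "\<sigma> ^ 4 \<le> \<delta>\<^sup>2" using power_mono[OF \<sigma>(2), of 2] by simp
    have d4: "\<delta> ^ 4 \<le> \<delta>\<^sup>2" using \<delta> \<delta>0 by (intro power_decreasing) auto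
    have s8: "\<sigma> ^ 8 \<le> \<delta>\<^sup>2" using power_mono[OF \<sigma>(2), of 4] d4 by simp
    have "d ^ 4 \<le> (M * \<delta>) ^ 4" using power_mono[OF d(2), of 4] by simp
    also have "\<dots> \<le> M ^ 4 * \<delta>\<^sup>2" using d4 M by (auto simp: power_mult_distrib intro!: mult_left_mono)
    finally have 1: "d ^ 4 \<le> M ^ 4 * \<delta>\<^sup>2" .
    have 2: "16 * norm e ^ 4 * (\<sigma> ^ 4 * gmom TYPE('m) 4) \<le> 16 * E ^ 4 * (\<delta>\<^sup>2 * gmom TYPE('m) 4)"
      using e s4 by (intro mult_mono power_mono mult_right_mono) (auto simp: gmom_nonneg)
    have 3: "\<sigma> ^ 8 * gmom TYPE('m) 8 \<le> \<delta>\<^sup>2 * gmom TYPE('m) 8"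
      using s8 by (intro mult_right_mono) (auto simp: gmom_nonneg)
    show ?thesis
      using increment_moment4[OF \<sigma>(1), of d e] 1 2 3 unfolding \<Delta>_def by (simp add: algebra_simps)
  qed
  have "(\<integral>x. g x \<partial>gauss \<sigma>) = barrier w + (3 / 2 - w) * ((\<integral>x. \<Delta> x \<partial>gauss \<sigma>) / r)
      - ((\<integral>x. (\<Delta> x)\<^sup>2 \<partial>gauss \<sigma>) / r\<^sup>2) / 2 + P + C * (\<integral>x. \<Delta> x ^ 4 \<partial>gauss \<sigma>)"
    unfolding g_def power_divide using I prob_space
    by (subst Bochner_Integration.integral_add Bochner_Integration.integral_diff; simp)+
  also have "\<dots> \<le> barrier w + 3 / 2 * (M * \<delta> / r) - (V * \<delta> / r\<^sup>2) / 2 + P + \<delta> / h"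
  proof -
    have "(3 / 2 - w) * ((\<integral>x. \<Delta> x \<partial>gauss \<sigma>) / r) \<le> (3 / 2 - w) * (M * \<delta> / r)"
      using d(1) increment_moment1[OF \<sigma>(1), of d e] w r unfolding \<Delta>_def
      by (intro mult_left_mono divide_right_mono) auto
    also have "\<dots> \<le> 3 / 2 * (M * \<delta> / r)"
      using w r M \<delta>0 by (intro mult_right_mono) auto
    finally have 1: "(3 / 2 - w) * ((\<integral>x. \<Delta> x \<partial>gauss \<sigma>) / r) \<le> 3 / 2 * (M * \<delta> / r)" .
    have 2: "V * \<delta> / r\<^sup>2 \<le> (\<integral>x. (\<Delta> x)\<^sup>2 \<partial>gauss \<sigma>) / r\<^sup>2"
      using increment_moment2[OF \<sigma>(1), of e d] e(1) unfolding \<Delta>_def by (intro divide_right_mono) auto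
    have "C * (\<integral>x. \<Delta> x ^ 4 \<partial>gauss \<sigma>) \<le> C * (27 * (M ^ 4 + 16 * E ^ 4 * gmom TYPE('m) 4 + gmom TYPE('m) 8) * \<delta>\<^sup>2)"
      by (rule mult_left_mono[OF m4 C0])
    also have "\<dots> = (C * (27 * (M ^ 4 + 16 * E ^ 4 * gmom TYPE('m) 4 + gmom TYPE('m) 8)) * \<delta>) * \<delta>"
      by (simp add: power2_eq_square)
    also have "\<dots> \<le> 1 / h * \<delta>" using C(2) \<delta>0 by (intro mult_right_mono) auto
    finally have 3: "C * (\<integral>x. \<Delta> x ^ 4 \<partial>gauss \<sigma>) \<le> \<delta> / h" by simp
    show ?thesis by (intro add_mono diff_mono divide_right_mono order_refl 1 2 3) simp
  qed
  \<comment> \<open>The gain \<open>V * \<delta> / (2 * r\<^sup>2)\<close> from the curvature is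
    split in half. One half pays for the drift, the other for two amounts
    \<open>\<delta> / h\<close>: the large jumps and the required decrease.\<close>
  also have "\<dots> \<le> barrier w + P - \<delta> / h"
  proof -
    have "3 / 2 * (M * \<delta> / r) \<le> V * \<delta> / (4 * r\<^sup>2)"
      using mult_right_mono[OF V(1), of "\<delta>"] r \<delta>0 by (simp add: field_simps power2_eq_square)
    moreover have "2 * (\<delta> / h) \<le> V * \<delta> / (4 * r\<^sup>2)"
      using mult_right_mono[OF V(2), of "\<delta>"] r \<delta>0 h by (simp add: field_simps)
    moreover have "(V * \<delta> / r\<^sup>2) / 2 = V * \<delta> / (4 * r\<^sup>2) + V * \<delta> / (4 * r\<^sup>2)" by simp
    moreover have "A + p - v + P + q \<le> A + P - q" if "p \<le> u" "2 * q \<le> u" "v = u + u" for A p q u v :: real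
      using that by linarith
    ultimately show ?thesis by blast
  qed
  finally have "(\<integral>x. g x \<partial>gauss \<sigma>) \<le> barrier w + P - \<delta> / h" .
  moreover have "(\<integral>\<^sup>+x. f x \<partial>gauss \<sigma>) \<le> (\<integral>\<^sup>+x. ennreal (g x) \<partial>gauss \<sigma>)"
    using g by (intro nn_integral_mono) auto
  moreover have "(\<integral>\<^sup>+x. ennreal (g x) \<partial>gauss \<sigma>) = ennreal (\<integral>x. g x \<partial>gauss \<sigma>)"
    using g by (intro nn_integral_eq_integral ig) auto
  ultimately show ?thesis unfolding w_def[symmetric] by (metis ennreal_leI order_trans)
qed


text \<open>Induction over the number k of remaining steps. The term
  \<open>1 - k * \<delta> / h\<close> is the price of a finite horizon: it is 1 when no step is left
  and vanishes for k = n, so that only the barrier remains. The height |x - y|^2 -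
  \<open>\<beta>\<^sup>2\<close> + 2 \<beta> (c0 + K time) uses a linearised squared radius of the
  shrinking ball; this keeps its increments explicit and makes it nonnegative outside the ball. The
  shift by \<open>\<eta>\<close> keeps the barrier nonnegative after a small jump into the ball. Per
  unit of time, \<open>M\<close> bounds the drift of the height (contraction, shrinking, mean of the
  squared noise) and \<open>V\<close> bounds the second moment of its increments from below.\<close>

lemma surv_le_barrier:
  fixes y x :: "real ^ 'm" and K \<beta> c0 h \<nu> \<delta> r \<eta> :: real and H :: "nat \<Rightarrow> (real ^ 'm) set"
  defines "L \<equiv> norm y + 2 * \<beta>"
  defines "M \<equiv> (4 * \<beta> + 1) * \<nu> * L + 2 * \<beta> * K + gmom TYPE('m) 2"
  defines "V \<equiv> \<beta>\<^sup>2 / (8 * (real CARD('m))\<^sup>2)"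
  defines "C \<equiv> 1 / \<eta> ^ 4 + 3 / (2 * r * \<eta> ^ 3) + 1 / (2 * r\<^sup>2 * \<eta>\<^sup>2)"
  assumes pos: "0 < \<beta>" "0 \<le> K" "0 < h" "0 \<le> \<nu>" "0 < \<eta>" "\<eta> \<le> r / 2" "0 < r" "0 \<le> c0"
    and \<delta>: "0 < \<delta>" "\<delta> \<le> 1" "\<nu> * \<delta> * L \<le> 1" "\<nu> * \<delta> * L \<le> \<beta> / 4"
      "C * (27 * (M ^ 4 + 16 * (2 * \<beta> + 1) ^ 4 * gmom TYPE('m) 4 + gmom TYPE('m) 8)) * \<delta> \<le> 1 / h"
    and n: "real n * \<delta> = h" and c0: "c0 + K * h \<le> \<beta> / 2"
    and a: "\<And>i. i < n \<Longrightarrow> 1 - \<nu> * \<delta> \<le> a i" "\<And>i. i < n \<Longrightarrow> a i \<le> 1"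
    and s: "\<And>i. i < n \<Longrightarrow> 0 < s i" "\<And>i. i < n \<Longrightarrow> \<delta> / 2 \<le> (s i)\<^sup>2" "\<And>i. i < n \<Longrightarrow> (s i)\<^sup>2 \<le> \<delta>"
    and H: "\<And>i. i \<le> n \<Longrightarrow> H i \<subseteq> {x. \<beta> - c0 - K * (real i * \<delta>) \<le> norm (x - y)}"
    and r: "r \<le> \<beta>\<^sup>2" "6 * M * r \<le> V" "8 * r\<^sup>2 \<le> V * h"
    and jk: "j + k \<le> n"
    and alive: "\<beta> - c0 - K * (real j * \<delta>) \<le> norm (x - y)"
    and z: "(norm (x - y))\<^sup>2 - \<beta>\<^sup>2 + 2 * \<beta> * (c0 + K * (real j * \<delta>)) \<le> r"
  shows "surv a s H k j x \<le> ennreal (barrier (((norm (x - y))\<^sup>2 - \<beta>\<^sup>2 + 2 * \<beta> * (c0 + K * (real j * \<delta>)) + \<eta>) / r) + (1 - real k * \<delta> / h))"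
  using jk alive z
proof (induction k arbitrary: j x)
  define Z where "Z j x = (norm (x - y))\<^sup>2 - \<beta>\<^sup>2 + 2 * \<beta> * (c0 + K * (real j * \<delta>))" for j x
  have L0: "0 \<le> L" using pos by (simp add: L_def)
  have M0: "0 \<le> M" unfolding M_def using pos L0 gmom_nonneg[where 'm='m] by (intro add_nonneg_nonneg mult_nonneg_nonneg) auto
  \<comment> \<open>The ball keeps at least half its radius, so a surviving chain stays away from
    the centre, where the height has no first-order noise.\<close>
  have gap: "\<beta> / 2 \<le> \<beta> - c0 - K * (real j * \<delta>)" if "j \<le> n" for j
  proof -
    have "real j * \<delta> \<le> h" unfolding n[symmetric] using that \<delta> by (intro mult_right_mono) auto
    then have "K * (real j * \<delta>) \<le> K * h" using pos by (intro mult_left_mono) auto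
    then show ?thesis using c0 by linarith
  qed
  have Z0: "0 \<le> Z j x" if "j \<le> n" "\<beta> - c0 - K * (real j * \<delta>) \<le> norm (x - y)" for j x
  proof -
    have "(\<beta> - c0 - K * (real j * \<delta>))\<^sup>2 \<le> (norm (x - y))\<^sup>2"
      using gap[OF that(1)] pos that by (intro power_mono) auto
    moreover have "\<beta>\<^sup>2 - 2 * \<beta> * (c0 + K * (real j * \<delta>)) \<le> (\<beta> - (c0 + K * (real j * \<delta>)))\<^sup>2"
      unfolding power2_diff by simp
    ultimately show ?thesis by (simp add: Z_def diff_diff_eq)
  qed
  {
    case (0 j x)
    have "0 \<le> Z j x" using Z0 0 by auto
    then have "0 \<le> barrier ((Z j x + \<eta>) / r)"
      using 0 pos by (intro barrier_nonneg) (auto simp: Z_def field_simps)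
    then have "1 \<le> ennreal (barrier ((Z j x + \<eta>) / r) + (1 - real 0 * \<delta> / h))"
      by (simp add: ennreal_ge_1)
    then show ?case by (simp add: Z_def)
  next
    case (Suc k j x)
    then have j: "j < n" "j \<le> n" "Suc j + k \<le> n" by auto
    define e where "e = a j *\<^sub>R x - y"
    define d where "d = (norm e)\<^sup>2 - (norm (x - y))\<^sup>2 + 2 * \<beta> * K * \<delta>"
    define b where "b = 1 - a j"
    have z: "0 \<le> Z j x" "Z j x \<le> r" using Z0[OF j(2)] Suc.prems by (auto simp: Z_def)
    have xy: "\<beta> / 2 \<le> norm (x - y)" using gap[OF j(2)] Suc.prems by linarith
    have xy2: "norm (x - y) \<le> 2 * \<beta>"
    proof (rule power2_le_imp_le)
      have "0 \<le> 2 * \<beta> * (c0 + K * (real j * \<delta>))" using pos \<delta> by (intro mult_nonneg_nonneg add_nonneg_nonneg) auto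
      then have "(norm (x - y))\<^sup>2 \<le> \<beta>\<^sup>2 + \<beta>\<^sup>2" using z r unfolding Z_def by linarith
      also have "\<dots> \<le> (2 * \<beta>)\<^sup>2" by (simp add: power_mult_distrib)
      finally show "(norm (x - y))\<^sup>2 \<le> (2 * \<beta>)\<^sup>2" .
    qed (use pos in auto)
    have xL: "norm x \<le> L" using norm_triangle_ineq[of "x - y" y] xy2 by (simp add: L_def)
    have b: "0 \<le> b" "b \<le> \<nu> * \<delta>" using a[OF j(1)] by (auto simp: b_def)
    have bx: "b * norm x \<le> \<nu> * \<delta> * L" using b xL pos \<delta> by (intro mult_mono) auto
    have e_eq: "e = (x - y) - b *\<^sub>R x" by (simp add: e_def b_def algebra_simps)
    have e1: "\<beta> / 4 \<le> norm e"
      using norm_triangle_ineq2[of "x - y" "b *\<^sub>R x"] xy bx b \<delta> unfolding e_eq by simp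
    have e2: "norm e \<le> 2 * \<beta> + 1"
      using norm_triangle_ineq4[of "x - y" "b *\<^sub>R x"] xy2 bx b \<delta> unfolding e_eq by simp
    have d_eq: "d = - (2 * b * (x \<bullet> (x - y))) + (b * norm x)\<^sup>2 + 2 * \<beta> * K * \<delta>"
      unfolding d_def e_eq power2_norm_eq_inner power_mult_distrib
      by (simp add: inner_diff_left inner_diff_right inner_commute power2_eq_square algebra_simps)
    have d_abs: "\<bar>d\<bar> \<le> ((4 * \<beta> + 1) * \<nu> * L + 2 * \<beta> * K) * \<delta>"
    proof -
      have "\<bar>2 * b * (x \<bullet> (x - y))\<bar> \<le> 2 * b * (norm x * (2 * \<beta>))"
        unfolding abs_mult using b Cauchy_Schwarz_ineq2[of x "x - y"] xy2
        by (intro mult_mono order_trans[OF Cauchy_Schwarz_ineq2]) auto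
      also have "\<dots> = 4 * \<beta> * (b * norm x)" by simp
      also have "\<dots> \<le> 4 * \<beta> * (\<nu> * \<delta> * L)" using bx pos by (intro mult_left_mono) auto
      finally have 1: "\<bar>2 * b * (x \<bullet> (x - y))\<bar> \<le> 4 * \<beta> * (\<nu> * \<delta> * L)" .
      have "(b * norm x)\<^sup>2 \<le> 1 * (\<nu> * \<delta> * L)"
        unfolding power2_eq_square using b order_trans[OF bx \<delta>(3)] by (intro mult_mono bx) auto
      moreover have "0 \<le> 2 * \<beta> * K * \<delta>" using pos \<delta> by simp
      moreover have "((4 * \<beta> + 1) * \<nu> * L + 2 * \<beta> * K) * \<delta> = 4 * \<beta> * (\<nu> * \<delta> * L) + \<nu> * \<delta> * L + 2 * \<beta> * K * \<delta>"
        by (simp add: algebra_simps)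
      ultimately show ?thesis using 1 zero_le_power2[of "b * norm x"] unfolding d_eq by linarith
    qed
    have d1: "d + (s j)\<^sup>2 * gmom TYPE('m) 2 \<le> M * \<delta>"
    proof -
      have "(s j)\<^sup>2 * gmom TYPE('m) 2 \<le> \<delta> * gmom TYPE('m) 2"
        using s(3)[OF j(1)] gmom_nonneg by (intro mult_right_mono) auto
      moreover have "M * \<delta> = ((4 * \<beta> + 1) * \<nu> * L + 2 * \<beta> * K) * \<delta> + \<delta> * gmom TYPE('m) 2"
        by (simp add: M_def algebra_simps)
      ultimately show ?thesis using d_abs by linarith
    qed
    have d2: "\<bar>d\<bar> \<le> M * \<delta>"
    proof -
      have "M * \<delta> = ((4 * \<beta> + 1) * \<nu> * L + 2 * \<beta> * K) * \<delta> + \<delta> * gmom TYPE('m) 2"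
        by (simp add: M_def algebra_simps)
      moreover have "0 \<le> \<delta> * gmom TYPE('m) 2" using \<delta> gmom_nonneg[where 'm='m] by simp
      ultimately show ?thesis using d_abs by linarith
    qed
    \<comment> \<open>\<open>V\<close> is exactly what |e| at least \<open>\<beta> / 4\<close> and a
      noise variance of at least \<open>\<delta> / 2\<close> yield.\<close>
    have Ve: "V * \<delta> \<le> 4 * (norm e)\<^sup>2 * (s j)\<^sup>2 / (real CARD('m))\<^sup>2"
    proof -
      have "\<beta>\<^sup>2 / 16 * (\<delta> / 2) \<le> (norm e)\<^sup>2 * (s j)\<^sup>2"
        using power_mono[OF e1, of 2] s(2)[OF j(1)] pos \<delta>
        by (intro mult_mono) (auto simp: power_divide)
      then have "4 * (\<beta>\<^sup>2 / 16 * (\<delta> / 2)) / (real CARD('m))\<^sup>2 \<le> 4 * ((norm e)\<^sup>2 * (s j)\<^sup>2) / (real CARD('m))\<^sup>2"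
        by (intro divide_right_mono mult_left_mono) auto
      then show ?thesis by (simp add: V_def mult.commute mult.left_commute mult.assoc)
    qed
    have step: "Z (Suc j) (a j *\<^sub>R x + \<xi>) = Z j x + (d + 2 * (e \<bullet> \<xi>) + (norm \<xi>)\<^sup>2)" for \<xi>
    proof -
      have "a j *\<^sub>R x + \<xi> - y = e + \<xi>" by (simp add: e_def)
      then show ?thesis
        unfolding Z_def d_def power2_norm_eq_inner
        by (simp add: inner_add_left inner_add_right inner_commute algebra_simps)
    qed
    define P where "P = 1 - real k * \<delta> / h"
    have P: "0 \<le> P" "P \<le> 1"
      using pos \<delta> j mult_right_mono[of "real k" "real n" \<delta>] by (auto simp: P_def n)
    have "(\<integral>\<^sup>+\<xi>. indicator (H (Suc j)) (a j *\<^sub>R x + \<xi>) * surv a s H k (Suc j) (a j *\<^sub>R x + \<xi>) \<partial>gauss (s j))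
        \<le> ennreal (barrier ((Z j x + \<eta>) / r) + P - \<delta> / h)"
    proof (rule barrier_step[where e=e and d=d and M=M and V=V and E="2 * \<beta> + 1" and C=C])
      show "0 < s j" "(s j)\<^sup>2 \<le> \<delta>" using s j by auto
      show "C = 1 / \<eta> ^ 4 + 3 / (2 * r * \<eta> ^ 3) + 1 / (2 * r\<^sup>2 * \<eta>\<^sup>2)" by (simp add: C_def)
      fix \<xi> :: "real ^ 'm"
      have le1: "surv a s H k (Suc j) (a j *\<^sub>R x + \<xi>) \<le> 1"
        using s j by (intro surv_le_1[where n=n]) auto
      then show "indicator (H (Suc j)) (a j *\<^sub>R x + \<xi>) * surv a s H k (Suc j) (a j *\<^sub>R x + \<xi>) \<le> 1"
        by (auto simp: indicator_def)
      assume \<Delta>: "\<bar>d + 2 * (e \<bullet> \<xi>) + (norm \<xi>)\<^sup>2\<bar> < \<eta>"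
      let ?x = "a j *\<^sub>R x + \<xi>"
      have "surv a s H k (Suc j) ?x \<le> ennreal (barrier ((Z (Suc j) ?x + \<eta>) / r) + P)" if "?x \<in> H (Suc j)"
      proof (cases "Z (Suc j) ?x \<le> r")
        case True
        have "\<beta> - c0 - K * (real (Suc j) * \<delta>) \<le> norm (?x - y)"
          using H[of "Suc j"] that j by auto
        from Suc.IH[OF j(3) this] True show ?thesis by (simp add: Z_def P_def)
      next
        case False
        \<comment> \<open>Above height \<open>r\<close> the bound is trivial: the jump is smaller
          than \<open>\<eta>\<close>, hence than r/2, so the argument of the barrier is still at
          most 2.\<close>
        have "1 \<le> barrier ((Z (Suc j) ?x + \<eta>) / r)"
          using False step[of \<xi>] \<Delta> z pos by (intro barrier_ge_1) (auto simp: field_simps)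
        then have "1 \<le> barrier ((Z (Suc j) ?x + \<eta>) / r) + P"
          using P by linarith
        then have "1 \<le> ennreal (barrier ((Z (Suc j) ?x + \<eta>) / r) + P)"
          by (simp only: ennreal_ge_1)
        with le1 show ?thesis by (rule order_trans)
      qed
      then show "indicator (H (Suc j)) ?x * surv a s H k (Suc j) ?x
        \<le> ennreal (barrier ((Z j x + (d + 2 * (e \<bullet> \<xi>) + (norm \<xi>)\<^sup>2) + \<eta>) / r) + P)"
        by (simp add: step indicator_def)
    qed (use pos \<delta> z M0 d1 d2 Ve e2 r P in auto)
    then show ?case
      using pos by (simp add: Z_def P_def add_divide_distrib distrib_right algebra_simps)
  }
qed

text \<open>A grid has to be fixed before the endpoint of the path is known, so the threshold
  \<open>\<delta>0\<close> is quantified before \<open>y\<close>, \<open>x\<close> and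
  \<open>r\<close>. The predicate records this order.\<close>

definition exterior_ball_step ::
    "'m::finite itself \<Rightarrow> real \<Rightarrow> real \<Rightarrow> real \<Rightarrow> real \<Rightarrow> real \<Rightarrow> real \<Rightarrow> real \<Rightarrow> real \<Rightarrow> bool" where
  "exterior_ball_step _ K \<beta> h \<nu> R r0 \<eta> \<delta>0 \<longleftrightarrow> 0 < \<delta>0 \<and> (\<forall>\<delta> n a s H r c0. \<forall>(y :: real ^ 'm) x. 0 < \<delta> \<longrightarrow> \<delta> \<le> \<delta>0 \<longrightarrow> real n * \<delta> = h \<longrightarrow>
     \<nu> * (norm y + 2 * \<beta>) \<le> R \<longrightarrow> 0 \<le> c0 \<longrightarrow> c0 + K * h \<le> \<beta> / 2 \<longrightarrow>
     (\<forall>i<n. 1 - \<nu> * \<delta> \<le> a i \<and> a i \<le> 1 \<and> 0 < s i \<and> \<delta> / 2 \<le> (s i)\<^sup>2 \<and> (s i)\<^sup>2 \<le> \<delta>) \<longrightarrow>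
     (\<forall>i\<le>n. H i \<subseteq> {x. \<beta> - c0 - K * (real i * \<delta>) \<le> norm (x - y)}) \<longrightarrow>
     r0 \<le> r \<longrightarrow> r \<le> \<beta>\<^sup>2 \<longrightarrow>
     6 * ((4 * \<beta> + 1) * \<nu> * (norm y + 2 * \<beta>) + 2 * \<beta> * K + gmom TYPE('m) 2) * r \<le> \<beta>\<^sup>2 / (8 * (real CARD('m))\<^sup>2) \<longrightarrow>
     8 * r\<^sup>2 \<le> \<beta>\<^sup>2 / (8 * (real CARD('m))\<^sup>2) * h \<longrightarrow>
     \<beta> - c0 \<le> norm (x - y) \<longrightarrow>
     surv a s H n 0 x \<le> ennreal (2 * ((norm (x - y))\<^sup>2 - \<beta>\<^sup>2 + 2 * \<beta> * c0 + \<eta>) / r))"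

text \<open>The threshold for \<open>\<delta>\<close> is uniform in \<open>y\<close> and \<open>r\<close> as long as \<open>\<nu> * norm y\<close> is bounded and \<open>r\<close> is
  bounded away from 0.\<close>

lemma ex_exterior_ball_step:
  fixes K \<beta> h \<nu> R r0 \<eta> :: real
  assumes pos: "0 < \<beta>" "0 \<le> K" "0 < h" "0 \<le> \<nu>" "0 < \<eta>" "0 < r0" "0 \<le> R"
  shows "\<exists>\<delta>0. exterior_ball_step TYPE('m::finite) K \<beta> h \<nu> R r0 \<eta> \<delta>0"
proof -
  define M where "M = (4 * \<beta> + 1) * R + 2 * \<beta> * K + gmom TYPE('m) 2"
  define C where "C = (1 / \<eta> ^ 4 + 3 / (2 * r0 * \<eta> ^ 3) + 1 / (2 * r0\<^sup>2 * \<eta>\<^sup>2)) *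
    (27 * (M ^ 4 + 16 * (2 * \<beta> + 1) ^ 4 * gmom TYPE('m) 4 + gmom TYPE('m) 8))"
  have g0: "0 \<le> gmom TYPE('m) i" for i by (rule gmom_nonneg)
  have C0: "0 \<le> C" unfolding C_def using pos g0
    by (intro mult_nonneg_nonneg add_nonneg_nonneg) auto
  \<comment> \<open>The entries ensure in turn: a step of at most 1, a contraction that moves points
    by at most 1, then by at most \<open>\<beta> / 4\<close>, and a fourth-moment term within
    \<open>\<delta> / h\<close>.\<close>
  define \<delta>0 where "\<delta>0 = Min {1, 1 / (R + 1), \<beta> / (4 * (R + 1)), 1 / (h * (C + 1))}"
  have l1: "0 < R + 1" using pos by simp
  have "0 < \<delta>0" unfolding \<delta>0_def using pos l1 C0 by auto
  moreover have "surv a s H n 0 x \<le> ennreal (2 * ((norm (x - y))\<^sup>2 - \<beta>\<^sup>2 + 2 * \<beta> * c0 + \<eta>) / r)"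
    if A: "0 < \<delta>" "\<delta> \<le> \<delta>0" "real n * \<delta> = h" "\<nu> * (norm y + 2 * \<beta>) \<le> R" "0 \<le> c0" "c0 + K * h \<le> \<beta> / 2"
      and as: "\<forall>i<n. 1 - \<nu> * \<delta> \<le> a i \<and> a i \<le> 1 \<and> 0 < s i \<and> \<delta> / 2 \<le> (s i)\<^sup>2 \<and> (s i)\<^sup>2 \<le> \<delta>"
      and H: "\<forall>i\<le>n. H i \<subseteq> {x. \<beta> - c0 - K * (real i * \<delta>) \<le> norm (x - y)}"
      and r: "r0 \<le> r" "r \<le> \<beta>\<^sup>2"
        "6 * ((4 * \<beta> + 1) * \<nu> * (norm y + 2 * \<beta>) + 2 * \<beta> * K + gmom TYPE('m) 2) * r \<le> \<beta>\<^sup>2 / (8 * (real CARD('m))\<^sup>2)"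
        "8 * r\<^sup>2 \<le> \<beta>\<^sup>2 / (8 * (real CARD('m))\<^sup>2) * h"
      and x: "\<beta> - c0 \<le> norm (x - y)"
    for \<delta> n a s H r c0 and y x :: "real ^ 'm"
  proof -
    define z where "z = (norm (x - y))\<^sup>2 - \<beta>\<^sup>2 + 2 * \<beta> * c0"
    have r0: "0 < r" using r pos by simp
    have z0: "0 \<le> z"
    proof -
      have "0 \<le> K * h" using pos by simp
      then have "c0 \<le> \<beta>" using A(6) pos(1) by linarith
      then have "(\<beta> - c0)\<^sup>2 \<le> (norm (x - y))\<^sup>2" using x A pos by (intro power_mono) auto
      then show ?thesis unfolding z_def power2_diff using zero_le_power2[of c0] by linarith
    qed
    show ?thesis
    proof (cases "\<eta> \<le> r / 2 \<and> z \<le> r")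
      \<comment> \<open>The claimed bound is then at least 1.\<close>
      case False
      have "r \<le> 2 * (z + \<eta>)" using False z0 pos by auto
      then have "1 \<le> 2 * (z + \<eta>) / r" using r0 by (simp add: field_simps)
      moreover have "surv a s H n 0 x \<le> 1" using as by (intro surv_le_1[where n=n]) auto
      ultimately show ?thesis unfolding z_def by (auto intro: order_trans simp: ennreal_ge_1)
    next
      case True
      have d: "\<delta> \<le> 1" "\<delta> * (R + 1) \<le> 1" "\<delta> * (R + 1) \<le> \<beta> / 4" "\<delta> * (C + 1) \<le> 1 / h"
      proof -
        have m: "\<delta> \<le> 1" "\<delta> \<le> 1 / (R + 1)" "\<delta> \<le> \<beta> / (4 * (R + 1))" "\<delta> \<le> 1 / (h * (C + 1))"
          using A(2) unfolding \<delta>0_def by auto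
        show "\<delta> \<le> 1" by fact
        show "\<delta> * (R + 1) \<le> 1" using m(2) l1 by (simp add: pos_le_divide_eq)
        show "\<delta> * (R + 1) \<le> \<beta> / 4" using m(3) l1 by (simp add: pos_le_divide_eq algebra_simps)
        have "0 < h * (C + 1)" using C0 pos by (intro mult_pos_pos) auto
        then show "\<delta> * (C + 1) \<le> 1 / h" using m(4) pos by (simp add: pos_le_divide_eq mult_ac)
      qed
      have dL: "\<nu> * \<delta> * (norm y + 2 * \<beta>) \<le> \<delta> * (R + 1)"
        using mult_left_mono[OF A(4), of \<delta>] A(1) by (simp add: algebra_simps)
      have dC: "(1 / \<eta> ^ 4 + 3 / (2 * r * \<eta> ^ 3) + 1 / (2 * r\<^sup>2 * \<eta>\<^sup>2)) *
          (27 * (((4 * \<beta> + 1) * \<nu> * (norm y + 2 * \<beta>) + 2 * \<beta> * K + gmom TYPE('m) 2) ^ 4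
             + 16 * (2 * \<beta> + 1) ^ 4 * gmom TYPE('m) 4 + gmom TYPE('m) 8)) * \<delta> \<le> 1 / h"
      proof -
        have p1: "0 \<le> (4 * \<beta> + 1) * \<nu> * (norm y + 2 * \<beta>) + 2 * \<beta> * K + gmom TYPE('m) 2"
          using pos g0 by (intro add_nonneg_nonneg mult_nonneg_nonneg) auto
        have p2: "(4 * \<beta> + 1) * \<nu> * (norm y + 2 * \<beta>) + 2 * \<beta> * K + gmom TYPE('m) 2 \<le> M"
          unfolding M_def mult.assoc using pos A(4) by (intro add_mono mult_left_mono) auto
        have "(1 / \<eta> ^ 4 + 3 / (2 * r * \<eta> ^ 3) + 1 / (2 * r\<^sup>2 * \<eta>\<^sup>2)) *
          (27 * (((4 * \<beta> + 1) * \<nu> * (norm y + 2 * \<beta>) + 2 * \<beta> * K + gmom TYPE('m) 2) ^ 4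
             + 16 * (2 * \<beta> + 1) ^ 4 * gmom TYPE('m) 4 + gmom TYPE('m) 8)) \<le> C"
          unfolding C_def using pos r r0 g0 p1 p2
          by (intro mult_mono add_mono divide_left_mono power_mono mult_pos_pos add_nonneg_nonneg) auto
        then have "(1 / \<eta> ^ 4 + 3 / (2 * r * \<eta> ^ 3) + 1 / (2 * r\<^sup>2 * \<eta>\<^sup>2)) *
          (27 * (((4 * \<beta> + 1) * \<nu> * (norm y + 2 * \<beta>) + 2 * \<beta> * K + gmom TYPE('m) 2) ^ 4
             + 16 * (2 * \<beta> + 1) ^ 4 * gmom TYPE('m) 4 + gmom TYPE('m) 8)) * \<delta> \<le> C * \<delta>"
          using A by (intro mult_right_mono) auto
        also have "\<dots> \<le> \<delta> * (C + 1)" using A by (simp add: algebra_simps)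
        finally show ?thesis using d(4) by linarith
      qed
      have "surv a s H n 0 x \<le> ennreal (barrier (((norm (x - y))\<^sup>2 - \<beta>\<^sup>2 + 2 * \<beta> * (c0 + K * (real 0 * \<delta>)) + \<eta>) / r) + (1 - real n * \<delta> / h))"
      proof (rule surv_le_barrier[where n=n and \<nu>=\<nu> and K=K])
        show "\<nu> * \<delta> * (norm y + 2 * \<beta>) \<le> 1" "\<nu> * \<delta> * (norm y + 2 * \<beta>) \<le> \<beta> / 4"
          using dL d by linarith+
      qed (use pos A as H r r0 x True dC d in \<open>auto simp: z_def\<close>)
      also have "\<dots> = ennreal (barrier ((z + \<eta>) / r))"
        using A pos by (simp add: z_def)
      also have "\<dots> \<le> ennreal (2 * (z + \<eta>) / r)"
      proof (rule ennreal_leI)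
        have "0 \<le> (z + \<eta>) / r" using z0 pos r0 by simp
        then have "barrier ((z + \<eta>) / r) \<le> 2 * ((z + \<eta>) / r)"
          by (rule barrier_le)
        then show "barrier ((z + \<eta>) / r) \<le> 2 * (z + \<eta>) / r" by simp
      qed
      finally show ?thesis by (simp add: z_def)
    qed
  qed
  ultimately show ?thesis unfolding exterior_ball_step_def by blast
qed

lemmas surv_exterior_ball = exterior_ball_step_def[THEN iffD1, THEN conjunct2, rule_format]

section \<open>Brownian motion and its past\<close>

locale brownian_motion =
  fixes M :: "'w measure" and W :: "real \<Rightarrow> 'w \<Rightarrow> real ^ 'm"
  assumes bm: "standard_brownian_motion M W"
begin

sublocale prob_space M
  using bm by (simp add: standard_brownian_motion_def)

lemma measurable_W [measurable]: "0 \<le> t \<Longrightarrow> W t \<in> borel_measurable M"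
  using bm by (simp add: standard_brownian_motion_def)

lemma W_0 [simp]: "\<omega> \<in> space M \<Longrightarrow> W 0 \<omega> = 0"
  using bm by (simp add: standard_brownian_motion_def)

lemma continuous_path: "\<omega> \<in> space M \<Longrightarrow> continuous_on {0..} (\<lambda>t. W t \<omega>)"
  using bm by (simp add: standard_brownian_motion_def)

lemma distr_increment: "0 \<le> s \<Longrightarrow> s < t \<Longrightarrow> distr M borel (\<lambda>\<omega>. W t \<omega> - W s \<omega>) = gauss (sqrt (t - s))"
  using bm unfolding standard_brownian_motion_def distributed_def gauss_def
  by (metis (no_types, lifting) distr_cong sets_lborel)

lemma indep_increments:
  "0 \<le> \<tau> 0 \<Longrightarrow> strict_mono_on {..n} \<tau> \<Longrightarrow>
    indep_vars (\<lambda>_. borel) (\<lambda>i \<omega>. W (\<tau> (Suc i)) \<omega> - W (\<tau> i) \<omega>) {..<n}"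
  using bm by (simp add: standard_brownian_motion_def)

lemma distr_W: "0 < t \<Longrightarrow> distr M borel (W t) = gauss (sqrt t)"
  using distr_increment[of 0 t] by (auto cong: distr_cong)

definition past :: "real \<Rightarrow> 'w measure" where
  "past t = sigma (space M) {W s -` B \<inter> space M | s B. 0 \<le> s \<and> s \<le> t \<and> B \<in> sets borel}"

lemma space_past [simp]: "space (past t) = space M"
  unfolding past_def by (rule space_measure_of) auto

lemma sets_past: "sets (past t) = sigma_sets (space M) {W s -` B \<inter> space M | s B. 0 \<le> s \<and> s \<le> t \<and> B \<in> sets borel}"
  unfolding past_def by (rule sets_measure_of) auto

lemma past_le: "sets (past t) \<subseteq> sets M"
  unfolding sets_past by (rule sets.sigma_sets_subset) auto

lemma past_mono: "s \<le> t \<Longrightarrow> sets (past s) \<subseteq> sets (past t)"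
  unfolding sets_past by (rule sigma_sets_mono') fastforce

lemma measurable_past: "0 \<le> s \<Longrightarrow> s \<le> t \<Longrightarrow> W s \<in> borel_measurable (past t)"
  by (rule measurableI) (auto simp: sets_past intro!: sigma_sets.Basic)

lemma measurable_from_past: "f \<in> measurable (past t) N \<Longrightarrow> f \<in> measurable M N"
  using past_le[of t] unfolding measurable_def by auto

text \<open>Once 0 and t are added to the finitely many times and all are sorted, every value at a
  time in \<open>J\<close> is a partial sum of increments up to t, while W u - W t is the next
  increment.\<close>

lemma indep_cylinder_increment:
  assumes t: "0 \<le> t" "t < u" and J: "finite J" "J \<subseteq> {0..t}"
    and B: "\<And>s. s \<in> J \<Longrightarrow> B s \<in> sets borel" and A: "A \<in> sets borel"
  shows "prob ({\<omega> \<in> space M. \<forall>s\<in>J. W s \<omega> \<in> B s} \<inter> ((\<lambda>\<omega>. W u \<omega> - W t \<omega>) -` A \<inter> space M))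
       = prob {\<omega> \<in> space M. \<forall>s\<in>J. W s \<omega> \<in> B s} * prob ((\<lambda>\<omega>. W u \<omega> - W t \<omega>) -` A \<inter> space M)"
proof -
  define S where "S = insert 0 (insert t J)"
  define L where "L = sorted_list_of_set S"
  define n where "n = length L - 1"
  have S: "finite S" "S \<subseteq> {0..t}" using J t by (auto simp: S_def)
  have L: "set L = S" "sorted L" "sorted_wrt (<) L"
  proof -
    show "set L = S" unfolding L_def by (rule set_sorted_list_of_set[OF S(1)])
    show "sorted L" unfolding L_def by (rule sorted_sorted_list_of_set)
    show "sorted_wrt (<) L" unfolding L_def by (rule strict_sorted_list_of_set)
  qed
  have "L \<noteq> []" using L by (auto simp: S_def)
  then have len: "length L = Suc n" by (cases L) (auto simp: n_def)
  \<comment> \<open>Index \<open>n\<close> is time t and index \<open>n + 1\<close> is u, so the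
    increment with index \<open>n\<close> is the one after t.\<close>
  define \<tau> where "\<tau> i = (if i \<le> n then L ! i else u)" for i
  have idx: "\<exists>i\<le>n. \<tau> i = s" if "s \<in> S" for s
  proof -
    have "s \<in> set L" using that L(1) by simp
    then obtain i where "i < length L" "L ! i = s" by (auto simp: in_set_conv_nth)
    then show ?thesis using len by (intro exI[of _ i]) (auto simp: \<tau>_def)
  qed
  have Lin: "L ! i \<in> {0..t}" if "i \<le> n" for i
  proof -
    have "L ! i \<in> set L" using that len by (intro nth_mem) auto
    then show ?thesis using L(1) S by auto
  qed
  have \<tau>0: "\<tau> 0 = 0"
  proof -
    obtain i where i: "i \<le> n" "\<tau> i = 0" using idx[of 0] by (auto simp: S_def)
    then have "L ! 0 \<le> L ! i" using L len by (intro sorted_nth_mono) auto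
    then show ?thesis using i Lin[of 0] by (auto simp: \<tau>_def)
  qed
  have \<tau>n: "\<tau> n = t"
  proof -
    obtain i where i: "i \<le> n" "\<tau> i = t" using idx[of t] by (auto simp: S_def)
    then have "L ! i \<le> L ! n" using L len by (intro sorted_nth_mono) auto
    then show ?thesis using i Lin[of n] by (auto simp: \<tau>_def)
  qed
  have mono: "strict_mono_on {..Suc n} \<tau>"
  proof (rule strict_mono_onI)
    fix i j assume ij: "i \<in> {..Suc n}" "j \<in> {..Suc n}" "i < j"
    show "\<tau> i < \<tau> j"
    proof (cases "j \<le> n")
      case True
      then show ?thesis using ij len sorted_wrt_nth_less[OF L(3), of i j] by (simp add: \<tau>_def)
    next
      case False
      then show ?thesis using ij Lin[of i] t by (auto simp: \<tau>_def)
    qed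
  qed
  define X where "X i \<omega> = W (\<tau> (Suc i)) \<omega> - W (\<tau> i) \<omega>" for i \<omega>
  have ind: "indep_vars (\<lambda>_. borel) X {..<Suc n}"
    unfolding X_def using \<tau>0 mono by (intro indep_increments) auto
  have ind2: "indep_var (PiM {..<n} (\<lambda>_. borel)) (\<lambda>\<omega>. restrict (\<lambda>i. X i \<omega>) {..<n})
     (PiM {n} (\<lambda>_. borel)) (\<lambda>\<omega>. restrict (\<lambda>i. X i \<omega>) {n})"
    by (rule indep_var_restrict[OF ind]) auto
  have Wsum: "W (\<tau> i) \<omega> = (\<Sum>j<i. X j \<omega>)" if "\<omega> \<in> space M" for i \<omega>
    using that \<tau>0 by (induction i) (auto simp: X_def)
  have "\<forall>s\<in>J. \<exists>i. i \<le> n \<and> \<tau> i = s" using idx by (auto simp: S_def)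
  then obtain idx where idx: "\<And>s. s \<in> J \<Longrightarrow> idx s \<le> n \<and> \<tau> (idx s) = s"
    by (auto simp: bchoice_iff)
  define E where "E = {f \<in> space (PiM {..<n} (\<lambda>_. borel)). \<forall>s\<in>J. (\<Sum>j<idx s. f j) \<in> B s}"
  define F where "F = {f \<in> space (PiM {n} (\<lambda>_. borel)). f n \<in> A}"
  have E: "E \<in> sets (PiM {..<n} (\<lambda>_. borel))"
    unfolding E_def
  proof (rule sets.sets_Collect_finite_All[OF _ J(1)])
    fix s assume s: "s \<in> J"
    have "(\<lambda>f. \<Sum>j<idx s. f j :: real ^ 'm) \<in> borel_measurable (PiM {..<n} (\<lambda>_. borel))"
      using idx[OF s] by (intro borel_measurable_sum measurable_component_singleton) auto
    from measurable_sets[OF this B[OF s]]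
    show "{f \<in> space (PiM {..<n} (\<lambda>_. borel)). (\<Sum>j<idx s. f j) \<in> B s} \<in> sets (PiM {..<n} (\<lambda>_. borel))"
      by (simp add: vimage_def Int_def conj_commute)
  qed
  have F: "F \<in> sets (PiM {n} (\<lambda>_. borel))"
    unfolding F_def using A by measurable
  have evE: "{\<omega> \<in> space M. \<forall>s\<in>J. W s \<omega> \<in> B s} = (\<lambda>\<omega>. restrict (\<lambda>i. X i \<omega>) {..<n}) -` E \<inter> space M"
  proof -
    have "(\<Sum>j<idx s. restrict (\<lambda>i. X i \<omega>) {..<n} j) = W s \<omega>" if "s \<in> J" "\<omega> \<in> space M" for s \<omega>
    proof -
      have "(\<Sum>j<idx s. restrict (\<lambda>i. X i \<omega>) {..<n} j) = (\<Sum>j<idx s. X j \<omega>)"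
        using idx[OF that(1)] by (intro sum.cong) auto
      then show ?thesis using Wsum[OF that(2), of "idx s"] idx[OF that(1)] by simp
    qed
    then have "restrict (\<lambda>i. X i \<omega>) {..<n} \<in> E \<longleftrightarrow> (\<forall>s\<in>J. W s \<omega> \<in> B s)" if "\<omega> \<in> space M" for \<omega>
      using that by (simp add: E_def space_PiM cong: ball_cong)
    then show ?thesis by blast
  qed
  have evF: "(\<lambda>\<omega>. W u \<omega> - W t \<omega>) -` A \<inter> space M = (\<lambda>\<omega>. restrict (\<lambda>i. X i \<omega>) {n}) -` F \<inter> space M"
  proof -
    have "X n \<omega> = W u \<omega> - W t \<omega>" for \<omega> using \<tau>n by (simp add: X_def) (simp add: \<tau>_def)
    then have "restrict (\<lambda>i. X i \<omega>) {n} \<in> F \<longleftrightarrow> W u \<omega> - W t \<omega> \<in> A" for \<omega>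
      by (simp add: F_def space_PiM)
    then show ?thesis by blast
  qed
  have "(\<lambda>x. (restrict (\<lambda>i. X i x) {..<n}, restrict (\<lambda>i. X i x) {n})) -` (E \<times> F) \<inter> space M
    = ((\<lambda>\<omega>. restrict (\<lambda>i. X i \<omega>) {..<n}) -` E \<inter> space M) \<inter> ((\<lambda>\<omega>. restrict (\<lambda>i. X i \<omega>) {n}) -` F \<inter> space M)"
    by auto
  then show ?thesis
    unfolding evE evF using indep_varD[OF ind2 E F] by simp
qed

text \<open>Cylinder events are stable under intersection and generate \<open>past t\<close>, so
  independence extends from them.\<close>

lemma indep_past_increment:
  assumes t: "0 \<le> t" "t < u" and A: "A \<in> sets (past t)" and B: "B \<in> sets borel"
  shows "prob (A \<inter> ((\<lambda>\<omega>. W u \<omega> - W t \<omega>) -` B \<inter> space M)) = prob A * prob ((\<lambda>\<omega>. W u \<omega> - W t \<omega>) -` B \<inter> space M)"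
proof -
  define P where "P = {{\<omega> \<in> space M. \<forall>s\<in>J. W s \<omega> \<in> B s} | J B. finite J \<and> J \<subseteq> {0..t} \<and> (\<forall>s\<in>J. B s \<in> sets borel)}"
  define Q where "Q = {(\<lambda>\<omega>. W u \<omega> - W t \<omega>) -` A \<inter> space M | A. A \<in> sets borel}"
  have [measurable]: "(\<lambda>\<omega>. W u \<omega> - W t \<omega>) \<in> borel_measurable M"
    using t by (intro borel_measurable_diff measurable_W) auto
  have P_sub: "P \<subseteq> events"
  proof
    fix E assume "E \<in> P"
    then obtain J B where E: "E = {\<omega> \<in> space M. \<forall>s\<in>J. W s \<omega> \<in> B s}" "finite J" "J \<subseteq> {0..t}" "\<forall>s\<in>J. B s \<in> sets borel"
      unfolding P_def by (elim CollectE exE conjE) (rule that)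
    show "E \<in> events" unfolding E(1)
    proof (rule sets.sets_Collect_finite_All[OF _ E(2)])
      fix s assume "s \<in> J"
      then show "{x \<in> space M. W s x \<in> B s} \<in> events"
        using measurable_sets[OF measurable_W, of s "B s"] E by (auto simp: vimage_def Int_def conj_commute)
    qed
  qed
  have "indep_set P Q"
    unfolding indep_sets2_eq
  proof (intro conjI ballI)
    show "P \<subseteq> events" by fact
    show "Q \<subseteq> events" by (auto simp: Q_def)
    fix a b assume ab: "a \<in> P" "b \<in> Q"
    obtain J B where J: "a = {\<omega> \<in> space M. \<forall>s\<in>J. W s \<omega> \<in> B s}" "finite J" "J \<subseteq> {0..t}" "\<forall>s\<in>J. B s \<in> sets borel"
      using ab(1) unfolding P_def by (elim CollectE exE conjE) (rule that)
    obtain A where A: "b = (\<lambda>\<omega>. W u \<omega> - W t \<omega>) -` A \<inter> space M" "A \<in> sets borel"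
      using ab(2) unfolding Q_def by (elim CollectE exE conjE) (rule that)
    show "prob (a \<inter> b) = prob a * prob b"
      unfolding J(1) A(1) using J A by (intro indep_cylinder_increment[OF t]) auto
  qed
  moreover have "Int_stable P"
  proof (rule Int_stableI)
    fix a b assume "a \<in> P" "b \<in> P"
    then obtain J B J' B' where
      a: "a = {\<omega> \<in> space M. \<forall>s\<in>J. W s \<omega> \<in> B s}" "finite J" "J \<subseteq> {0..t}" "\<forall>s\<in>J. B s \<in> sets borel" and
      b: "b = {\<omega> \<in> space M. \<forall>s\<in>J'. W s \<omega> \<in> B' s}" "finite J'" "J' \<subseteq> {0..t}" "\<forall>s\<in>J'. B' s \<in> sets borel"
      unfolding P_def by (elim CollectE exE conjE) (rule that)
    define C where "C s = (if s \<in> J then B s else UNIV) \<inter> (if s \<in> J' then B' s else UNIV)" for s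
    have "a \<inter> b = {\<omega> \<in> space M. \<forall>s\<in>J \<union> J'. W s \<omega> \<in> C s}"
      unfolding a b C_def by auto
    moreover have "\<forall>s\<in>J \<union> J'. C s \<in> sets borel" using a b by (auto simp: C_def)
    moreover have "finite (J \<union> J')" "J \<union> J' \<subseteq> {0..t}" using a b by auto
    ultimately show "a \<inter> b \<in> P"
      unfolding P_def by (intro CollectI exI[of _ "J \<union> J'"] exI[of _ C] conjI)
  qed
  moreover have "Int_stable Q"
  proof (rule Int_stableI)
    fix a b assume "a \<in> Q" "b \<in> Q"
    then obtain A B where "a = (\<lambda>\<omega>. W u \<omega> - W t \<omega>) -` A \<inter> space M" "b = (\<lambda>\<omega>. W u \<omega> - W t \<omega>) -` B \<inter> space M"
      "A \<in> sets borel" "B \<in> sets borel" unfolding Q_def by (elim CollectE exE conjE) (rule that)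
    then show "a \<inter> b \<in> Q" unfolding Q_def by (intro CollectI exI[of _ "A \<inter> B"]) auto
  qed
  ultimately have I: "indep_set (sigma_sets (space M) P) (sigma_sets (space M) Q)"
    by (rule indep_set_sigma_sets)
  have past_P: "sets (past t) \<subseteq> sigma_sets (space M) P"
    unfolding sets_past
  proof (rule sigma_sets_mono')
    show "{W s -` B \<inter> space M |s B. 0 \<le> s \<and> s \<le> t \<and> B \<in> sets borel} \<subseteq> P"
    proof safe
      fix s B assume "0 \<le> s" "s \<le> t" "B \<in> sets (borel :: (real ^ 'm) measure)"
      then show "W s -` B \<inter> space M \<in> P"
        unfolding P_def by (intro CollectI exI[of _ "{s}"] exI[of _ "\<lambda>_. B"]) auto
    qed
  qed
  have "(\<lambda>\<omega>. W u \<omega> - W t \<omega>) -` B \<inter> space M \<in> sigma_sets (space M) Q"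
    using B by (intro sigma_sets.Basic) (auto simp: Q_def)
  with I past_P A show ?thesis
    unfolding indep_sets2_eq by blast
qed

text \<open>The Markov property in integrated form: past and increment have a product law, so the
  increment can be averaged out with the past frozen. The first component is the sample point
  itself, which lets \<open>g\<close> depend on the whole path up to t.\<close>

lemma nn_integral_past_increment:
  assumes t: "0 \<le> t" "t < u" and g [measurable]: "g \<in> borel_measurable (past t \<Otimes>\<^sub>M borel)"
  shows "(\<integral>\<^sup>+\<omega>. g (\<omega>, W u \<omega> - W t \<omega>) \<partial>M) = (\<integral>\<^sup>+\<omega>. \<integral>\<^sup>+\<xi>. g (\<omega>, \<xi>) \<partial>gauss (sqrt (u - t)) \<partial>M)"
proof -
  have I: "(\<lambda>\<omega>. \<omega>) \<in> measurable M (past t)" "(\<lambda>\<omega>. W u \<omega> - W t \<omega>) \<in> borel_measurable M"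
  proof -
    show "(\<lambda>\<omega>. W u \<omega> - W t \<omega>) \<in> borel_measurable M"
      using t by (intro borel_measurable_diff measurable_W) auto
    show "(\<lambda>\<omega>. \<omega>) \<in> measurable M (past t)"
      by (rule measurable_from_past[where t=t]) (rule measurable_ident_sets[OF refl])
  qed
  note [measurable] = I(1,2)
  interpret N: prob_space "gauss (sqrt (u - t)) :: (real ^ 'm) measure"
    using t by (intro prob_space_gauss) auto
  interpret X: prob_space "distr M (past t) (\<lambda>\<omega>. \<omega>)"
    by (rule prob_space_distr) fact
  have prod: "distr M (past t) (\<lambda>\<omega>. \<omega>) \<Otimes>\<^sub>M gauss (sqrt (u - t)) = distr M (past t \<Otimes>\<^sub>M borel) (\<lambda>\<omega>. (\<omega>, W u \<omega> - W t \<omega>))"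
  proof (rule pair_measure_eqI)
    fix A B assume A: "A \<in> sets (distr M (past t) (\<lambda>\<omega>. \<omega>))" and B: "B \<in> sets (gauss (sqrt (u - t)) :: (real ^ 'm) measure)"
    have "emeasure (distr M (past t) (\<lambda>\<omega>. \<omega>)) A * emeasure (gauss (sqrt (u - t))) B
        = emeasure M (A \<inter> space M) * emeasure M ((\<lambda>\<omega>. W u \<omega> - W t \<omega>) -` B \<inter> space M)"
      using A B t I by (simp add: distr_increment[symmetric] emeasure_distr)
    also have "\<dots> = emeasure M (A \<inter> ((\<lambda>\<omega>. W u \<omega> - W t \<omega>) -` B \<inter> space M))"
      using indep_past_increment[OF t, of A B] A B sets.sets_into_space[of A "past t"]
      by (simp add: emeasure_eq_measure ennreal_mult[symmetric] Int_absorb2)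
    also have "\<dots> = emeasure (distr M (past t \<Otimes>\<^sub>M borel) (\<lambda>\<omega>. (\<omega>, W u \<omega> - W t \<omega>))) (A \<times> B)"
      using A B by (subst emeasure_distr) (auto intro!: arg_cong[where f="emeasure M"])
    finally show "emeasure (distr M (past t) (\<lambda>\<omega>. \<omega>)) A * emeasure (gauss (sqrt (u - t))) B
       = emeasure (distr M (past t \<Otimes>\<^sub>M borel) (\<lambda>\<omega>. (\<omega>, W u \<omega> - W t \<omega>))) (A \<times> B)" .
  next
    show "sigma_finite_measure (distr M (past t) (\<lambda>\<omega>. \<omega>))" ..
    show "sigma_finite_measure (gauss (sqrt (u - t)) :: (real ^ 'm) measure)" ..
    show "sets (distr M (past t) (\<lambda>\<omega>. \<omega>) \<Otimes>\<^sub>M (gauss (sqrt (u - t)) :: (real ^ 'm) measure)) =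
      sets (distr M (past t \<Otimes>\<^sub>M borel) (\<lambda>\<omega>. (\<omega>, W u \<omega> - W t \<omega>)))"
      unfolding sets_distr by (rule sets_pair_measure_cong) simp_all
  qed
  have meas: "(\<lambda>\<omega>. \<integral>\<^sup>+\<xi>. g (\<omega>, \<xi>) \<partial>gauss (sqrt (u - t))) \<in> borel_measurable (past t)"
    by measurable
  have g' [measurable]: "g \<in> borel_measurable (distr M (past t) (\<lambda>\<omega>. \<omega>) \<Otimes>\<^sub>M gauss (sqrt (u - t)))"
    using g unfolding measurable_cong_sets[OF sets_pair_measure_cong[OF sets_distr sets_gauss] refl] .
  have "(\<integral>\<^sup>+\<omega>. g (\<omega>, W u \<omega> - W t \<omega>) \<partial>M) = (\<integral>\<^sup>+x. g x \<partial>distr M (past t \<Otimes>\<^sub>M borel) (\<lambda>\<omega>. (\<omega>, W u \<omega> - W t \<omega>)))"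
    by (subst nn_integral_distr) auto
  also have "\<dots> = (\<integral>\<^sup>+x. g x \<partial>(distr M (past t) (\<lambda>\<omega>. \<omega>) \<Otimes>\<^sub>M gauss (sqrt (u - t))))"
    using prod by simp
  also have "\<dots> = (\<integral>\<^sup>+\<omega>. \<integral>\<^sup>+\<xi>. g (\<omega>, \<xi>) \<partial>gauss (sqrt (u - t)) \<partial>distr M (past t) (\<lambda>\<omega>. \<omega>))"
    by (rule N.nn_integral_fst[symmetric]) (rule g')
  also have "\<dots> = (\<integral>\<^sup>+\<omega>. \<integral>\<^sup>+\<xi>. g (\<omega>, \<xi>) \<partial>gauss (sqrt (u - t)) \<partial>M)"
    by (rule nn_integral_distr) (auto intro: meas)
  finally show ?thesis .
qed

end

section \<open>Forward and backward Markov chains\<close>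

text \<open>Bayes' formula for (W_s, W_(s+\<delta>)): given the later value y, the earlier one is
  normal with mean s y / (s + \<delta>) and variance \<delta> s / (s + \<delta>). The exponents
  agree by completing the square.\<close>

lemma normal_density_bridge:
  assumes "s > 0" "\<delta> > 0"
  shows "normal_density 0 (sqrt s) x * normal_density 0 (sqrt \<delta>) (y - x)
       = normal_density 0 (sqrt (s + \<delta>)) y * normal_density 0 (sqrt (\<delta> * s / (s + \<delta>))) (x - s / (s + \<delta>) * y)"
proof -
  have "x\<^sup>2 / (2 * s) + (y - x)\<^sup>2 / (2 * \<delta>) = y\<^sup>2 / (2 * (s + \<delta>)) + (x - s / (s + \<delta>) * y)\<^sup>2 / (2 * (\<delta> * s / (s + \<delta>)))"
  proof -
    have nz: "2 * s \<noteq> 0" "2 * \<delta> \<noteq> 0" "2 * (s + \<delta>) \<noteq> 0" "2 * \<delta> * s * (s + \<delta>) \<noteq> 0"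
      using assms by auto
    have "x - s / (s + \<delta>) * y = (x * (s + \<delta>) - s * y) / (s + \<delta>)"
      using assms by (simp add: field_simps)
    then have "(x - s / (s + \<delta>) * y)\<^sup>2 / (2 * (\<delta> * s / (s + \<delta>))) = (x * (s + \<delta>) - s * y)\<^sup>2 / (2 * \<delta> * s * (s + \<delta>))"
      using assms by (simp add: power_divide power2_eq_square)
    moreover have "x\<^sup>2 / (2 * s) + (y - x)\<^sup>2 / (2 * \<delta>) = (x\<^sup>2 * \<delta> + (y - x)\<^sup>2 * s) * (s + \<delta>) / (2 * \<delta> * s * (s + \<delta>))"
    proof -
      have *: "x\<^sup>2 / (2 * s) = x\<^sup>2 * (\<delta> * (s + \<delta>)) / (2 * \<delta> * s * (s + \<delta>))"
        "(y - x)\<^sup>2 / (2 * \<delta>) = (y - x)\<^sup>2 * (s * (s + \<delta>)) / (2 * \<delta> * s * (s + \<delta>))"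
        unfolding frac_eq_eq[OF nz(1) nz(4)] frac_eq_eq[OF nz(2) nz(4)] by (simp_all only: mult_ac)
      show ?thesis unfolding * add_divide_distrib[symmetric] by (simp only: distrib_right mult.assoc)
    qed
    moreover have "y\<^sup>2 / (2 * (s + \<delta>)) = y\<^sup>2 * (\<delta> * s) / (2 * \<delta> * s * (s + \<delta>))"
      unfolding frac_eq_eq[OF nz(3) nz(4)] by (simp only: mult_ac)
    moreover have "(x\<^sup>2 * \<delta> + (y - x)\<^sup>2 * s) * (s + \<delta>) = y\<^sup>2 * (\<delta> * s) + (x * (s + \<delta>) - s * y)\<^sup>2"
      by (simp add: power2_eq_square algebra_simps)
    ultimately show ?thesis by (simp add: add_divide_distrib)
  qed
  note eq = this
  have ex: "exp (- p / q) * exp (- p' / q') = exp (- (p / q + p' / q'))" for p q p' q' :: real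
    by (simp add: exp_add[symmetric])
  have ee: "exp (- x\<^sup>2 / (2 * s)) * exp (- (y - x)\<^sup>2 / (2 * \<delta>))
    = exp (- y\<^sup>2 / (2 * (s + \<delta>))) * exp (- (x - s / (s + \<delta>) * y)\<^sup>2 / (2 * (\<delta> * s / (s + \<delta>))))"
    unfolding ex eq by (rule refl)
  have sq: "sqrt (2 * pi * s) * sqrt (2 * pi * \<delta>) = sqrt (2 * pi * (s + \<delta>)) * sqrt (2 * pi * (\<delta> * s / (s + \<delta>)))"
    unfolding real_sqrt_mult[symmetric] using assms by (simp add: field_simps)
  have p: "(sqrt s)\<^sup>2 = s" "(sqrt \<delta>)\<^sup>2 = \<delta>" "(sqrt (s + \<delta>))\<^sup>2 = s + \<delta>" "(sqrt (\<delta> * s / (s + \<delta>)))\<^sup>2 = \<delta> * s / (s + \<delta>)"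
    using assms by simp_all
  have q: "1 / A * E * (1 / B * F) = 1 / (A * B) * (E * F)" for A B E F :: real by simp
  show ?thesis
    unfolding normal_density_def p diff_0_right q ee sq by (rule refl)
qed

lemma nn_integral_lborel_translate:
  fixes f :: "'a::euclidean_space \<Rightarrow> ennreal"
  assumes [measurable]: "f \<in> borel_measurable borel"
  shows "(\<integral>\<^sup>+x. f (c + x) \<partial>lborel) = (\<integral>\<^sup>+x. f x \<partial>lborel)"
proof -
  have "(\<integral>\<^sup>+x. f x \<partial>lborel) = (\<integral>\<^sup>+x. f x \<partial>distr lborel borel ((+) c))"
    by (simp add: lborel_distr_plus)
  also have "\<dots> = (\<integral>\<^sup>+x. f (c + x) \<partial>lborel)"
    by (subst nn_integral_distr) auto
  finally show ?thesis ..
qed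

text \<open>Both sides integrate \<open>g\<close> at W_s times \<open>\<psi>\<close> at
  W_(s+\<delta>), conditioning once on the earlier and once on the later value.
  \<open>normal_density_bridge\<close> in each coordinate and Tonelli's theorem connect
  them.\<close>

lemma gauss_reversal:
  fixes g \<psi> :: "real ^ 'm \<Rightarrow> ennreal"
  assumes s: "s > 0" "\<delta> > 0" and [measurable]: "g \<in> borel_measurable borel" "\<psi> \<in> borel_measurable borel"
  shows "(\<integral>\<^sup>+x. g x * (\<integral>\<^sup>+\<xi>. \<psi> (x + \<xi>) \<partial>gauss (sqrt \<delta>)) \<partial>gauss (sqrt s))
       = (\<integral>\<^sup>+y. \<psi> y * (\<integral>\<^sup>+\<xi>. g ((s / (s + \<delta>)) *\<^sub>R y + \<xi>) \<partial>gauss (sqrt (\<delta> * s / (s + \<delta>)))) \<partial>gauss (sqrt (s + \<delta>)))"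
proof -
  define \<phi> where "\<phi> v x = ennreal (\<Prod>i\<in>UNIV. normal_density 0 (sqrt v) (x $ i))" for v and x :: "real ^ 'm"
  define v where "v = \<delta> * s / (s + \<delta>)"
  define a where "a = s / (s + \<delta>)"
  have [measurable]: "\<phi> v \<in> borel_measurable borel" for v unfolding \<phi>_def by measurable
  have bridge: "\<phi> s x * \<phi> \<delta> (y - x) = \<phi> (s + \<delta>) y * \<phi> v (x - a *\<^sub>R y)" for x y
  proof -
    have "(\<Prod>i\<in>UNIV. normal_density 0 (sqrt s) (x $ i)) * (\<Prod>i\<in>UNIV. normal_density 0 (sqrt \<delta>) ((y - x) $ i))
      = (\<Prod>i\<in>UNIV. normal_density 0 (sqrt (s + \<delta>)) (y $ i)) * (\<Prod>i\<in>UNIV. normal_density 0 (sqrt v) ((x - a *\<^sub>R y) $ i))"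
      unfolding prod.distrib[symmetric] v_def a_def vector_minus_component vector_scaleR_component real_scaleR_def
      by (intro prod.cong refl normal_density_bridge s)
    then show ?thesis
      unfolding \<phi>_def by (simp only: ennreal_mult[symmetric] prod_nonneg normal_density_nonneg)
  qed
  have G: "(\<integral>\<^sup>+x. f x \<partial>gauss (sqrt v)) = (\<integral>\<^sup>+x. \<phi> v x * f x \<partial>lborel)"
    if [measurable]: "f \<in> borel_measurable borel" for f v
    unfolding \<phi>_def by (rule nn_integral_gauss) simp
  have tr: "(\<integral>\<^sup>+\<xi>. f (c + \<xi>) \<partial>gauss (sqrt v)) = (\<integral>\<^sup>+x. \<phi> v (x - c) * f x \<partial>lborel)"
    if [measurable]: "f \<in> borel_measurable borel" for f v c
  proof -
    have "(\<integral>\<^sup>+\<xi>. f (c + \<xi>) \<partial>gauss (sqrt v)) = (\<integral>\<^sup>+x. \<phi> v x * f (c + x) \<partial>lborel)"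
      by (rule G) simp
    also have "\<dots> = (\<integral>\<^sup>+x. \<phi> v ((c + x) - c) * f (c + x) \<partial>lborel)" by simp
    also have "\<dots> = (\<integral>\<^sup>+x. \<phi> v (x - c) * f x \<partial>lborel)"
      by (rule nn_integral_lborel_translate) simp
    finally show ?thesis .
  qed
  have "(\<integral>\<^sup>+x. g x * (\<integral>\<^sup>+\<xi>. \<psi> (x + \<xi>) \<partial>gauss (sqrt \<delta>)) \<partial>gauss (sqrt s))
      = (\<integral>\<^sup>+x. \<phi> s x * (g x * (\<integral>\<^sup>+y. \<phi> \<delta> (y - x) * \<psi> y \<partial>lborel)) \<partial>lborel)"
    unfolding tr[OF assms(4)] by (rule G) simp
  also have "\<dots> = (\<integral>\<^sup>+x. \<integral>\<^sup>+y. \<phi> s x * \<phi> \<delta> (y - x) * (g x * \<psi> y) \<partial>lborel \<partial>lborel)"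
  proof (rule nn_integral_cong)
    fix x :: "real ^ 'm"
    have "\<phi> s x * (g x * (\<integral>\<^sup>+y. \<phi> \<delta> (y - x) * \<psi> y \<partial>lborel)) = (\<phi> s x * g x) * (\<integral>\<^sup>+y. \<phi> \<delta> (y - x) * \<psi> y \<partial>lborel)"
      by (simp only: mult.assoc)
    also have "\<dots> = (\<integral>\<^sup>+y. (\<phi> s x * g x) * (\<phi> \<delta> (y - x) * \<psi> y) \<partial>lborel)"
      by (rule nn_integral_cmult[symmetric]) measurable
    finally show "\<phi> s x * (g x * (\<integral>\<^sup>+y. \<phi> \<delta> (y - x) * \<psi> y \<partial>lborel)) = (\<integral>\<^sup>+y. \<phi> s x * \<phi> \<delta> (y - x) * (g x * \<psi> y) \<partial>lborel)"
      by (simp only: mult_ac)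
  qed
  also have "\<dots> = (\<integral>\<^sup>+y. \<integral>\<^sup>+x. \<phi> s x * \<phi> \<delta> (y - x) * (g x * \<psi> y) \<partial>lborel \<partial>lborel)"
    by (rule lborel_pair.Fubini') simp
  also have "\<dots> = (\<integral>\<^sup>+y. \<phi> (s + \<delta>) y * (\<psi> y * (\<integral>\<^sup>+x. \<phi> v (x - a *\<^sub>R y) * g x \<partial>lborel)) \<partial>lborel)"
  proof (rule nn_integral_cong)
    fix y :: "real ^ 'm"
    have "(\<integral>\<^sup>+x. \<phi> s x * \<phi> \<delta> (y - x) * (g x * \<psi> y) \<partial>lborel) = (\<integral>\<^sup>+x. (\<phi> (s + \<delta>) y * \<psi> y) * (\<phi> v (x - a *\<^sub>R y) * g x) \<partial>lborel)"
      unfolding bridge by (simp only: mult_ac)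
    also have "\<dots> = (\<phi> (s + \<delta>) y * \<psi> y) * (\<integral>\<^sup>+x. \<phi> v (x - a *\<^sub>R y) * g x \<partial>lborel)"
      by (rule nn_integral_cmult) measurable
    finally show "(\<integral>\<^sup>+x. \<phi> s x * \<phi> \<delta> (y - x) * (g x * \<psi> y) \<partial>lborel) = \<phi> (s + \<delta>) y * (\<psi> y * (\<integral>\<^sup>+x. \<phi> v (x - a *\<^sub>R y) * g x \<partial>lborel))"
      by (simp only: mult.assoc)
  qed
  also have "\<dots> = (\<integral>\<^sup>+y. \<psi> y * (\<integral>\<^sup>+\<xi>. g (a *\<^sub>R y + \<xi>) \<partial>gauss (sqrt v)) \<partial>gauss (sqrt (s + \<delta>)))"
    unfolding tr[OF assms(3)] by (rule G[symmetric]) simp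
  finally show ?thesis by (simp add: v_def a_def)
qed

context brownian_motion begin

text \<open>\<open>E\<close> is an arbitrary past event so that the test at the next grid time can
  be absorbed into it before the induction hypothesis is applied.\<close>

lemma emeasure_forward:
  assumes t: "0 \<le> t" and \<delta>: "\<delta> > 0" and H [measurable]: "\<And>i. H i \<in> sets borel"
    and E: "E \<in> sets (past (t + real j * \<delta>))"
  shows "emeasure M {\<omega> \<in> E. \<forall>i. j < i \<and> i \<le> j + k \<longrightarrow> W (t + real i * \<delta>) \<omega> \<in> H i}
    = (\<integral>\<^sup>+\<omega>. indicator E \<omega> * surv (\<lambda>_. 1) (\<lambda>_. sqrt \<delta>) H k j (W (t + real j * \<delta>) \<omega>) \<partial>M)"
  using E
proof (induction k arbitrary: j E)
  case 0
  then have "E \<in> sets M" using past_le by blast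
  moreover have "{\<omega> \<in> E. \<forall>i. j < i \<and> i \<le> j + 0 \<longrightarrow> W (t + real i * \<delta>) \<omega> \<in> H i} = E"
    by (auto dest: leD)
  ultimately show ?case by simp
next
  case (Suc k)
  let ?S = "surv (\<lambda>_. 1) (\<lambda>_. sqrt \<delta>) H k (Suc j)"
  define u where "u = t + real j * \<delta>"
  define u' where "u' = t + real (Suc j) * \<delta>"
  have u: "0 \<le> u" "u < u'" "u' - u = \<delta>" using t \<delta> by (auto simp: u_def u'_def algebra_simps)
  have [measurable]: "?S \<in> borel_measurable borel"
    using \<delta> by (intro measurable_surv[where n="Suc j + k"]) auto
  have [measurable]: "W u \<in> borel_measurable (past u)" using u by (intro measurable_past) auto
  have [measurable]: "E \<in> sets (past u)" using Suc.prems by (simp add: u_def)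
  define E' where "E' = E \<inter> (W u' -` H (Suc j) \<inter> space M)"
  have E': "E' \<in> sets (past u')"
  proof -
    have "E \<in> sets (past u')" using past_mono[of u u'] u Suc.prems by (auto simp: u_def)
    moreover have "W u' -` H (Suc j) \<inter> space (past u') \<in> sets (past u')"
      using u by (intro measurable_sets[OF measurable_past]) auto
    ultimately show ?thesis by (auto simp: E'_def)
  qed
  have E_sub: "E \<subseteq> space M" using Suc.prems sets.sets_into_space[of E "past u"] by (simp add: u_def)
  have "{\<omega> \<in> E. \<forall>i. j < i \<and> i \<le> j + Suc k \<longrightarrow> W (t + real i * \<delta>) \<omega> \<in> H i}
      = {\<omega> \<in> E'. \<forall>i. Suc j < i \<and> i \<le> Suc j + k \<longrightarrow> W (t + real i * \<delta>) \<omega> \<in> H i}" (is "?l = ?r")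
  proof -
    have "j < i \<and> i \<le> j + Suc k \<longleftrightarrow> i = Suc j \<or> Suc j < i \<and> i \<le> Suc j + k" for i
      by linarith
    then have *: "(\<forall>i. j < i \<and> i \<le> j + Suc k \<longrightarrow> P i) \<longleftrightarrow> P (Suc j) \<and> (\<forall>i. Suc j < i \<and> i \<le> Suc j + k \<longrightarrow> P i)" for P
      by (simp only: imp_disjL all_conj_distrib simp_thms)
    show ?thesis
    proof (rule set_eqI)
      fix \<omega>
      show "\<omega> \<in> ?l \<longleftrightarrow> \<omega> \<in> ?r"
        unfolding mem_Collect_eq * E'_def Int_iff vimage_eq u'_def using E_sub by blast
    qed
  qed
  then have "emeasure M ?l = emeasure M ?r" by simp
  also have "\<dots> = (\<integral>\<^sup>+\<omega>. indicator E' \<omega> * ?S (W u' \<omega>) \<partial>M)"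
    using Suc.IH[of E' "Suc j"] E' unfolding u'_def by simp
  also have "\<dots> = (\<integral>\<^sup>+\<omega>. (\<lambda>(\<omega>, \<xi>). indicator E \<omega> * (indicator (H (Suc j)) (W u \<omega> + \<xi>) * ?S (W u \<omega> + \<xi>))) (\<omega>, W u' \<omega> - W u \<omega>) \<partial>M)"
    by (intro nn_integral_cong) (auto simp: E'_def indicator_def)
  also have "\<dots> = (\<integral>\<^sup>+\<omega>. \<integral>\<^sup>+\<xi>. indicator E \<omega> * (indicator (H (Suc j)) (W u \<omega> + \<xi>) * ?S (W u \<omega> + \<xi>)) \<partial>gauss (sqrt \<delta>) \<partial>M)"
    using u by (subst nn_integral_past_increment) auto
  also have "\<dots> = (\<integral>\<^sup>+\<omega>. indicator E \<omega> * surv (\<lambda>_. 1) (\<lambda>_. sqrt \<delta>) H (Suc k) j (W u \<omega>) \<partial>M)"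
    by (intro nn_integral_cong) (simp add: nn_integral_cmult)
  finally show ?case by (simp add: u_def)
qed

text \<open>Here \<open>surv\<close> runs in reversed time: its index j stands for grid time
  \<open>s (n - j)\<close>, and its factors and variances are those of the path conditioned on the
  later value.\<close>

lemma emeasure_backward:
  fixes b \<delta> :: real and n :: nat and H :: "nat \<Rightarrow> (real ^ 'm) set"
  defines "s \<equiv> \<lambda>i. b + real i * \<delta>"
  defines "a \<equiv> \<lambda>j. s (n - Suc j) / s (n - j)"
  defines "\<sigma> \<equiv> \<lambda>j. sqrt (\<delta> * s (n - Suc j) / s (n - j))"
  assumes b: "0 < b" and \<delta>: "0 < \<delta>" and H [measurable]: "\<And>i. H i \<in> sets borel"
  shows "emeasure M {\<omega> \<in> space M. \<forall>i\<le>n. W (s i) \<omega> \<in> H i}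
    = (\<integral>\<^sup>+\<omega>. indicator (H n) (W (s n) \<omega>) * surv a \<sigma> (\<lambda>j. H (n - j)) n 0 (W (s n) \<omega>) \<partial>M)"
proof -
  let ?B = "\<lambda>i. surv a \<sigma> (\<lambda>j. H (n - j)) i (n - i)"
  let ?F = "\<lambda>i. surv (\<lambda>_. 1) (\<lambda>_. sqrt \<delta>) H (n - i) i"
  have s: "0 < s i" for i using b \<delta> by (auto simp: s_def intro!: add_pos_nonneg)
  have \<sigma>: "0 < \<sigma> i" for i using s \<delta> by (simp add: \<sigma>_def)
  have Bm [measurable]: "?B i \<in> borel_measurable borel" if "i \<le> n" for i
    using that \<sigma> by (intro measurable_surv[where n=n]) auto
  have Fm [measurable]: "?F i \<in> borel_measurable borel" if "i \<le> n" for i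
    using that \<delta> by (intro measurable_surv[where n=n]) auto
  \<comment> \<open>Invariant for a split at grid time \<open>s i\<close>: backward survival before
    it times forward survival after it. Each induction step turns one forward transition into a
    backward one by \<open>gauss_reversal\<close>; at i = n only the backward part is left.\<close>
  have "emeasure M {\<omega> \<in> space M. \<forall>i\<le>n. W (s i) \<omega> \<in> H i}
    = (\<integral>\<^sup>+x. (indicator (H i) x * ?B i x) * ?F i x \<partial>gauss (sqrt (s i)))" if "i \<le> n" for i
    using that
  proof (induction i)
    case 0
    define E where "E = W b -` H 0 \<inter> space M"
    have E: "E \<in> sets (past (b + real 0 * \<delta>))"
      using measurable_sets[OF measurable_past[of b b], of "H 0"] b by (simp add: E_def)
    have "{\<omega> \<in> space M. \<forall>i\<le>n. W (s i) \<omega> \<in> H i} = {\<omega> \<in> E. \<forall>i. 0 < i \<and> i \<le> 0 + n \<longrightarrow> W (b + real i * \<delta>) \<omega> \<in> H i}"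
    proof (rule set_eqI)
      fix \<omega>
      have *: "(\<forall>i\<le>n. P i) \<longleftrightarrow> P 0 \<and> (\<forall>i. 0 < i \<and> i \<le> 0 + n \<longrightarrow> P i)" for P
        by (metis add_0 gr_zeroI zero_le)
      have "(\<forall>i\<le>n. W (s i) \<omega> \<in> H i) \<longleftrightarrow> W b \<omega> \<in> H 0 \<and> (\<forall>i. 0 < i \<and> i \<le> 0 + n \<longrightarrow> W (b + real i * \<delta>) \<omega> \<in> H i)"
        using *[of "\<lambda>i. W (s i) \<omega> \<in> H i"] unfolding s_def by simp
      then show "\<omega> \<in> {\<omega> \<in> space M. \<forall>i\<le>n. W (s i) \<omega> \<in> H i} \<longleftrightarrow>
         \<omega> \<in> {\<omega> \<in> E. \<forall>i. 0 < i \<and> i \<le> 0 + n \<longrightarrow> W (b + real i * \<delta>) \<omega> \<in> H i}"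
        unfolding mem_Collect_eq E_def Int_iff vimage_eq by blast
    qed
    then have "emeasure M {\<omega> \<in> space M. \<forall>i\<le>n. W (s i) \<omega> \<in> H i}
      = (\<integral>\<^sup>+\<omega>. indicator E \<omega> * ?F 0 (W (b + real 0 * \<delta>) \<omega>) \<partial>M)"
      using emeasure_forward[OF less_imp_le[OF b] \<delta> H E, of n] by simp
    also have "\<dots> = (\<integral>\<^sup>+\<omega>. indicator (H 0) (W b \<omega>) * ?F 0 (W b \<omega>) \<partial>M)"
      by (intro nn_integral_cong) (simp add: E_def indicator_def)
    also have "\<dots> = (\<integral>\<^sup>+x. indicator (H 0) x * ?F 0 x \<partial>distr M borel (W b))"
      using b Fm[of 0] by (subst nn_integral_distr) auto
    finally show ?case using b by (simp add: distr_W s_def)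
  next
    case (Suc i)
    have i: "i < n" "i \<le> n" "Suc i \<le> n" using Suc.prems by auto
    have n_i: "n - i = Suc (n - Suc i)" "n - (n - i) = i" "n - (n - Suc i) = Suc i" using i by auto
    have s_i: "s i + \<delta> = s (Suc i)" by (simp add: s_def algebra_simps)
    have F: "?F i = (\<lambda>x. \<integral>\<^sup>+\<xi>. indicator (H (Suc i)) (x + \<xi>) * ?F (Suc i) (x + \<xi>) \<partial>gauss (sqrt \<delta>))"
      by (subst n_i(1)) simp
    have B: "?B (Suc i) y = (\<integral>\<^sup>+\<xi>. indicator (H i) ((s i / s (Suc i)) *\<^sub>R y + \<xi>) * ?B i ((s i / s (Suc i)) *\<^sub>R y + \<xi>)
        \<partial>gauss (sqrt (\<delta> * s i / s (Suc i))))" for y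
      using n_i by (simp add: a_def \<sigma>_def)
    note [measurable] = Bm[OF i(2)] Fm[OF i(3)]
    have "emeasure M {\<omega> \<in> space M. \<forall>i\<le>n. W (s i) \<omega> \<in> H i}
      = (\<integral>\<^sup>+x. (indicator (H i) x * ?B i x) * ?F i x \<partial>gauss (sqrt (s i)))"
      using Suc by simp
    also have "\<dots> = (\<integral>\<^sup>+y. (indicator (H (Suc i)) y * ?F (Suc i) y) * ?B (Suc i) y \<partial>gauss (sqrt (s (Suc i))))"
      unfolding F B s_i[symmetric] by (rule gauss_reversal) (use s \<delta> in auto)
    finally show ?case by (simp add: mult_ac)
  qed
  from this[of n] have "emeasure M {\<omega> \<in> space M. \<forall>i\<le>n. W (s i) \<omega> \<in> H i}
    = (\<integral>\<^sup>+x. indicator (H n) x * ?B n x \<partial>gauss (sqrt (s n)))" by simp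
  also have "\<dots> = (\<integral>\<^sup>+x. indicator (H n) x * ?B n x \<partial>distr M borel (W (s n)))"
    using s by (simp add: distr_W)
  also have "\<dots> = (\<integral>\<^sup>+\<omega>. indicator (H n) (W (s n) \<omega>) * ?B n (W (s n) \<omega>) \<partial>M)"
    using s[of n] Bm[of n] by (subst nn_integral_distr) auto
  finally show ?thesis by simp
qed

end

section \<open>Tubes with exterior balls\<close>

lemma mem_nbhd_iff: "x \<in> nbhd A v \<longleftrightarrow> (\<exists>y\<in>A. dist x y < v)"
  by (simp add: nbhd_def rho_def INF_less_iff)

lemma open_nbhd: "open (nbhd A v)"
proof -
  have "nbhd A v = (\<Union>y\<in>A. ball y v)" by (auto simp: mem_nbhd_iff dist_commute)
  then show ?thesis by auto
qed

text \<open>The infimum in \<open>rho_h\<close> need not be attained, whence the strict slack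
  between \<open>k\<close> and \<open>e\<close>.\<close>

lemma rho_h_subset_nbhd:
  assumes "rho_h A B \<le> ereal k" "k < e"
  shows "A \<subseteq> nbhd B e" "B \<subseteq> nbhd A e"
proof -
  have "rho_h A B < ereal e" using assms by (auto intro: le_less_trans)
  then obtain d where d: "d < e" "A \<subseteq> nbhd B d" "B \<subseteq> nbhd A d"
    unfolding rho_h_def Inf_less_iff by auto
  have "nbhd C d \<subseteq> nbhd C e" for C :: "'a set"
    using d(1) by (auto simp: mem_nbhd_iff) (meson order.strict_trans)
  then show "A \<subseteq> nbhd B e" "B \<subseteq> nbhd A e" using d by blast+
qed

text \<open>Identifies the strip in the class definition with the points of the section close to its
  complement. For an empty complement \<open>rho\<close> is infinite, in agreement with the
  right-hand side.\<close>

lemma rho_pos_iff_open: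
  assumes "open A"
  shows "0 < rho x (- A) \<longleftrightarrow> x \<in> A"
proof
  assume "0 < rho x (- A)"
  then show "x \<in> A"
    using INF_lower[of x "- A" "\<lambda>y. ereal (dist x y)"] by (force simp: rho_def zero_ereal_def)
next
  assume "x \<in> A"
  then obtain e where e: "e > 0" "ball x e \<subseteq> A" using assms openE by blast
  have "ereal e \<le> rho x (- A)"
    unfolding rho_def using e by (intro INF_greatest) (auto simp: subset_iff not_less[symmetric])
  then show "0 < rho x (- A)" using e by (auto intro: less_le_trans[rotated] simp: zero_ereal_def)
qed

text \<open>The segment from x to y is connected and meets both \<open>A\<close> and its
  complement.\<close>

lemma near_frontier:
  fixes x :: "'a::euclidean_space"
  assumes "x \<in> A" "y \<notin> A" "dist x y < v"
  shows "\<exists>g\<in>frontier A. dist x g < v"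
proof -
  have "closed_segment x y \<inter> frontier A \<noteq> {}"
    using assms by (intro connected_Int_frontier) auto
  then obtain g where "g \<in> closed_segment x y" "g \<in> frontier A" by blast
  then show ?thesis using assms(3) dist_in_closed_segment[of g x y] by (auto intro!: bexI[of _ g] simp: dist_commute)
qed

section \<open>Measurability of staying events\<close>

context brownian_motion begin

text \<open>By continuity and compactness, staying in \<open>U\<close> means that the distance to
  the complement has a lower bound 1 / (n + 1), and such a bound can be tested on a countable dense
  set of times.\<close>

lemma sets_stay_compact:
  assumes a: "0 \<le> a" and U: "open U"
  shows "{\<omega> \<in> space M. \<forall>s\<in>{a..b}. (s, W s \<omega>) \<in> U} \<in> sets (past b)"
proof (cases "U = UNIV")
  \<comment> \<open>\<open>infdist\<close> to the empty set is 0, so the distance criterion used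
    otherwise would fail here.\<close>
  case True
  then show ?thesis using sets.top[of "past b"] by simp
next
  case False
  define f where "f \<omega> s = infdist (s, W s \<omega>) (- U)" for \<omega> s
  obtain D where D: "countable D" "D \<subseteq> {a..b}" "{a..b} \<subseteq> closure D"
    using separable by blast
  have f_pos: "(s, W s \<omega>) \<in> U \<longleftrightarrow> 0 < f \<omega> s" for s \<omega>
    using in_closed_iff_infdist_zero[of "- U" "(s, W s \<omega>)"] U False infdist_nonneg[of "(s, W s \<omega>)" "- U"]
    unfolding f_def by (auto simp: less_le)
  have cont: "continuous_on {a..b} (f \<omega>)" if "\<omega> \<in> space M" for \<omega>
    unfolding f_def using a that
    by (intro continuous_on_infdist continuous_on_Pair continuous_on_id continuous_on_subset[OF continuous_path]) auto
  have iff: "(\<forall>s\<in>{a..b}. (s, W s \<omega>) \<in> U) \<longleftrightarrow> (\<exists>n. \<forall>s\<in>D. 1 / real (Suc n) \<le> f \<omega> s)" if \<omega>: "\<omega> \<in> space M" for \<omega>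
  proof
    assume L: "\<forall>s\<in>{a..b}. (s, W s \<omega>) \<in> U"
    show "\<exists>n. \<forall>s\<in>D. 1 / real (Suc n) \<le> f \<omega> s"
    proof (cases "{a..b} = {}")
      case True
      then show ?thesis using D by auto
    next
      case False
      obtain x where x: "x \<in> {a..b}" "\<forall>y\<in>{a..b}. f \<omega> x \<le> f \<omega> y"
        using continuous_attains_inf[OF compact_Icc False cont[OF \<omega>]] by blast
      then have "0 < f \<omega> x" using L f_pos by blast
      then obtain n where n: "1 / real (Suc n) < f \<omega> x" using nat_approx_posE by blast
      have "1 / real (Suc n) \<le> f \<omega> s" if "s \<in> D" for s
        using that D(2) x(2) n by (meson less_imp_le order_trans subsetD)
      then show ?thesis by blast
    qed
  next
    assume "\<exists>n. \<forall>s\<in>D. 1 / real (Suc n) \<le> f \<omega> s"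
    then obtain n where n: "\<forall>s\<in>D. 1 / real (Suc n) \<le> f \<omega> s" ..
    show "\<forall>s\<in>{a..b}. (s, W s \<omega>) \<in> U"
    proof
      fix s assume s: "s \<in> {a..b}"
      have "closure D \<subseteq> {a..b}" using D(2) closure_minimal closed_atLeastAtMost by blast
      then have "continuous_on (closure D) (f \<omega>)" using cont[OF \<omega>] continuous_on_subset by blast
      then have "1 / real (Suc n) \<le> f \<omega> s"
        by (rule continuous_ge_on_closure) (use s D n in auto)
      moreover have "0 < 1 / real (Suc n)" by simp
      ultimately show "(s, W s \<omega>) \<in> U" using f_pos less_le_trans by blast
    qed
  qed
  have m: "(\<lambda>\<omega>. f \<omega> s) \<in> borel_measurable (past b)" if "s \<in> D" for s
  proof -
    have "W s \<in> borel_measurable (past b)" using that D a by (intro measurable_past) auto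
    then have "(\<lambda>\<omega>. (s, W s \<omega>)) \<in> borel_measurable (past b)" by (intro borel_measurable_Pair) auto
    moreover have "(\<lambda>p. infdist p (- U)) \<in> borel_measurable borel"
      by (intro borel_measurable_continuous_onI continuous_on_infdist continuous_on_id)
    ultimately show ?thesis unfolding f_def by (rule measurable_compose)
  qed
  have "{\<omega> \<in> space (past b). \<forall>s\<in>D. 1 / real (Suc n) \<le> f \<omega> s} \<in> sets (past b)" for n
  proof (rule sets.sets_Collect_countable_All'[OF _ D(1)])
    fix s assume "s \<in> D"
    then show "{\<omega> \<in> space (past b). 1 / real (Suc n) \<le> f \<omega> s} \<in> sets (past b)"
      by (intro borel_measurable_le borel_measurable_const m)
  qed
  then have "{\<omega> \<in> space (past b). \<exists>n. \<forall>s\<in>D. 1 / real (Suc n) \<le> f \<omega> s} \<in> sets (past b)"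
    by (rule sets.sets_Collect_countable_Ex)
  moreover have "{\<omega> \<in> space (past b). \<exists>n. \<forall>s\<in>D. 1 / real (Suc n) \<le> f \<omega> s} = {\<omega> \<in> space M. \<forall>s\<in>{a..b}. (s, W s \<omega>) \<in> U}"
    using iff by auto
  ultimately show ?thesis by simp
qed

text \<open>Time 0 is left out because the path starts on the boundary of G; a countable
  intersection recovers the half-open interval.\<close>

lemma sets_stay_half_open:
  assumes U: "open U"
  shows "{\<omega> \<in> space M. \<forall>s. 0 < s \<and> s \<le> b \<longrightarrow> (s, W s \<omega>) \<in> U} \<in> sets (past b)"
proof (cases "0 < b")
  case False
  then have "{\<omega> \<in> space M. \<forall>s. 0 < s \<and> s \<le> b \<longrightarrow> (s, W s \<omega>) \<in> U} = space (past b)" by auto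
  then show ?thesis by (metis sets.top)
next
  case True
  have "{\<omega> \<in> space M. \<forall>s. 0 < s \<and> s \<le> b \<longrightarrow> (s, W s \<omega>) \<in> U}
      = (\<Inter>n. {\<omega> \<in> space M. \<forall>s\<in>{1 / real (Suc n)..b}. (s, W s \<omega>) \<in> U})" (is "?l = ?r")
  proof (intro set_eqI iffI)
    fix \<omega> assume "\<omega> \<in> ?l"
    moreover have "0 < s" if "1 / real (Suc n) \<le> s" for n s
      using that by (meson less_le_trans of_nat_0_less_iff zero_less_Suc zero_less_divide_1_iff)
    ultimately show "\<omega> \<in> ?r" by auto
  next
    fix \<omega> assume r: "\<omega> \<in> ?r"
    have "(s, W s \<omega>) \<in> U" if s: "0 < s" "s \<le> b" for s
    proof -
      obtain n where "1 / real (Suc n) < s" using nat_approx_posE s(1) by blast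
      then have "s \<in> {1 / real (Suc n)..b}" using s by simp
      then show ?thesis using r by blast
    qed
    then show "\<omega> \<in> ?l" using r by blast
  qed
  also have "\<dots> \<in> sets (past b)"
    by (rule sets.countable_INT) (use sets_stay_compact[OF _ U] in auto)
  finally show ?thesis .
qed

end

section \<open>Motion of the sections and their exterior balls\<close>

lemma open_time_section: "open G \<Longrightarrow> open (time_section G t)"
proof -
  assume "open G"
  then have "open ((\<lambda>x. (t, x)) -` G)" by (intro open_vimage continuous_intros) auto
  then show ?thesis by (simp add: time_section_def vimage_def)
qed

locale tube = brownian_motion M W for M :: "'w measure" and W :: "real \<Rightarrow> 'w \<Rightarrow> real ^ 'm" +
  fixes T K \<beta> \<gamma> :: real and G :: "(real \<times> (real ^ 'm)) set"
  assumes T: "0 < T" and K: "0 < K" and \<beta>: "0 < \<beta>" and \<gamma>: "0 < \<gamma>" and G: "G \<in> class_G_params M W T K \<beta> \<gamma>"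
begin

abbreviation "Gs \<equiv> time_section G"

lemma open_G: "open G"
  using G by (simp add: class_G_params_def class_G_def)

lemma open_Gs: "open (Gs t)"
  by (rule open_time_section[OF open_G])

lemma mem_Gs: "x \<in> Gs t \<longleftrightarrow> (t, x) \<in> G"
  by (simp add: time_section_def)

lemma Gs_close:
  assumes "0 < s" "s < T" "0 < u" "u < T" "K * \<bar>s - u\<bar> < e"
  shows "Gs s \<subseteq> nbhd (Gs u) e" "- Gs s \<subseteq> nbhd (- Gs u) e"
proof -
  have R: "rho_H (Gs p) (Gs q) \<le> ereal (K * (q - p))" if "0 < p" "p < q" "q < T" for p q
    using G that by (simp add: class_G_params_def)
  have *: "Gs s \<subseteq> nbhd (Gs u) e \<and> - Gs s \<subseteq> nbhd (- Gs u) e"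
  proof (cases s u rule: linorder_cases)
    case less
    have "K * (u - s) < e" using less assms(5) by simp
    moreover have "rho_h (Gs s) (Gs u) \<le> ereal (K * (u - s))" "rho_h (- Gs s) (- Gs u) \<le> ereal (K * (u - s))"
      using R[OF assms(1) less assms(4)] by (simp_all add: rho_H_def)
    ultimately show ?thesis by (intro conjI rho_h_subset_nbhd(1))
  next
    case equal
    then have "x \<in> nbhd A e" if "x \<in> A" for x and A :: "(real ^ 'm) set"
      using assms(5) that by (auto simp: mem_nbhd_iff intro!: bexI[of _ x])
    then show ?thesis using equal by blast
  next
    case greater
    have "K * (s - u) < e" using greater assms(5) by simp
    moreover have "rho_h (Gs u) (Gs s) \<le> ereal (K * (s - u))" "rho_h (- Gs u) (- Gs s) \<le> ereal (K * (s - u))"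
      using R[OF assms(3) greater assms(2)] by (simp_all add: rho_H_def)
    ultimately show ?thesis by (intro conjI rho_h_subset_nbhd(2))
  qed
  then show "Gs s \<subseteq> nbhd (Gs u) e" "- Gs s \<subseteq> nbhd (- Gs u) e" by auto
qed

lemma exterior_ball:
  assumes "0 < t" "t < T" "g \<in> frontier (Gs t)"
  obtains y where "ball y \<beta> \<subseteq> - Gs t" "dist g y = \<beta>"
proof -
  obtain y where "ball y \<beta> \<subseteq> - Gs t" "g \<in> frontier (ball y \<beta>)"
    using G assms by (force simp: class_G_params_def)
  then show ?thesis using that \<beta> by (auto simp: dist_commute)
qed

text \<open>A point of the section at s is at most slightly more than K |s - u| away from the
  section at u, which keeps distance \<beta> from y. A static exterior ball thus becomes a shrinking
  obstacle for other times, in both time directions.\<close>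

lemma Gs_avoids_ball:
  assumes "0 < s" "s < T" "0 < u" "u < T" and y: "ball y \<beta> \<subseteq> - Gs u" and x: "x \<in> Gs s"
  shows "\<beta> - K * \<bar>s - u\<bar> \<le> dist x y"
proof (rule field_le_epsilon)
  fix e :: real assume "e > 0"
  then have "x \<in> nbhd (Gs u) (K * \<bar>s - u\<bar> + e)" using Gs_close(1)[of s u "K * \<bar>s - u\<bar> + e"] assms x by auto
  then obtain z where z: "z \<in> Gs u" "dist x z < K * \<bar>s - u\<bar> + e" by (auto simp: mem_nbhd_iff)
  have "\<beta> \<le> dist z y" using y z(1) by (auto simp: dist_commute subset_iff not_less[symmetric])
  then show "\<beta> - K * \<bar>s - u\<bar> \<le> dist x y + e"
    using dist_triangle[of z y x] z(2) by (simp add: dist_commute)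
qed

end

section \<open>Paths ending near the boundary\<close>

context tube begin

text \<open>The grid path is run backwards from W t. Its endpoint is within v of a frontier point,
  hence at height O(\<beta> v) above an exterior ball, and the reversed chain has to avoid this
  ball, shrinking with speed K, for a time h. Bounding the endpoint by \<open>R\<close> makes one
  grid fine enough for all endpoints; the estimate obtained is free of \<open>R\<close>. With t at
  least T/2 and h at most T/8 all grid times are at least T/4, so the contraction factors are at
  least 1 - 4 \<delta> / T.\<close>

lemma strip_bound_bounded:
  fixes h \<kappa> t v R :: real and A :: "'w set" and B :: "(real ^ 'm) set"
  defines "V \<equiv> \<beta>\<^sup>2 / (8 * (real CARD('m))\<^sup>2)"
  assumes h: "0 < h" "h \<le> T / 8" "K * h \<le> \<beta> / 2"
    and \<kappa>: "0 < \<kappa>" "\<kappa> \<le> \<beta>\<^sup>2" "8 * \<kappa>\<^sup>2 \<le> V * h"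
      "6 * ((4 * \<beta> + 1) * (4 / T) * (4 * \<beta> + 1) + 2 * \<beta> * K + gmom TYPE('m) 2) * \<kappa> \<le> V"
    and t: "T / 2 \<le> t" "t < T" and v: "0 < v" "v \<le> \<beta>" and B [measurable]: "B \<in> sets borel"
    and near: "\<And>x. x \<in> B \<Longrightarrow> x \<in> closure (Gs t) \<and> (\<exists>g\<in>frontier (Gs t). dist x g < v)"
    and A: "A \<subseteq> space M" "\<And>\<omega>. \<omega> \<in> A \<Longrightarrow> W t \<omega> \<in> B" "\<And>\<omega> s. \<omega> \<in> A \<Longrightarrow> 0 < s \<Longrightarrow> s < t \<Longrightarrow> W s \<omega> \<in> Gs s"
    and R: "0 \<le> R" "\<And>\<omega>. \<omega> \<in> A \<Longrightarrow> norm (W t \<omega>) \<le> R"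
  shows "emeasure M A \<le> ennreal (8 * \<beta> / \<kappa> * v) * (\<integral>\<^sup>+\<omega>. indicator B (W t \<omega>) * ennreal (1 + norm (W t \<omega>)) \<partial>M)"
proof -
  have "0 < \<beta> * v" "0 < \<kappa> / (1 + R)" "0 \<le> 4 / T * (R + 4 * \<beta>)" "0 \<le> 4 / T" "0 \<le> K"
    using \<beta> v \<kappa> R T K by auto
  from ex_exterior_ball_step[where 'm='m, OF \<beta> this(5) h(1) this(4) this(1) this(2) this(3)]
  obtain \<delta>0 where \<delta>0': "exterior_ball_step TYPE('m) K \<beta> h (4 / T) (4 / T * (R + 4 * \<beta>)) (\<kappa> / (1 + R)) (\<beta> * v) \<delta>0" ..
  then have \<delta>0: "0 < \<delta>0" by (simp add: exterior_ball_step_def)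
  \<comment> \<open>A step of at most T/8 makes every contraction factor at least 1/2, so that the
    noise variance is at least \<open>\<delta> / 2\<close>.\<close>
  define d where "d = min \<delta>0 (T / 8)"
  have d: "0 < d" using \<delta>0 T by (simp add: d_def)
  obtain n :: nat where n: "h / d < real n" using reals_Archimedean2 by blast
  have n0: "0 < n" using n h d by (metis divide_pos_pos less_trans of_nat_0_less_iff)
  define \<delta> where "\<delta> = h / real n"
  have \<delta>: "0 < \<delta>" "\<delta> \<le> d" "real n * \<delta> = h" "\<delta> \<le> T / 8" "\<delta> \<le> \<delta>0"
  proof -
    show "0 < \<delta>" "real n * \<delta> = h" using n0 h by (auto simp: \<delta>_def)
    show "\<delta> \<le> d" using n n0 d by (simp add: \<delta>_def field_simps)
    then show "\<delta> \<le> T / 8" "\<delta> \<le> \<delta>0" by (auto simp: d_def)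
  qed
  define b where "b = t - h"
  define s where "s i = b + real i * \<delta>" for i
  define a where "a j = s (n - Suc j) / s (n - j)" for j
  define \<sigma> where "\<sigma> j = sqrt (\<delta> * s (n - Suc j) / s (n - j))" for j
  define H where "H i = (if i < n then Gs (s i) else B \<inter> cball 0 R)" for i
  have b: "T / 4 \<le> b" "0 < b" using t h T by (auto simp: b_def)
  have sn: "s n = t" by (simp add: s_def b_def \<delta>)
  have s_ge: "b \<le> s i" for i using \<delta> by (simp add: s_def)
  have s_less: "s i < t" if "i < n" for i
    using mult_strict_right_mono[of "real i" "real n" \<delta>] that \<delta> by (simp add: s_def b_def)
  have s_diff: "t - s (n - j) = real j * \<delta>" if "j \<le> n" for j
    unfolding sn[symmetric] s_def using that by (simp add: of_nat_diff algebra_simps)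
  have Hm: "H i \<in> sets borel" for i
    using open_Gs by (auto simp: H_def)
  have a_eq: "a i = 1 - \<delta> / s (n - i)" if "i < n" for i
  proof -
    have "n - i = Suc (n - Suc i)" using that by simp
    then have "s (n - Suc i) = s (n - i) - \<delta>" by (simp add: s_def algebra_simps)
    then show ?thesis using s_ge[of "n - i"] b by (simp add: a_def field_simps)
  qed
  have as: "1 - 4 / T * \<delta> \<le> a i \<and> a i \<le> 1 \<and> 0 < \<sigma> i \<and> \<delta> / 2 \<le> (\<sigma> i)\<^sup>2 \<and> (\<sigma> i)\<^sup>2 \<le> \<delta>" if i: "i < n" for i
  proof -
    have s4: "T / 4 \<le> s (n - i)" "0 < s (n - i)" using s_ge[of "n - i"] b by auto
    have "\<delta> / s (n - i) \<le> \<delta> / (T / 4)" using s4 T \<delta> by (intro divide_left_mono mult_pos_pos) auto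
    then have a1: "1 - 4 / T * \<delta> \<le> a i" by (simp add: a_eq[OF i] mult.commute)
    have a2: "a i \<le> 1" using \<delta> s4 by (simp add: a_eq[OF i])
    have "4 / T * \<delta> \<le> 1 / 2" using \<delta>(4) T by (simp add: field_simps)
    then have a3: "1 / 2 \<le> a i" using a1 by linarith
    have \<sigma>2: "\<sigma> i = sqrt (\<delta> * a i)" by (simp add: \<sigma>_def a_def)
    have "0 < \<delta> * a i" using a3 \<delta> by auto
    moreover have "\<delta> / 2 \<le> \<delta> * a i" "\<delta> * a i \<le> \<delta>"
      using mult_left_mono[OF a3, of \<delta>] mult_left_mono[OF a2, of \<delta>] \<delta> by auto
    ultimately show ?thesis using a1 a2 by (simp add: \<sigma>2)
  qed
  have pt: "surv a \<sigma> (\<lambda>j. H (n - j)) n 0 x \<le> ennreal (8 * \<beta> / \<kappa> * v) * ennreal (1 + norm x)"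
    if x: "x \<in> B" "norm x \<le> R" for x
  proof -
    obtain g where g: "g \<in> frontier (Gs t)" "dist x g < v" using near x by blast
    obtain y where y: "ball y \<beta> \<subseteq> - Gs t" "dist g y = \<beta>"
      using exterior_ball[OF _ t(2) g(1)] t T by auto
    have cl: "\<beta> \<le> norm (z - y)" if "z \<in> closure (Gs t)" for z
    proof (rule ccontr)
      assume "\<not> \<beta> \<le> norm (z - y)"
      then have "z \<in> ball y \<beta>" by (simp add: dist_norm norm_minus_commute)
      moreover have "ball y \<beta> \<inter> closure (Gs t) = {}"
        using y(1) by (subst open_Int_closure_eq_empty) auto
      ultimately show False using that by blast
    qed
    have xy: "norm (x - y) \<le> \<beta> + v"
      using dist_triangle[of x y g] g y by (simp add: dist_norm)
    have ny: "norm y \<le> norm x + 2 * \<beta>"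
      using norm_triangle_ineq2[of y x] xy v by (simp add: norm_minus_commute)
    \<comment> \<open>The pull of the bridge, and with it the drift constant that \<open>r\<close>
      must compensate, grows linearly in the endpoint. Division by \<open>1 + norm x\<close>
      balances this and produces the weight in the conclusion.\<close>
    define r where "r = \<kappa> / (1 + norm x)"
    have n1: "1 \<le> 1 + norm x" by simp
    have r\<kappa>: "r \<le> \<kappa>" "0 < r" using \<kappa> divide_left_mono[OF n1, of \<kappa>] by (auto simp: r_def add_pos_nonneg)
    have "surv a \<sigma> (\<lambda>j. H (n - j)) n 0 x \<le> ennreal (2 * ((norm (x - y))\<^sup>2 - \<beta>\<^sup>2 + 2 * \<beta> * 0 + \<beta> * v) / r)"
    proof (rule surv_exterior_ball[OF \<delta>0'])
      show "4 / T * (norm y + 2 * \<beta>) \<le> 4 / T * (R + 4 * \<beta>)" using ny x T by (intro mult_left_mono) auto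
      show "H (n - i) \<subseteq> {x. \<beta> - 0 - K * (real i * \<delta>) \<le> norm (x - y)}" if i: "i \<le> n" for i
      proof (cases "i = 0")
        case True
        then show ?thesis using cl near by (auto simp: H_def)
      next
        case False
        then have ni: "n - i < n" using i by simp
        have "\<beta> - K * \<bar>s (n - i) - t\<bar> \<le> dist z y" if "z \<in> Gs (s (n - i))" for z
          using s_ge[of "n - i"] b s_less[OF ni] t T that by (intro Gs_avoids_ball y) auto
        moreover have "\<bar>s (n - i) - t\<bar> = real i * \<delta>" using s_diff[OF i] s_less[OF ni] by simp
        ultimately show ?thesis using ni by (auto simp: H_def dist_norm)
      qed
      show "\<kappa> / (1 + R) \<le> r" unfolding r_def using x R \<kappa> by (intro divide_left_mono mult_pos_pos add_pos_nonneg) auto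
      show "r \<le> \<beta>\<^sup>2" using r\<kappa> \<kappa> by simp
      have "r\<^sup>2 \<le> \<kappa>\<^sup>2" using r\<kappa> by (intro power_mono) auto
      then have "8 * r\<^sup>2 \<le> 8 * \<kappa>\<^sup>2" by simp
      then show "8 * r\<^sup>2 \<le> \<beta>\<^sup>2 / (8 * (real CARD('m))\<^sup>2) * h" using \<kappa>(3) unfolding V_def by (rule order_trans)
      show "6 * ((4 * \<beta> + 1) * (4 / T) * (norm y + 2 * \<beta>) + 2 * \<beta> * K + gmom TYPE('m) 2) * r \<le> \<beta>\<^sup>2 / (8 * (real CARD('m))\<^sup>2)"
      proof -
        have "0 \<le> 4 * (\<beta> * norm x)" using \<beta> by simp
        moreover have "(4 * \<beta> + 1) * (1 + norm x) = 4 * \<beta> + 1 + norm x + 4 * (\<beta> * norm x)" by (simp add: algebra_simps)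
        ultimately have "norm y + 2 * \<beta> \<le> (4 * \<beta> + 1) * (1 + norm x)" using ny by linarith
        then have "(4 * \<beta> + 1) * (4 / T) * (norm y + 2 * \<beta>) \<le> (4 * \<beta> + 1) * (4 / T) * ((4 * \<beta> + 1) * (1 + norm x))"
          using \<beta> T by (intro mult_left_mono) auto
        moreover have "2 * \<beta> * K + gmom TYPE('m) 2 \<le> (2 * \<beta> * K + gmom TYPE('m) 2) * (1 + norm x)"
          using \<beta> K gmom_nonneg[where 'm='m] mult_left_mono[OF n1, of "2 * \<beta> * K + gmom TYPE('m) 2"] by auto
        moreover have distr: "(a * p + b + c) * q = a * (p * q) + (b + c) * q" for a p b c q :: real
          by (simp add: algebra_simps)
        ultimately have "(4 * \<beta> + 1) * (4 / T) * (norm y + 2 * \<beta>) + 2 * \<beta> * K + gmom TYPE('m) 2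
          \<le> ((4 * \<beta> + 1) * (4 / T) * (4 * \<beta> + 1) + 2 * \<beta> * K + gmom TYPE('m) 2) * (1 + norm x)"
          unfolding distr by linarith
        then have "6 * ((4 * \<beta> + 1) * (4 / T) * (norm y + 2 * \<beta>) + 2 * \<beta> * K + gmom TYPE('m) 2) * r
          \<le> 6 * (((4 * \<beta> + 1) * (4 / T) * (4 * \<beta> + 1) + 2 * \<beta> * K + gmom TYPE('m) 2) * (1 + norm x)) * r"
          using r\<kappa> by (intro mult_right_mono mult_left_mono) auto
        also have "\<dots> = 6 * ((4 * \<beta> + 1) * (4 / T) * (4 * \<beta> + 1) + 2 * \<beta> * K + gmom TYPE('m) 2) * \<kappa>"
        proof -
          have "(1 + norm x) * r = \<kappa>" unfolding r_def by (simp add: add_pos_nonneg less_imp_neq[symmetric])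
          then show ?thesis by (simp only: mult.assoc)
        qed
        finally show ?thesis using \<kappa>(4) unfolding V_def by (rule order_trans)
      qed
      show "\<beta> - 0 \<le> norm (x - y)" using cl near[OF x(1)] by simp
      show "1 - 4 / T * \<delta> \<le> a i \<and> a i \<le> 1 \<and> 0 < \<sigma> i \<and> \<delta> / 2 \<le> (\<sigma> i)\<^sup>2 \<and> (\<sigma> i)\<^sup>2 \<le> \<delta>" if "i < n" for i
        by (rule as[OF that])
    qed (use \<delta> h in auto)
    also have "\<dots> \<le> ennreal (8 * \<beta> / \<kappa> * v * (1 + norm x))"
    proof (rule ennreal_leI)
      have "(norm (x - y))\<^sup>2 \<le> (\<beta> + v)\<^sup>2" using xy by (intro power_mono) auto
      also have "\<dots> \<le> \<beta>\<^sup>2 + 3 * \<beta> * v"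
        using mult_right_mono[OF v(2), of v] v by (simp add: power2_eq_square algebra_simps)
      finally have "2 * ((norm (x - y))\<^sup>2 - \<beta>\<^sup>2 + 2 * \<beta> * 0 + \<beta> * v) \<le> 8 * \<beta> * v" by simp
      then have "2 * ((norm (x - y))\<^sup>2 - \<beta>\<^sup>2 + 2 * \<beta> * 0 + \<beta> * v) / r \<le> 8 * \<beta> * v / r"
        using r\<kappa> by (intro divide_right_mono) auto
      also have "\<dots> = 8 * \<beta> / \<kappa> * v * (1 + norm x)" by (simp add: r_def)
      finally show "2 * ((norm (x - y))\<^sup>2 - \<beta>\<^sup>2 + 2 * \<beta> * 0 + \<beta> * v) / r \<le> 8 * \<beta> / \<kappa> * v * (1 + norm x)" .
    qed
    also have "\<dots> = ennreal (8 * \<beta> / \<kappa> * v) * ennreal (1 + norm x)"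
      using \<beta> \<kappa> v by (intro ennreal_mult) auto
    finally show ?thesis .
  qed
  have tm [measurable]: "W t \<in> borel_measurable M" using t T by (intro measurable_W) auto
  define E where "E = {\<omega> \<in> space M. \<forall>i\<le>n. W (s i) \<omega> \<in> H i}"
  have E: "E \<in> sets M"
    unfolding E_def
  proof (intro sets.sets_Collect_countable_All sets.sets_Collect_imp sets.sets_Collect_const)
    fix i
    have "0 \<le> s i" using s_ge[of i] b by simp
    from measurable_sets[OF measurable_W[OF this] Hm[of i]]
    show "{\<omega> \<in> space M. W (s i) \<omega> \<in> H i} \<in> sets M" by (simp add: vimage_def Int_def conj_commute)
  qed
  have "A \<subseteq> E"
  proof
    fix \<omega> assume \<omega>: "\<omega> \<in> A"
    have "W (s i) \<omega> \<in> H i" if "i \<le> n" for i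
    proof (cases "i < n")
      case True
      then show ?thesis using A(3)[OF \<omega>, of "s i"] s_less s_ge[of i] b by (simp add: H_def)
    next
      case False
      then have "i = n" using that by simp
      then show ?thesis using A(2) R(2) \<omega> by (simp add: H_def sn)
    qed
    then show "\<omega> \<in> E" using A(1) \<omega> by (auto simp: E_def)
  qed
  then have "emeasure M A \<le> emeasure M E" using E by (rule emeasure_mono)
  also have "\<dots> = (\<integral>\<^sup>+\<omega>. indicator (H n) (W t \<omega>) * surv a \<sigma> (\<lambda>j. H (n - j)) n 0 (W t \<omega>) \<partial>M)"
    using emeasure_backward[OF b(2) \<delta>(1) Hm, of n, folded s_def, folded a_def \<sigma>_def]
    by (simp add: E_def sn)
  also have "\<dots> \<le> (\<integral>\<^sup>+\<omega>. ennreal (8 * \<beta> / \<kappa> * v) * (indicator B (W t \<omega>) * ennreal (1 + norm (W t \<omega>))) \<partial>M)"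
    using pt by (intro nn_integral_mono) (auto simp: H_def indicator_def)
  also have "\<dots> = ennreal (8 * \<beta> / \<kappa> * v) * (\<integral>\<^sup>+\<omega>. indicator B (W t \<omega>) * ennreal (1 + norm (W t \<omega>)) \<partial>M)"
    by (rule nn_integral_cmult) measurable
  finally show ?thesis .
qed

text \<open>Time 0 is excluded since G lies over the open time interval. \<open>stay\<close> and
  \<open>stay_before\<close> differ by the paths that first leave exactly at time t.\<close>

definition stay :: "real \<Rightarrow> 'w set" where
  "stay t = {\<omega> \<in> space M. \<forall>s. 0 < s \<and> s \<le> t \<longrightarrow> W s \<omega> \<in> Gs s}"

definition stay_before :: "real \<Rightarrow> 'w set" where
  "stay_before t = {\<omega> \<in> space M. \<forall>s. 0 < s \<and> s < t \<longrightarrow> W s \<omega> \<in> Gs s}"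

lemma stay_past: "stay t \<in> sets (past t)"
  unfolding stay_def mem_Gs by (rule sets_stay_half_open[OF open_G])

lemma sets_stay [measurable]: "stay t \<in> sets M"
  using stay_past past_le by blast

lemma stay_before_eq: "stay_before t = (\<Inter>n. stay (t - 1 / real (Suc n)))"
proof (intro set_eqI iffI)
  fix \<omega> assume \<omega>: "\<omega> \<in> stay_before t"
  have *: "s < t" if "s \<le> t - 1 / real (Suc n)" for s n
  proof -
    have "0 < 1 / real (Suc n)" by simp
    then show ?thesis using that by linarith
  qed
  show "\<omega> \<in> (\<Inter>n. stay (t - 1 / real (Suc n)))"
    using \<omega> * unfolding stay_def stay_before_def by blast
next
  fix \<omega> assume \<omega>: "\<omega> \<in> (\<Inter>n. stay (t - 1 / real (Suc n)))"
  have "W s \<omega> \<in> Gs s" if "0 < s" "s < t" for s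
  proof -
    obtain n where "1 / real (Suc n) < t - s" using nat_approx_posE[of "t - s"] \<open>s < t\<close> by auto
    then have "s \<le> t - 1 / real (Suc n)" by simp
    then show ?thesis using \<omega> that by (simp add: stay_def)
  qed
  moreover have "\<omega> \<in> space M" using \<omega> by (simp add: stay_def)
  ultimately show "\<omega> \<in> stay_before t" by (simp add: stay_before_def)
qed

lemma sets_stay_before [measurable]: "stay_before t \<in> sets M"
  unfolding stay_before_eq by (rule sets.countable_INT) (auto intro: sets_stay)

text \<open>Monotone limit over the bound on the endpoint. Letting \<open>B\<close> lie in the
  closure of the section makes the estimate applicable to the frontier itself in
  \<open>stay_boundary_null\<close>.\<close>

lemma strip_bound:
  fixes h \<kappa> t v :: real and A :: "'w set" and B :: "(real ^ 'm) set"
  defines "V \<equiv> \<beta>\<^sup>2 / (8 * (real CARD('m))\<^sup>2)"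
  assumes h: "0 < h" "h \<le> T / 8" "K * h \<le> \<beta> / 2"
    and \<kappa>: "0 < \<kappa>" "\<kappa> \<le> \<beta>\<^sup>2" "8 * \<kappa>\<^sup>2 \<le> V * h"
      "6 * ((4 * \<beta> + 1) * (4 / T) * (4 * \<beta> + 1) + 2 * \<beta> * K + gmom TYPE('m) 2) * \<kappa> \<le> V"
    and t: "T / 2 \<le> t" "t < T" and v: "0 < v" "v \<le> \<beta>" and B [measurable]: "B \<in> sets borel"
    and near: "\<And>x. x \<in> B \<Longrightarrow> x \<in> closure (Gs t) \<and> (\<exists>g\<in>frontier (Gs t). dist x g < v)"
    and A: "A \<in> sets M" "A \<subseteq> stay_before t" "\<And>\<omega>. \<omega> \<in> A \<Longrightarrow> W t \<omega> \<in> B"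
  shows "emeasure M A \<le> ennreal (8 * \<beta> / \<kappa> * v) * (\<integral>\<^sup>+\<omega>. indicator B (W t \<omega>) * ennreal (1 + norm (W t \<omega>)) \<partial>M)"
proof -
  have [measurable]: "W t \<in> borel_measurable M" using t T by (intro measurable_W) auto
  define AR where "AR n = A \<inter> {\<omega> \<in> space M. norm (W t \<omega>) \<le> real n}" for n :: nat
  have AR: "AR n \<in> sets M" for n unfolding AR_def using A(1) by measurable
  have inc: "incseq AR"
    unfolding AR_def by (intro monoI) auto
  have A_sub: "A \<subseteq> space M" using A(1) sets.sets_into_space by blast
  have "(\<Union>n. AR n) = A"
    using A_sub real_arch_simple unfolding AR_def by blast
  then have "emeasure M A = (SUP n. emeasure M (AR n))"
    using SUP_emeasure_incseq[of AR M, OF image_subsetI inc] AR by simp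
  also have "\<dots> \<le> ennreal (8 * \<beta> / \<kappa> * v) * (\<integral>\<^sup>+\<omega>. indicator B (W t \<omega>) * ennreal (1 + norm (W t \<omega>)) \<partial>M)"
  proof (rule SUP_least)
    fix n
    show "emeasure M (AR n) \<le> ennreal (8 * \<beta> / \<kappa> * v) * (\<integral>\<^sup>+\<omega>. indicator B (W t \<omega>) * ennreal (1 + norm (W t \<omega>)) \<partial>M)"
    proof (rule strip_bound_bounded[where R="real n", OF h \<kappa>[unfolded V_def] t v B near])
      show "AR n \<subseteq> space M" by (auto simp: AR_def)
    qed (use A in \<open>auto simp: AR_def stay_before_def\<close>)
  qed
  finally show ?thesis .
qed

end

text \<open>The threshold \<open>\<eta>\<close> may depend on t, so no uniform partition is
  available. Instead, the supremum of the points up to which the linear bound holds is shown to be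
  \<open>b\<close>: \<open>left\<close> carries the bound to the supremum and \<open>right\<close>
  moves beyond it.\<close>

lemma dini_bound:
  fixes f :: "real \<Rightarrow> real"
  assumes ab: "a \<le> b" and D: "0 \<le> D"
    and right: "\<And>t. a \<le> t \<Longrightarrow> t < b \<Longrightarrow> \<exists>\<eta>>0. \<forall>h. 0 < h \<and> h < \<eta> \<longrightarrow> f t - f (t + h) \<le> D * h"
    and left: "\<And>t e. a < t \<Longrightarrow> t \<le> b \<Longrightarrow> 0 < e \<Longrightarrow> \<exists>\<delta>>0. \<forall>s. t - \<delta> < s \<and> s < t \<longrightarrow> f s - f t \<le> e"
  shows "f a - f b \<le> D * (b - a)"
proof -
  define S where "S = {t \<in> {a..b}. f a - f t \<le> D * (t - a)}"
  have aS: "a \<in> S" using ab by (simp add: S_def)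
  have bdd: "bdd_above S" by (rule bdd_aboveI[of _ b]) (simp add: S_def)
  define u where "u = Sup S"
  have u: "a \<le> u" "u \<le> b"
  proof -
    show "a \<le> u" unfolding u_def by (rule cSup_upper[OF aS bdd])
    have "S \<noteq> {}" using aS by blast
    then show "u \<le> b" unfolding u_def by (rule cSup_least) (simp add: S_def)
  qed
  have uS: "u \<in> S"
  proof (cases "u = a")
    case True
    then show ?thesis using aS by simp
  next
    case False
    have "f a - f u \<le> D * (u - a)"
    proof (rule field_le_epsilon)
      fix e :: real assume e: "e > 0"
      obtain \<delta> where \<delta>: "\<delta> > 0" "\<forall>s. u - \<delta> < s \<and> s < u \<longrightarrow> f s - f u \<le> e"
        using left[of u e] u False e by auto
      obtain s where s: "s \<in> S" "u - \<delta> < s"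
        using less_cSupE[of "u - \<delta>" S] aS \<delta>(1) unfolding u_def by (metis diff_less_eq empty_iff less_add_same_cancel1)
      have su: "s \<le> u" using cSup_upper[OF s(1) bdd] by (simp add: u_def)
      have fs: "f a - f s \<le> D * (s - a)" using s by (simp add: S_def)
      have "f s - f u \<le> e" using \<delta>(2) s(2) su e by (cases "s = u") auto
      moreover have "D * (s - a) \<le> D * (u - a)" using su D by (intro mult_left_mono) auto
      ultimately show "f a - f u \<le> D * (u - a) + e" using fs by linarith
    qed
    then show ?thesis using u by (simp add: S_def)
  qed
  have "u = b"
  proof (rule ccontr)
    assume "u \<noteq> b"
    then have ub: "u < b" using u by simp
    obtain \<eta> where \<eta>: "\<eta> > 0" "\<forall>h. 0 < h \<and> h < \<eta> \<longrightarrow> f u - f (u + h) \<le> D * h"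
      using right[OF u(1) ub] by blast
    define h where "h = min (\<eta> / 2) (b - u)"
    have h: "0 < h" "h < \<eta>" "u + h \<le> b" using \<eta> ub by (auto simp: h_def min_def)
    have "f a - f (u + h) \<le> D * (u - a) + D * h" using \<eta>(2) h uS by (force simp: S_def)
    then have "u + h \<in> S" using h u by (simp add: S_def algebra_simps)
    then show False using cSup_upper[OF _ bdd] h by (force simp: u_def)
  qed
  then show ?thesis using uS by (simp add: S_def)
qed

text \<open>Continuity of measure for a lower limit of sets. \<open>A\<close> may fail to be
  measurable; it is covered by the increasing union of the intersections \<open>B n\<close>.\<close>

lemma (in finite_measure) measure_le_of_eventually:
  assumes F: "\<And>N. F N \<in> sets M" and A: "\<And>\<omega>. \<omega> \<in> A \<Longrightarrow> eventually (\<lambda>N :: nat. \<omega> \<in> F N) sequentially"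
    and le: "eventually (\<lambda>N. measure M (F N) \<le> c) sequentially"
  shows "measure M A \<le> c"
proof -
  obtain N0 where N0: "\<And>N. N \<ge> N0 \<Longrightarrow> measure M (F N) \<le> c"
    using le unfolding eventually_sequentially by blast
  define B where "B n = (\<Inter>N\<in>{n..}. F N)" for n
  have B: "B n \<in> sets M" for n unfolding B_def by (rule sets.countable_INT') (auto intro: F)
  have inc: "incseq B" by (rule incseq_SucI) (auto simp: B_def)
  have sub: "A \<subseteq> (\<Union>n. B n)"
  proof
    fix \<omega> assume "\<omega> \<in> A"
    from A[OF this] show "\<omega> \<in> (\<Union>n. B n)" unfolding eventually_sequentially B_def by auto
  qed
  have "measure M (B n) \<le> c" for n
  proof -
    have "measure M (B n) \<le> measure M (F (max n N0))"
      by (rule finite_measure_mono) (auto simp: B_def F)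
    then show ?thesis using N0[of "max n N0"] by simp
  qed
  moreover have "(\<lambda>n. measure M (B n)) \<longlonglongrightarrow> measure M (\<Union>n. B n)"
    using B inc by (intro finite_Lim_measure_incseq) auto
  ultimately have "measure M (\<Union>n. B n) \<le> c" by (intro LIMSEQ_le_const2[of _ _ c]) auto
  moreover have "measure M A \<le> measure M (\<Union>n. B n)"
    by (rule finite_measure_mono[OF sub]) (use B in auto)
  ultimately show ?thesis by simp
qed

text \<open>Chebyshev's inequality. In \<open>exit_rate\<close> it makes the rest of a path after a
  near exit small with probability at least one half.\<close>

lemma gauss_chebyshev:
  assumes "0 < \<sigma>" "0 < a" "2 * \<sigma>\<^sup>2 * gmom TYPE('m::finite) 2 \<le> a\<^sup>2"
  shows "1 / 2 \<le> measure (gauss \<sigma>) {x :: real ^ 'm. norm x \<le> a}"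
proof -
  interpret prob_space "gauss \<sigma> :: (real ^ 'm) measure" by (rule prob_space_gauss) fact
  have m: "{x :: real ^ 'm. norm x \<le> a} \<in> sets (gauss \<sigma>)" by simp
  have "measure (gauss \<sigma>) {x :: real ^ 'm. \<not> norm x \<le> a} = (\<integral>x. indicator {x :: real ^ 'm. \<not> norm x \<le> a} x \<partial>gauss \<sigma>)"
    by simp
  also have "\<dots> \<le> (\<integral>x. norm (x :: real ^ 'm) ^ 2 / a\<^sup>2 \<partial>gauss \<sigma>)"
  proof (rule integral_mono)
    show "integrable (gauss \<sigma>) (\<lambda>x :: real ^ 'm. norm x ^ 2 / a\<^sup>2)"
      using integrable_gauss_norm_power[OF assms(1)] by (rule integrable_divide)
    show "indicator {x :: real ^ 'm. \<not> norm x \<le> a} x \<le> norm x ^ 2 / a\<^sup>2" for x :: "real ^ 'm"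
      using assms(2) power_mono[of a "norm x" 2] by (auto simp: indicator_def)
  qed (auto simp: less_top[symmetric])
  also have "\<dots> = \<sigma>\<^sup>2 * gmom TYPE('m) 2 / a\<^sup>2"
    using integral_gauss_norm_power[where 'm='m, OF assms(1), of 2] by simp
  also have "\<dots> \<le> 1 / 2" using assms by (simp add: field_simps)
  finally have "measure (gauss \<sigma>) {x :: real ^ 'm. \<not> norm x \<le> a} \<le> 1 / 2" .
  moreover have "measure (gauss \<sigma>) {x :: real ^ 'm. \<not> norm x \<le> a} = 1 - measure (gauss \<sigma>) {x :: real ^ 'm. norm x \<le> a}"
    using prob_neg[of "\<lambda>x. norm x \<le> a"] m by simp
  ultimately show ?thesis by simp
qed

text \<open>Describes the factor in \<open>strip_bound\<close> by m, T, K and \<beta> alone, so that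
  it can be fixed before the process and the set.\<close>

definition strip_const :: "'m::finite itself \<Rightarrow> real \<Rightarrow> real \<Rightarrow> real \<Rightarrow> real \<Rightarrow> bool" where
  "strip_const _ T K \<beta> C \<longleftrightarrow> (\<exists>h \<kappa>. 0 < h \<and> h \<le> T / 8 \<and> K * h \<le> \<beta> / 2 \<and> 0 < \<kappa> \<and> \<kappa> \<le> \<beta>\<^sup>2 \<and>
     8 * \<kappa>\<^sup>2 \<le> \<beta>\<^sup>2 / (8 * (real CARD('m))\<^sup>2) * h \<and>
     6 * ((4 * \<beta> + 1) * (4 / T) * (4 * \<beta> + 1) + 2 * \<beta> * K + gmom TYPE('m) 2) * \<kappa> \<le> \<beta>\<^sup>2 / (8 * (real CARD('m))\<^sup>2) \<and>
     C = 8 * \<beta> / \<kappa>)"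

lemma ex_strip_const:
  assumes "0 < T" "0 < K" "0 < \<beta>"
  shows "\<exists>C>0. strip_const TYPE('m::finite) T K \<beta> C"
proof -
  define V where "V = \<beta>\<^sup>2 / (8 * (real CARD('m))\<^sup>2)"
  define h where "h = min (T / 8) (\<beta> / (2 * K))"
  define Q where "Q = (4 * \<beta> + 1) * (4 / T) * (4 * \<beta> + 1) + 2 * \<beta> * K + gmom TYPE('m) 2"
  \<comment> \<open>Each entry of the minimum enforces one of the three upper bounds on
    \<open>\<kappa>\<close>.\<close>
  define \<kappa> where "\<kappa> = min (\<beta>\<^sup>2) (min (sqrt (V * h / 8)) (V / (6 * Q)))"
  have V: "0 < V" using assms by (simp add: V_def)
  have h: "0 < h" "h \<le> T / 8" "h \<le> \<beta> / (2 * K)" using assms by (auto simp: h_def)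
  have Q: "0 < Q" unfolding Q_def using assms gmom_nonneg[where 'm='m, of 2]
    by (intro add_pos_nonneg mult_pos_pos) auto
  have \<kappa>: "0 < \<kappa>" "\<kappa> \<le> \<beta>\<^sup>2" "\<kappa> \<le> sqrt (V * h / 8)" "\<kappa> \<le> V / (6 * Q)"
    using assms V h Q by (auto simp: \<kappa>_def)
  have 1: "8 * \<kappa>\<^sup>2 \<le> V * h"
  proof -
    have "\<kappa>\<^sup>2 \<le> (sqrt (V * h / 8))\<^sup>2" using \<kappa> by (intro power_mono) auto
    also have "\<dots> = V * h / 8" using V h by simp
    finally show ?thesis by simp
  qed
  have 2: "6 * Q * \<kappa> \<le> V" using \<kappa>(4) Q by (simp add: pos_le_divide_eq mult.commute)
  have 3: "K * h \<le> \<beta> / 2" using h(3) assms by (simp add: pos_le_divide_eq mult.commute field_simps)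
  have "strip_const TYPE('m) T K \<beta> (8 * \<beta> / \<kappa>)"
    unfolding strip_const_def using h \<kappa> 1[unfolded V_def] 2[unfolded V_def Q_def] 3 by blast
  moreover have "0 < 8 * \<beta> / \<kappa>" using \<kappa> assms by simp
  ultimately show ?thesis by blast
qed

context brownian_motion begin

lemma integrable_norm_W:
  assumes "0 < t"
  shows "integrable M (\<lambda>\<omega>. norm (W t \<omega>))"
proof -
  have [measurable]: "W t \<in> borel_measurable M" using assms by (intro measurable_W) auto
  have "integrable (distr M borel (W t)) (\<lambda>x. norm x)"
    using integrable_gauss_norm_power[where 'm='m, of "sqrt t" 1] assms by (simp add: distr_W)
  then show ?thesis by (subst (asm) integrable_distr_eq) auto
qed

lemma prob_increment:
  assumes "0 \<le> s" "s < u" and [measurable]: "B \<in> sets borel"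
  shows "prob ((\<lambda>\<omega>. W u \<omega> - W s \<omega>) -` B \<inter> space M) = measure (gauss (sqrt (u - s))) B"
proof -
  have [measurable]: "(\<lambda>\<omega>. W u \<omega> - W s \<omega>) \<in> borel_measurable M"
    using assms by (intro borel_measurable_diff measurable_W) auto
  show ?thesis unfolding distr_increment[OF assms(1,2), symmetric] by (simp add: measure_distr)
qed

end

context tube begin

lemma strip_bound_const:
  assumes sc: "strip_const TYPE('m) T K \<beta> C"
    and t: "T / 2 \<le> t" "t < T" and v: "0 < v" "v \<le> \<beta>" and B: "B \<in> sets borel"
    and near: "\<And>x. x \<in> B \<Longrightarrow> x \<in> closure (Gs t) \<and> (\<exists>g\<in>frontier (Gs t). dist x g < v)"
    and A: "A \<in> sets M" "A \<subseteq> stay_before t" "\<And>\<omega>. \<omega> \<in> A \<Longrightarrow> W t \<omega> \<in> B"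
  shows "emeasure M A \<le> ennreal (C * v) * (\<integral>\<^sup>+\<omega>. indicator B (W t \<omega>) * ennreal (1 + norm (W t \<omega>)) \<partial>M)"
proof -
  obtain h \<kappa> where c: "0 < h" "h \<le> T / 8" "K * h \<le> \<beta> / 2" "0 < \<kappa>" "\<kappa> \<le> \<beta>\<^sup>2"
     "8 * \<kappa>\<^sup>2 \<le> \<beta>\<^sup>2 / (8 * (real CARD('m))\<^sup>2) * h"
     "6 * ((4 * \<beta> + 1) * (4 / T) * (4 * \<beta> + 1) + 2 * \<beta> * K + gmom TYPE('m) 2) * \<kappa> \<le> \<beta>\<^sup>2 / (8 * (real CARD('m))\<^sup>2)"
     and C: "C = 8 * \<beta> / \<kappa>"
    using sc unfolding strip_const_def by blast
  show ?thesis unfolding C by (rule strip_bound[OF c t v B near A])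
qed

lemma stay_mono: "s \<le> t \<Longrightarrow> stay t \<subseteq> stay s"
  by (auto simp: stay_def)

lemma stay_le_before: "stay t \<subseteq> stay_before t"
  by (auto simp: stay_def stay_before_def)

text \<open>One factor v is the backward survival probability, the other is the weighted mass of the
  strip. The threshold \<open>v1\<close> inherits the dependence of \<open>v\<^sub>0\<close> on
  t.\<close>

lemma stay_strip:
  assumes sc: "strip_const TYPE('m) T K \<beta> C" and C: "0 < C" and t: "T / 2 \<le> t" "t < T"
  shows "\<exists>v1>0. \<forall>v. 0 < v \<and> v < v1 \<longrightarrow>
    prob (stay t \<inter> {\<omega> \<in> space M. W t \<omega> \<in> nbhd (- Gs t) v}) \<le> C * \<gamma> * v\<^sup>2"
proof -
  have t0: "0 < t" using t T by simp
  have [measurable]: "W t \<in> borel_measurable M" using t0 by (intro measurable_W) auto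
  have "\<forall>t\<in>{0<..<T}. \<exists>v\<^sub>0>0. \<forall>v. 0 < v \<and> v < v\<^sub>0 \<longrightarrow>
      (LINT \<omega>:{\<omega> \<in> space M. 0 < rho (W t \<omega>) (- Gs t) \<and> rho (W t \<omega>) (- Gs t) < ereal v}|M. 1 + norm (W t \<omega>)) < \<gamma> * v"
    using G unfolding class_G_params_def by (elim CollectE conjE) assumption
  from bspec[OF this, of t] t0 t obtain v0 where v0: "0 < v0" "\<forall>v. 0 < v \<and> v < v0 \<longrightarrow>
      (LINT \<omega>:{\<omega> \<in> space M. 0 < rho (W t \<omega>) (- Gs t) \<and> rho (W t \<omega>) (- Gs t) < ereal v}|M. 1 + norm (W t \<omega>)) < \<gamma> * v"
    unfolding greaterThanLessThan_iff by blast
  have "prob (stay t \<inter> {\<omega> \<in> space M. W t \<omega> \<in> nbhd (- Gs t) v}) \<le> C * \<gamma> * v\<^sup>2"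
    if v: "0 < v" "v < min v0 \<beta>" for v
  proof -
    define B where "B = Gs t \<inter> nbhd (- Gs t) v"
    have B [measurable]: "B \<in> sets borel" unfolding B_def by (intro borel_open open_Int open_Gs open_nbhd)
    define S where "S = {\<omega> \<in> space M. 0 < rho (W t \<omega>) (- Gs t) \<and> rho (W t \<omega>) (- Gs t) < ereal v}"
    have S_iff: "\<omega> \<in> S \<longleftrightarrow> \<omega> \<in> space M \<and> W t \<omega> \<in> B" for \<omega>
      unfolding S_def B_def using rho_pos_iff_open[OF open_Gs] by (auto simp: nbhd_def)
    have S [measurable]: "S \<in> sets M"
    proof -
      have "S = W t -` B \<inter> space M" using S_iff by auto
      then show ?thesis by simp
    qed
    have int: "integrable M (\<lambda>\<omega>. indicator S \<omega> *\<^sub>R (1 + norm (W t \<omega>)))"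
      using integrable_norm_W[OF t0] by (intro integrable_mult_indicator S) auto
    have "(\<integral>\<^sup>+\<omega>. indicator B (W t \<omega>) * ennreal (1 + norm (W t \<omega>)) \<partial>M)
       = (\<integral>\<^sup>+\<omega>. ennreal (indicator S \<omega> *\<^sub>R (1 + norm (W t \<omega>))) \<partial>M)"
      by (intro nn_integral_cong) (simp add: S_iff indicator_def)
    also have "\<dots> = ennreal (\<integral>\<omega>. indicator S \<omega> *\<^sub>R (1 + norm (W t \<omega>)) \<partial>M)"
      by (rule nn_integral_eq_integral[OF int]) auto
    also have "\<dots> \<le> ennreal (\<gamma> * v)"
      using v0(2)[rule_format, of v] v unfolding S_def[symmetric] set_lebesgue_integral_def by (intro ennreal_leI) auto
    finally have I: "(\<integral>\<^sup>+\<omega>. indicator B (W t \<omega>) * ennreal (1 + norm (W t \<omega>)) \<partial>M) \<le> ennreal (\<gamma> * v)" .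
    define A where "A = stay t \<inter> {\<omega> \<in> space M. W t \<omega> \<in> nbhd (- Gs t) v}"
    have A: "A \<in> sets M"
    proof -
      have "{\<omega> \<in> space M. W t \<omega> \<in> nbhd (- Gs t) v} = W t -` nbhd (- Gs t) v \<inter> space M" by auto
      then show ?thesis unfolding A_def using open_nbhd[of "- Gs t" v] by auto
    qed
    have "emeasure M A \<le> ennreal (C * v) * (\<integral>\<^sup>+\<omega>. indicator B (W t \<omega>) * ennreal (1 + norm (W t \<omega>)) \<partial>M)"
    proof (rule strip_bound_const[OF sc t])
      show "x \<in> closure (Gs t) \<and> (\<exists>g\<in>frontier (Gs t). dist x g < v)" if xB: "x \<in> B" for x
      proof -
        obtain y where "y \<notin> Gs t" "dist x y < v" using xB by (auto simp: B_def mem_nbhd_iff)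
        moreover have "x \<in> Gs t" using that by (simp add: B_def)
        ultimately show ?thesis using near_frontier[of x "Gs t" y v] closure_subset by blast
      qed
      show "A \<subseteq> stay_before t" using stay_le_before by (auto simp: A_def)
      show "W t \<omega> \<in> B" if "\<omega> \<in> A" for \<omega>
        using that t0 by (simp add: A_def B_def stay_def)
    qed (use v A B in auto)
    also have "\<dots> \<le> ennreal (C * v) * ennreal (\<gamma> * v)" using I by (rule mult_left_mono) simp
    also have "\<dots> = ennreal (C * \<gamma> * v\<^sup>2)"
      using C \<gamma> v by (simp add: ennreal_mult[symmetric] power2_eq_square mult_ac)
    finally show ?thesis
      using C \<gamma> unfolding A_def[symmetric] by (simp add: emeasure_eq_measure)
  qed
  then show ?thesis using v0(1) \<beta> by (intro exI[of _ "min v0 \<beta>"]) auto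
qed

text \<open>A path leaving exactly at time t sits on the frontier of the section, and there v in
  \<open>strip_bound_const\<close> may be taken arbitrarily small.\<close>

lemma stay_boundary_null:
  assumes sc: "strip_const TYPE('m) T K \<beta> C" and C: "0 < C" and t: "T / 2 \<le> t" "t < T"
  shows "prob (stay_before t) = prob (stay t)"
proof -
  have t0: "0 < t" using t T by simp
  have [measurable]: "W t \<in> borel_measurable M" using t0 by (intro measurable_W) auto
  define A where "A = stay_before t - stay t"
  define B where "B = frontier (Gs t)"
  have A: "A \<in> sets M" by (auto simp: A_def)
  have B: "B \<in> sets borel" by (simp add: B_def)
  have AB: "W t \<omega> \<in> B" if \<omega>: "\<omega> \<in> A" for \<omega>
  proof -
    have sp: "\<omega> \<in> space M" using \<omega> by (auto simp: A_def stay_before_def)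
    have before: "W s \<omega> \<in> Gs s" if "0 < s" "s < t" for s
      using \<omega> that by (auto simp: A_def stay_before_def)
    have out: "W t \<omega> \<notin> Gs t"
    proof
      assume "W t \<omega> \<in> Gs t"
      then have "\<omega> \<in> stay t" using before sp by (auto simp: stay_def le_less)
      then show False using \<omega> by (simp add: A_def)
    qed
    have "W t \<omega> \<in> closure (Gs t)"
      unfolding closure_approachable
    proof (intro allI impI)
      fix e :: real assume e: "0 < e"
      have "continuous_on {0..} (\<lambda>t. W t \<omega>)" by (rule continuous_path[OF sp])
      then obtain d where d: "0 < d" "\<And>s. 0 \<le> s \<Longrightarrow> dist s t < d \<Longrightarrow> dist (W s \<omega>) (W t \<omega>) < e / 2"
        unfolding continuous_on_iff using t0 half_gt_zero[OF e] by (meson atLeast_iff less_imp_le)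
      \<comment> \<open>At most d/2 for continuity, at most t/2 to stay at positive times, at most e
        / (4 K) so that the section moves by less than e/2.\<close>
      define m where "m = min (d / 2) (min (t / 2) (e / (4 * K)))"
      have m: "0 < m" "m < d" "m < t" "K * m < e / 2"
      proof -
        have "m \<le> d / 2" "m \<le> t / 2" "m \<le> e / (4 * K)" by (auto simp: m_def)
        moreover have "K * (e / (4 * K)) = e / 4" using K by simp
        ultimately show "m < d" "m < t" "K * m < e / 2"
          using d t0 e K mult_left_mono[of m "e / (4 * K)" K] by auto
        show "0 < m" using d t0 e K by (simp add: m_def)
      qed
      have "W (t - m) \<omega> \<in> nbhd (Gs t) (e / 2)"
        using Gs_close(1)[of "t - m" t "e / 2"] before[of "t - m"] m t t0 by auto
      then obtain y where y: "y \<in> Gs t" "dist (W (t - m) \<omega>) y < e / 2" by (auto simp: mem_nbhd_iff)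
      have "dist (W (t - m) \<omega>) (W t \<omega>) < e / 2" using d(2)[of "t - m"] m by (simp add: dist_real_def)
      then have "dist y (W t \<omega>) < e"
        using y(2) dist_triangle_half_r[of "W (t - m) \<omega>" y e "W t \<omega>"] by simp
      then show "\<exists>y\<in>Gs t. dist y (W t \<omega>) < e" using y by blast
    qed
    then show ?thesis using out open_Gs by (simp add: B_def frontier_def interior_open)
  qed
  \<comment> \<open>The strip condition requires \<open>rho\<close> to be positive and says nothing
    about the frontier. The full moment replaces it, since the factor v still tends to 0.\<close>
  define J where "J = (\<integral>\<omega>. 1 + norm (W t \<omega>) \<partial>M)"
  have int: "integrable M (\<lambda>\<omega>. 1 + norm (W t \<omega>))" using integrable_norm_W[OF t0] by auto
  have J0: "0 \<le> J" unfolding J_def by (rule integral_nonneg_AE) auto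
  have I: "(\<integral>\<^sup>+\<omega>. indicator B (W t \<omega>) * ennreal (1 + norm (W t \<omega>)) \<partial>M) \<le> ennreal J"
  proof -
    have "(\<integral>\<^sup>+\<omega>. indicator B (W t \<omega>) * ennreal (1 + norm (W t \<omega>)) \<partial>M) \<le> (\<integral>\<^sup>+\<omega>. ennreal (1 + norm (W t \<omega>)) \<partial>M)"
      by (intro nn_integral_mono) (auto simp: indicator_def)
    also have "\<dots> = ennreal J" unfolding J_def by (rule nn_integral_eq_integral[OF int]) auto
    finally show ?thesis .
  qed
  have "prob A \<le> 0"
  proof (rule field_le_epsilon)
    fix e :: real assume e: "0 < e"
    define v where "v = min \<beta> (e / (C * J + 1))"
    have CJ: "0 < C * J + 1" using C J0 by (intro add_nonneg_pos mult_nonneg_nonneg) auto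
    have v: "0 < v" "v \<le> \<beta>" "v \<le> e / (C * J + 1)" using \<beta> e CJ by (auto simp: v_def)
    have "emeasure M A \<le> ennreal (C * v) * (\<integral>\<^sup>+\<omega>. indicator B (W t \<omega>) * ennreal (1 + norm (W t \<omega>)) \<partial>M)"
    proof (rule strip_bound_const[OF sc t v(1,2) B])
      show "x \<in> closure (Gs t) \<and> (\<exists>g\<in>frontier (Gs t). dist x g < v)" if "x \<in> B" for x
        using that v by (auto simp: B_def frontier_def intro!: bexI[of _ x])
      show "A \<subseteq> stay_before t" by (auto simp: A_def)
    qed (use A AB in auto)
    also have "\<dots> \<le> ennreal (C * v) * ennreal J" using I by (rule mult_left_mono) simp
    also have "\<dots> = ennreal (C * v * J)" using C v J0 by (simp add: ennreal_mult[symmetric])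
    finally have "prob A \<le> C * v * J" using C v J0 by (simp add: emeasure_eq_measure)
    also have "\<dots> \<le> v * (C * J + 1)" using v by (simp add: algebra_simps)
    also have "\<dots> \<le> e" using v(3) CJ by (simp add: pos_le_divide_eq)
    finally show "prob A \<le> 0 + e" by simp
  qed
  then have "prob A = 0" using measure_nonneg[of M A] by simp
  moreover have "prob A = prob (stay_before t) - prob (stay t)"
    unfolding A_def by (rule finite_measure_Diff) (auto simp: stay_le_before)
  ultimately show ?thesis by simp
qed

end

section \<open>The exit time has bounded density\<close>

text \<open>The 4 is 1 + 1 + 2: one makes the Chebyshev radius in \<open>exit_rate\<close> positive,
  one is the distance to the complement in units of sqrt h, two cover the motion of the section. The
  outer factor 2 is the loss from a probability of one half.\<close>

definition rate_const :: "'m::finite itself \<Rightarrow> real \<Rightarrow> real \<Rightarrow> real" where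
  "rate_const _ C \<gamma> = 2 * (2 * C * \<gamma> * (gmom TYPE('m) 2 + (sqrt (2 * gmom TYPE('m) 2) + 4)\<^sup>2) + 1)"

lemma open_nbhd_norm:
  "open {(x :: real ^ 'm, \<xi> :: real ^ 'm). x \<in> nbhd A (norm \<xi> + a)}"
proof -
  have "{(x :: real ^ 'm, \<xi> :: real ^ 'm). x \<in> nbhd A (norm \<xi> + a)} = (\<Union>y\<in>A. {p. dist (fst p) y < norm (snd p) + a})"
    by (auto simp: mem_nbhd_iff)
  moreover have "open {p :: (real ^ 'm) \<times> (real ^ 'm). dist (fst p) y < norm (snd p) + a}" for y
    by (intro open_Collect_less continuous_intros)
  ultimately show ?thesis by auto
qed

context tube begin

lemma sets_stay_increment_strip:
  assumes t: "0 < t" and h: "0 \<le> h"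
  shows "stay t \<inter> {\<omega> \<in> space M. W t \<omega> \<in> nbhd A (norm (W (t + h) \<omega> - W t \<omega>) + a)} \<in> sets M"
proof -
  define S where "S = {(x :: real ^ 'm, \<xi> :: real ^ 'm). x \<in> nbhd A (norm \<xi> + a)}"
  have S: "S \<in> sets (borel \<Otimes>\<^sub>M borel)"
    unfolding borel_prod S_def by (intro borel_open open_nbhd_norm)
  have [measurable]: "W t \<in> borel_measurable M" "(\<lambda>\<omega>. W (t + h) \<omega> - W t \<omega>) \<in> borel_measurable M"
    using t h by (auto intro!: borel_measurable_diff measurable_W)
  have "(\<lambda>\<omega>. (W t \<omega>, W (t + h) \<omega> - W t \<omega>)) \<in> measurable M (borel \<Otimes>\<^sub>M borel)" by measurable
  from measurable_sets[OF this S] have "(\<lambda>\<omega>. (W t \<omega>, W (t + h) \<omega> - W t \<omega>)) -` S \<inter> space M \<in> sets M" .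
  moreover have "stay t \<inter> {\<omega> \<in> space M. W t \<omega> \<in> nbhd A (norm (W (t + h) \<omega> - W t \<omega>) + a)}
      = stay t \<inter> ((\<lambda>\<omega>. (W t \<omega>, W (t + h) \<omega> - W t \<omega>)) -` S \<inter> space M)"
    by (auto simp: S_def)
  ultimately show ?thesis by auto
qed

text \<open>The distance to the complement at time \<open>t\<close> and the increment after time \<open>t\<close> are independent;
  the quadratic strip bound is integrated against the law of the increment.\<close>

lemma stay_strip_increment:
  assumes sc: "strip_const TYPE('m) T K \<beta> C" and C: "0 < C" and t: "T / 2 \<le> t" "t < T" and c: "0 < c"
  shows "\<exists>\<eta>>0. \<forall>h. 0 < h \<and> h < \<eta> \<longrightarrow>
    prob (stay t \<inter> {\<omega> \<in> space M. W t \<omega> \<in> nbhd (- Gs t) (norm (W (t + h) \<omega> - W t \<omega>) + c * sqrt h)})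
      \<le> (2 * C * \<gamma> * (gmom TYPE('m) 2 + c\<^sup>2) + 1) * h"
proof -
  have t0: "0 < t" using t T by simp
  have Wt: "W t \<in> borel_measurable (past t)" using t0 by (intro measurable_past) auto
  obtain v1 where v1: "0 < v1" "\<And>v. 0 < v \<Longrightarrow> v < v1 \<Longrightarrow>
      prob (stay t \<inter> {\<omega> \<in> space M. W t \<omega> \<in> nbhd (- Gs t) v}) \<le> C * \<gamma> * v\<^sup>2"
    using stay_strip[OF sc C t] by blast
  define g4 where "g4 = gmom TYPE('m) 4"
  have g4: "0 \<le> g4" unfolding g4_def by (rule gmom_nonneg)
  \<comment> \<open>The first entry gives \<open>c * sqrt h < v1 / 2\<close>, the second makes the
    fourth-moment term at most \<open>h\<close>.\<close>
  define \<eta> where "\<eta> = min ((v1 / (2 * c))\<^sup>2) (v1 ^ 4 / (16 * g4 + 1))"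
  have g41: "0 < 16 * g4 + 1" using g4 by simp
  have \<eta>: "0 < \<eta>" using v1 c g41 by (simp add: \<eta>_def)
  have "prob (stay t \<inter> {\<omega> \<in> space M. W t \<omega> \<in> nbhd (- Gs t) (norm (W (t + h) \<omega> - W t \<omega>) + c * sqrt h)})
      \<le> (2 * C * \<gamma> * (gmom TYPE('m) 2 + c\<^sup>2) + 1) * h" if h: "0 < h" "h < \<eta>" for h
  proof -
    have sh: "sqrt h < v1 / (2 * c)"
      using h v1 c by (intro real_less_lsqrt) (auto simp: \<eta>_def)
    then have csh: "c * sqrt h < v1 / 2" "0 < c * sqrt h" using c h by (auto simp: field_simps)
    have h4: "16 * g4 * h\<^sup>2 / v1 ^ 4 \<le> h"
    proof -
      have "h * (16 * g4 + 1) \<le> v1 ^ 4" using h g41 by (simp add: \<eta>_def pos_less_divide_eq less_imp_le)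
      then have "16 * g4 * h \<le> v1 ^ 4" using h by (simp add: algebra_simps)
      from mult_right_mono[OF this, of h] h v1 show ?thesis by (simp add: pos_divide_le_eq power2_eq_square mult_ac)
    qed
    interpret N: prob_space "gauss (sqrt h) :: (real ^ 'm) measure" using h by (intro prob_space_gauss) auto
    interpret P: pair_sigma_finite M "gauss (sqrt h) :: (real ^ 'm) measure" ..
    define S where "S = {(x, \<xi> :: real ^ 'm). x \<in> nbhd (- Gs t) (norm \<xi> + c * sqrt h)}"
    have S [measurable]: "S \<in> sets (borel \<Otimes>\<^sub>M borel)"
      unfolding borel_prod S_def by (intro borel_open open_nbhd_norm)
    define g where "g p = (indicator (stay t) (fst p) * indicator S (W t (fst p), snd p) :: ennreal)" for p
    have g: "g \<in> borel_measurable (N' \<Otimes>\<^sub>M borel)" if [measurable]: "W t \<in> borel_measurable N'" "stay t \<in> sets N'" for N'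
      unfolding g_def by measurable
    have g1: "g \<in> borel_measurable (past t \<Otimes>\<^sub>M borel)" by (rule g[OF Wt stay_past])
    have g2: "g \<in> borel_measurable (M \<Otimes>\<^sub>M gauss (sqrt h))"
      using g[OF measurable_from_past[OF Wt] sets_stay]
      unfolding measurable_cong_sets[OF sets_pair_measure_cong[OF refl sets_gauss] refl] .
    define Q where "Q = stay t \<inter> {\<omega> \<in> space M. W t \<omega> \<in> nbhd (- Gs t) (norm (W (t + h) \<omega> - W t \<omega>) + c * sqrt h)}"
    have Q: "Q \<in> sets M" unfolding Q_def by (rule sets_stay_increment_strip) (use t0 h in auto)
    have "emeasure M Q = (\<integral>\<^sup>+\<omega>. indicator Q \<omega> \<partial>M)" using Q by simp
    also have "\<dots> = (\<integral>\<^sup>+\<omega>. g (\<omega>, W (t + h) \<omega> - W t \<omega>) \<partial>M)"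
      by (intro nn_integral_cong) (auto simp: g_def Q_def S_def indicator_def)
    also have "\<dots> = (\<integral>\<^sup>+\<omega>. \<integral>\<^sup>+\<xi>. g (\<omega>, \<xi>) \<partial>gauss (sqrt h) \<partial>M)"
      using nn_integral_past_increment[OF _ _ g1, of "t + h"] t0 h by simp
    also have "\<dots> = (\<integral>\<^sup>+\<xi>. \<integral>\<^sup>+\<omega>. g (\<omega>, \<xi>) \<partial>M \<partial>gauss (sqrt h))"
      by (rule P.Fubini'[symmetric]) (use g2 in simp)
    also have "\<dots> \<le> (\<integral>\<^sup>+\<xi>. ennreal (2 * C * \<gamma> * norm \<xi> ^ 2 + 2 * C * \<gamma> * (c\<^sup>2 * h) + 16 / v1 ^ 4 * norm \<xi> ^ 4) \<partial>(gauss (sqrt h) :: (real ^ 'm) measure))"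
    proof (rule nn_integral_mono)
      fix \<xi> :: "real ^ 'm"
      define B where "B = stay t \<inter> {\<omega> \<in> space M. W t \<omega> \<in> nbhd (- Gs t) (norm \<xi> + c * sqrt h)}"
      have B: "B \<in> sets M"
      proof -
        have "B = stay t \<inter> (W t -` nbhd (- Gs t) (norm \<xi> + c * sqrt h) \<inter> space M)" by (auto simp: B_def)
        moreover have "W t -` nbhd (- Gs t) (norm \<xi> + c * sqrt h) \<inter> space M \<in> sets M"
          using t0 by (intro measurable_sets[OF measurable_W] borel_open open_nbhd) auto
        ultimately show ?thesis by auto
      qed
      have "(\<integral>\<^sup>+\<omega>. g (\<omega>, \<xi>) \<partial>M) = (\<integral>\<^sup>+\<omega>. indicator B \<omega> \<partial>M)"
        by (intro nn_integral_cong) (auto simp: g_def B_def S_def indicator_def)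
      also have "\<dots> = ennreal (prob B)" using B by (simp add: emeasure_eq_measure)
      also have "\<dots> \<le> ennreal (2 * C * \<gamma> * norm \<xi> ^ 2 + 2 * C * \<gamma> * (c\<^sup>2 * h) + 16 / v1 ^ 4 * norm \<xi> ^ 4)"
      proof (rule ennreal_leI)
        have nn: "0 \<le> 2 * C * \<gamma> * norm \<xi> ^ 2 + 2 * C * \<gamma> * (c\<^sup>2 * h)" "0 \<le> 16 / v1 ^ 4 * norm \<xi> ^ 4"
          using C \<gamma> h by auto
        show "prob B \<le> 2 * C * \<gamma> * norm \<xi> ^ 2 + 2 * C * \<gamma> * (c\<^sup>2 * h) + 16 / v1 ^ 4 * norm \<xi> ^ 4"
        proof (cases "norm \<xi> < v1 / 2")
          case True
          have "prob B \<le> C * \<gamma> * (norm \<xi> + c * sqrt h)\<^sup>2"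
            unfolding B_def using True csh by (intro v1(2)) (auto simp: add_nonneg_pos)
          also have "(norm \<xi> + c * sqrt h)\<^sup>2 \<le> 2 * (norm \<xi>)\<^sup>2 + 2 * (c * sqrt h)\<^sup>2"
            using zero_le_power2[of "norm \<xi> - c * sqrt h"] unfolding power2_sum power2_diff by linarith
          then have "C * \<gamma> * (norm \<xi> + c * sqrt h)\<^sup>2 \<le> C * \<gamma> * (2 * (norm \<xi>)\<^sup>2 + 2 * (c * sqrt h)\<^sup>2)"
            using C \<gamma> by (intro mult_left_mono) auto
          also have "\<dots> = 2 * C * \<gamma> * norm \<xi> ^ 2 + 2 * C * \<gamma> * (c\<^sup>2 * h)"
            using h by (simp add: power_mult_distrib algebra_simps)
          finally show ?thesis using nn(2) by linarith
        next
          \<comment> \<open>Beyond the range of the strip bound, the trivial bound 1 is paid for by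
            the fourth moment of the increment, which is of order \<open>h\<^sup>2\<close>.\<close>
          case False
          then have "(v1 / 2) ^ 4 \<le> norm \<xi> ^ 4" using v1 by (intro power_mono) auto
          then have "1 \<le> 16 / v1 ^ 4 * norm \<xi> ^ 4" using v1 by (simp add: power_divide field_simps)
          then show ?thesis using nn(1) prob_le_1[of B] by linarith
        qed
      qed
      finally show "(\<integral>\<^sup>+\<omega>. g (\<omega>, \<xi>) \<partial>M) \<le> ennreal (2 * C * \<gamma> * norm \<xi> ^ 2 + 2 * C * \<gamma> * (c\<^sup>2 * h) + 16 / v1 ^ 4 * norm \<xi> ^ 4)" .
    qed
    also have "\<dots> = ennreal (\<integral>\<xi>. 2 * C * \<gamma> * norm \<xi> ^ 2 + 2 * C * \<gamma> * (c\<^sup>2 * h) + 16 / v1 ^ 4 * norm \<xi> ^ 4 \<partial>(gauss (sqrt h) :: (real ^ 'm) measure))"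
      using integrable_gauss_norm_power[where 'm='m, of "sqrt h"] C \<gamma> h v1
      by (intro nn_integral_eq_integral) auto
    also have "(\<integral>\<xi>. 2 * C * \<gamma> * norm \<xi> ^ 2 + 2 * C * \<gamma> * (c\<^sup>2 * h) + 16 / v1 ^ 4 * norm \<xi> ^ 4 \<partial>(gauss (sqrt h) :: (real ^ 'm) measure))
       = 2 * C * \<gamma> * (sqrt h ^ 2 * gmom TYPE('m) 2) + 2 * C * \<gamma> * (c\<^sup>2 * h) + 16 / v1 ^ 4 * (sqrt h ^ 4 * g4)"
      using integrable_gauss_norm_power[where 'm='m, of "sqrt h"] h N.prob_space
        integral_gauss_norm_power[where 'm='m, of "sqrt h" 2] integral_gauss_norm_power[where 'm='m, of "sqrt h" 4]
      by (simp add: g4_def)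
    also have "\<dots> \<le> (2 * C * \<gamma> * (gmom TYPE('m) 2 + c\<^sup>2) + 1) * h"
    proof -
      have "sqrt h ^ 4 = (sqrt h ^ 2) ^ 2" by (simp del: real_sqrt_pow2)
      then have "sqrt h ^ 2 = h" "sqrt h ^ 4 = h\<^sup>2" using h by simp_all
      then show ?thesis using h4 by (simp add: algebra_simps)
    qed
    finally have "emeasure M Q \<le> ennreal ((2 * C * \<gamma> * (gmom TYPE('m) 2 + c\<^sup>2) + 1) * h)"
      by (simp add: ennreal_leI)
    moreover have "0 \<le> (2 * C * \<gamma> * (gmom TYPE('m) 2 + c\<^sup>2) + 1) * h"
      using C \<gamma> h gmom_nonneg[where 'm='m, of 2] by auto
    ultimately show ?thesis unfolding Q_def[symmetric] by (simp add: emeasure_eq_measure)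
  qed
  then show ?thesis using \<eta> by blast
qed

text \<open>An Ottaviani-type argument trades the unknown exit time for one increment. A path
  leaving between t and t + h comes within \<open>sqrt h\<close> of the complement at some grid
  time, if the grid is fine. The increment from the first such time to t + h is independent of the
  past and at most \<open>c * sqrt h\<close> with probability at least 1/2. In that case W t is
  within |W (t + h) - W t| + (c + 3) sqrt h of the complement at time t. So the exit probability is
  at most twice the one bounded in \<open>stay_strip_increment\<close>.\<close>

lemma exit_rate:
  assumes sc: "strip_const TYPE('m) T K \<beta> C" and C: "0 < C" and t: "T / 2 \<le> t" "t < T"
  shows "\<exists>\<eta>>0. \<forall>h. 0 < h \<and> h < \<eta> \<longrightarrow> prob (stay t) - prob (stay (t + h)) \<le> rate_const TYPE('m) C \<gamma> * h"
proof -
  define c where "c = sqrt (2 * gmom TYPE('m) 2) + 1"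
  have g2: "0 \<le> gmom TYPE('m) 2" by (rule gmom_nonneg)
  have c: "0 < c" "2 * gmom TYPE('m) 2 \<le> c\<^sup>2"
  proof -
    show "0 < c" using g2 by (simp add: c_def add_nonneg_pos)
    have "(sqrt (2 * gmom TYPE('m) 2))\<^sup>2 \<le> c\<^sup>2" using g2 by (intro power_mono) (auto simp: c_def)
    then show "2 * gmom TYPE('m) 2 \<le> c\<^sup>2" using g2 by simp
  qed
  have t0: "0 < t" using t T by simp
  define D where "D = 2 * C * \<gamma> * (gmom TYPE('m) 2 + (c + 3)\<^sup>2) + 1"
  have "c + 3 = sqrt (2 * gmom TYPE('m) 2) + 4" by (simp add: c_def)
  then have rc: "rate_const TYPE('m) C \<gamma> = 2 * D" unfolding rate_const_def D_def by (simp only:)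
  have "0 < c + 3" using c by simp
  from stay_strip_increment[OF sc C t this]
  obtain \<eta>1 where \<eta>1: "0 < \<eta>1" "\<And>h. 0 < h \<Longrightarrow> h < \<eta>1 \<Longrightarrow>
      prob (stay t \<inter> {\<omega> \<in> space M. W t \<omega> \<in> nbhd (- Gs t) (norm (W (t + h) \<omega> - W t \<omega>) + (c + 3) * sqrt h)}) \<le> D * h"
    unfolding D_def by blast
  \<comment> \<open>Keeps t + h below T and gives \<open>K * h \<le> sqrt h\<close>, so the section
    moves by no more than the scale of the path.\<close>
  define \<eta> where "\<eta> = min \<eta>1 (min (T - t) ((1 / K)\<^sup>2))"
  have \<eta>: "0 < \<eta>" using \<eta>1 t K by (simp add: \<eta>_def)
  have "prob (stay t) - prob (stay (t + h)) \<le> 2 * D * h" if h: "0 < h" "h < \<eta>" for h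
  proof -
    have hT: "t + h < T" and h\<eta>: "h < \<eta>1" using h by (auto simp: \<eta>_def)
    have Kh: "K * h \<le> sqrt h"
    proof -
      have "sqrt h \<le> 1 / K" using h K by (intro real_le_lsqrt) (auto simp: \<eta>_def)
      then have "K * sqrt h \<le> 1" using K by (simp add: field_simps)
      from mult_right_mono[OF this, of "sqrt h"] h show ?thesis by (simp add: mult.assoc)
    qed
    have sh: "0 < sqrt h" using h by simp
    define Q where "Q = stay t \<inter> {\<omega> \<in> space M. W t \<omega> \<in> nbhd (- Gs t) (norm (W (t + h) \<omega> - W t \<omega>) + (c + 3) * sqrt h)}"
    define s where "s N i = t + real i * (h / real N)" for N i :: nat
    define Near where "Near N i = W (s N i) -` nbhd (- Gs (s N i)) (sqrt h) \<inter> space M" for N i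
    \<comment> \<open>First approach at index i: disjoint in i, and determined by the past of
      \<open>s N i\<close>.\<close>
    define E where "E N i = stay t \<inter> Near N i - (\<Union>j\<in>{1..<i}. Near N j)" for N i
    define F where "F N = (\<Union>i\<in>{1..N}. E N i)" for N
    have s_ge: "t \<le> s N i" for N i using h by (simp add: s_def)
    have s_mono: "s N j \<le> s N i" if "j \<le> i" for N i j
      unfolding s_def using that h by (intro add_left_mono mult_right_mono) auto
    have s_less: "s N i < t + h" if "i < N" for N i
    proof -
      have "real i * (h / real N) < real N * (h / real N)" using that h by (intro mult_strict_right_mono) auto
      then show ?thesis using that by (simp add: s_def)
    qed
    have s_N: "s N N = t + h" if "0 < N" for N using that by (simp add: s_def)
    have s_le: "s N i \<le> t + h" if "i \<le> N" "0 < N" for N i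
      using s_less[of i N] s_N[of N] that by (cases "i = N") auto
    have Near: "Near N i \<in> sets (past (s N i))" for N i
    proof -
      have "W (s N i) -` nbhd (- Gs (s N i)) (sqrt h) \<inter> space (past (s N i)) \<in> sets (past (s N i))"
        using s_ge[of N i] t0 by (intro measurable_sets[OF measurable_past] borel_open open_nbhd) auto
      then show ?thesis by (simp add: Near_def)
    qed
    have E_past: "E N i \<in> sets (past (s N i))" for N i
    proof -
      have "stay t \<in> sets (past (s N i))" using stay_past past_mono[OF s_ge] by blast
      moreover have "Near N j \<in> sets (past (s N i))" if "j \<in> {1..<i}" for j
        using Near past_mono[OF s_mono[of j i N]] that by auto
      ultimately show ?thesis
        unfolding E_def using Near by (intro sets.Diff sets.Int sets.finite_UN) auto
    qed
    have E: "E N i \<in> sets M" for N i using E_past past_le by blast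
    have disj: "disjoint_family_on (E N) {1..N}" for N
      unfolding disjoint_family_on_def
    proof (intro ballI impI)
      fix i j assume "i \<in> {1..N}" "j \<in> {1..N}" "i \<noteq> j"
      then consider "1 \<le> i \<and> i < j" | "1 \<le> j \<and> j < i" by fastforce
      then show "E N i \<inter> E N j = {}" by cases (auto simp: E_def)
    qed
    have half: "prob (F N) \<le> 2 * (D * h)" for N
    proof (cases "N = 0")
      case True
      have "0 \<le> D * h" using \<eta>1(2)[OF h(1) h\<eta>] measure_nonneg order_trans by blast
      then show ?thesis using True by (simp add: F_def)
    next
      case False
      then have N: "0 < N" by simp
      define L where "L i = {\<omega> \<in> space M. norm (W (t + h) \<omega> - W (s N i) \<omega>) \<le> c * sqrt h}" for i
      have L: "L i \<in> sets M" if "i \<in> {1..N}" for i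
      proof -
        have [measurable]: "W (t + h) \<in> borel_measurable M" "W (s N i) \<in> borel_measurable M"
          using t0 h s_ge[of N i] by (auto intro!: measurable_W)
        show ?thesis unfolding L_def by measurable
      qed
      have EL: "prob (E N i) \<le> 2 * prob (E N i \<inter> L i)" if i: "i \<in> {1..N}" for i
      proof (cases "i = N")
        \<comment> \<open>At the last grid time no increment is left, and the independence statement
          concerns positive time lags.\<close>
        case True
        have "E N i \<inter> L i = E N i"
          using c sh sets.sets_into_space[OF E[of N i]] s_N[OF N] True by (auto simp: L_def)
        then show ?thesis by simp
      next
        case False
        then have iN: "s N i < t + h" using i by (intro s_less) auto
        have Lv: "L i = (\<lambda>\<omega>. W (t + h) \<omega> - W (s N i) \<omega>) -` {x. norm x \<le> c * sqrt h} \<inter> space M"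
          by (auto simp: L_def)
        have s0: "0 \<le> s N i" using s_ge[of N i] t0 by linarith
        have "prob (E N i \<inter> L i) = prob (E N i) * prob (L i)"
          unfolding Lv by (rule indep_past_increment[OF s0 iN E_past]) simp
        moreover have "1 / 2 \<le> prob (L i)"
        proof -
          have "1 / 2 \<le> measure (gauss (sqrt (t + h - s N i))) {x :: real ^ 'm. norm x \<le> c * sqrt h}"
          proof (rule gauss_chebyshev)
            have "2 * (sqrt (t + h - s N i))\<^sup>2 * gmom TYPE('m) 2 = 2 * gmom TYPE('m) 2 * (t + h - s N i)" using iN by simp
            also have "\<dots> \<le> c\<^sup>2 * h" using c s_ge[of N i] g2 iN h by (intro mult_mono) auto
            finally show "2 * (sqrt (t + h - s N i))\<^sup>2 * gmom TYPE('m) 2 \<le> (c * sqrt h)\<^sup>2"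
              using h by (simp add: power_mult_distrib)
          qed (use c sh iN in auto)
          then show ?thesis unfolding Lv using s0 iN by (subst prob_increment) auto
        qed
        moreover have "prob (E N i) * (1 / 2) \<le> prob (E N i) * prob (L i)"
          using calculation(2) by (intro mult_left_mono) auto
        ultimately show ?thesis by linarith
      qed
      have ELQ: "E N i \<inter> L i \<subseteq> Q" if i: "i \<in> {1..N}" for i
      proof
        fix \<omega> assume \<omega>: "\<omega> \<in> E N i \<inter> L i"
        then have sp: "\<omega> \<in> space M" "\<omega> \<in> stay t" "W (s N i) \<omega> \<in> nbhd (- Gs (s N i)) (sqrt h)"
          "norm (W (t + h) \<omega> - W (s N i) \<omega>) \<le> c * sqrt h"
          by (auto simp: E_def L_def Near_def)
        then obtain z where z: "z \<notin> Gs (s N i)" "dist (W (s N i) \<omega>) z < sqrt h" by (auto simp: mem_nbhd_iff)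
        have si: "s N i \<le> t + h" using s_le i by auto
        have "K * \<bar>s N i - t\<bar> \<le> K * h" using K si s_ge[of N i] by (intro mult_left_mono) auto
        then have "K * \<bar>s N i - t\<bar> < 2 * sqrt h" using Kh sh by linarith
        then have "- Gs (s N i) \<subseteq> nbhd (- Gs t) (2 * sqrt h)"
          using s_ge[of N i] si t0 hT t by (intro Gs_close(2)) auto
        then obtain z' where z': "z' \<notin> Gs t" "dist z z' < 2 * sqrt h" using z(1) by (auto simp: mem_nbhd_iff subset_iff)
        have "dist (W t \<omega>) z' \<le> dist (W t \<omega>) (W (t + h) \<omega>) + dist (W (t + h) \<omega>) (W (s N i) \<omega>) + dist (W (s N i) \<omega>) z + dist z z'"
          using dist_triangle[of "W t \<omega>" z' "W (t + h) \<omega>"] dist_triangle[of "W (t + h) \<omega>" z' "W (s N i) \<omega>"]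
            dist_triangle[of "W (s N i) \<omega>" z' z] by linarith
        also have "\<dots> < norm (W (t + h) \<omega> - W t \<omega>) + (c + 3) * sqrt h"
          using sp(4) z(2) z'(2) by (simp add: dist_norm norm_minus_commute distrib_right)
        finally show "\<omega> \<in> Q" unfolding Q_def using sp z'(1) by (auto simp: mem_nbhd_iff)
      qed
      have disjL: "disjoint_family_on (\<lambda>i. E N i \<inter> L i) {1..N}"
        using disj[of N] unfolding disjoint_family_on_def by blast
      have Qm: "prob (\<Union>i\<in>{1..N}. E N i \<inter> L i) \<le> prob Q"
      proof (rule finite_measure_mono)
        show "(\<Union>i\<in>{1..N}. E N i \<inter> L i) \<subseteq> Q" using ELQ by blast
        show "Q \<in> sets M" unfolding Q_def by (rule sets_stay_increment_strip) (use t0 h in auto)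
      qed
      have "prob (F N) = (\<Sum>i\<in>{1..N}. prob (E N i))"
        unfolding F_def using E disj by (intro finite_measure_finite_Union) auto
      also have "\<dots> \<le> (\<Sum>i\<in>{1..N}. 2 * prob (E N i \<inter> L i))" by (intro sum_mono EL)
      also have "\<dots> = 2 * (\<Sum>i\<in>{1..N}. prob (E N i \<inter> L i))" by (simp add: sum_distrib_left)
      also have "(\<Sum>i\<in>{1..N}. prob (E N i \<inter> L i)) = prob (\<Union>i\<in>{1..N}. E N i \<inter> L i)"
        using E L disjL by (intro finite_measure_finite_Union[symmetric]) auto
      also have "2 * \<dots> \<le> 2 * (D * h)" using Qm \<eta>1(2)[OF h(1) h\<eta>] by (simp add: Q_def)
      finally show ?thesis .
    qed
    have "prob (stay t - stay (t + h)) \<le> 2 * (D * h)"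
    proof (rule measure_le_of_eventually[where F=F])
      show "F N \<in> sets M" for N unfolding F_def using E by (intro sets.finite_UN) auto
      show "eventually (\<lambda>N. prob (F N) \<le> 2 * (D * h)) sequentially" using half by simp
      fix \<omega> assume \<omega>: "\<omega> \<in> stay t - stay (t + h)"
      have sp: "\<omega> \<in> space M" using \<omega> by (simp add: stay_def)
      obtain u where u: "0 < u" "u \<le> t + h" "W u \<omega> \<notin> Gs u" using \<omega> sp by (auto simp: stay_def)
      have ut: "t < u" using \<omega> u by (auto simp: stay_def not_le[symmetric])
      have "continuous_on {t..t + h} (\<lambda>t. W t \<omega>)"
        using t0 by (intro continuous_on_subset[OF continuous_path[OF sp]]) auto
      then have "uniformly_continuous_on {t..t + h} (\<lambda>t. W t \<omega>)"
        by (rule compact_uniformly_continuous) simp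
      then obtain d where d: "0 < d" "\<And>x y. x \<in> {t..t + h} \<Longrightarrow> y \<in> {t..t + h} \<Longrightarrow> dist y x < d \<Longrightarrow> dist (W y \<omega>) (W x \<omega>) < sqrt h / 2"
        using half_gt_zero[OF sh] unfolding uniformly_continuous_on_def by meson
      define m where "m = min d (sqrt h / (2 * K))"
      have m: "0 < m" using d sh K by (simp add: m_def)
      obtain N0 :: nat where N0: "h / m < real N0" using reals_Archimedean2 by blast
      show "eventually (\<lambda>N. \<omega> \<in> F N) sequentially"
        unfolding eventually_sequentially
      proof (intro exI[of _ N0] allI impI)
        fix N assume N: "N0 \<le> N"
        have "h / m < real N" using N0 N by simp
        moreover have "0 < h / m" using h m by simp
        ultimately have N_pos: "0 < real N" "0 < N" by linarith+
        have hN: "h / real N < m" using \<open>h / m < real N\<close> N_pos m by (simp add: field_simps)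
        \<comment> \<open>The first grid index at or after the exit time u.\<close>
        define i where "i = nat \<lceil>(u - t) / (h / real N)\<rceil>"
        have q: "0 < (u - t) / (h / real N)" using ut h N_pos by simp
        have i1: "(u - t) / (h / real N) \<le> real i" "real i < (u - t) / (h / real N) + 1"
          unfolding i_def using q by linarith+
        have i_pos: "1 \<le> i" using i1 q by (cases i) auto
        have hN0: "0 < h / real N" using h N_pos by simp
        have "(u - t) / (h / real N) \<le> real N"
          unfolding pos_divide_le_eq[OF hN0] using u(2) N_pos by simp
        then have iN: "i \<le> N" unfolding i_def by linarith
        have us: "u \<le> s N i" "s N i < u + h / real N"
        proof -
          have "u - t \<le> real i * (h / real N)" using i1(1) unfolding pos_divide_le_eq[OF hN0] .
          then show "u \<le> s N i" by (simp add: s_def)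
          have "real i * (h / real N) < ((u - t) / (h / real N) + 1) * (h / real N)"
            using i1(2) hN0 by (intro mult_strict_right_mono) auto
          also have "\<dots> = u - t + h / real N"
            unfolding distrib_right using h N_pos by simp
          finally show "s N i < u + h / real N" by (simp add: s_def)
        qed
        have si: "s N i \<le> t + h" using s_le iN N_pos by auto
        have du: "\<bar>u - s N i\<bar> < m" using us hN by linarith
        have "dist (W (s N i) \<omega>) (W u \<omega>) < sqrt h / 2"
          using du us si ut u by (intro d(2)) (auto simp: m_def dist_real_def abs_minus_commute)
        moreover have "W u \<omega> \<in> nbhd (- Gs (s N i)) (sqrt h / 2)"
        proof -
          have "K * \<bar>u - s N i\<bar> < K * (sqrt h / (2 * K))" using du K by (intro mult_strict_left_mono) (auto simp: m_def)
          also have "\<dots> = sqrt h / 2" using K by simp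
          finally have "- Gs u \<subseteq> nbhd (- Gs (s N i)) (sqrt h / 2)"
            using u ut us si t0 hT by (intro Gs_close(2)) auto
          then show ?thesis using u(3) by blast
        qed
        then obtain z where z: "z \<notin> Gs (s N i)" "dist (W u \<omega>) z < sqrt h / 2" by (auto simp: mem_nbhd_iff)
        ultimately have "dist (W (s N i) \<omega>) z < sqrt h"
          using dist_triangle[of "W (s N i) \<omega>" z "W u \<omega>"] by linarith
        then have near: "\<omega> \<in> Near N i" using z sp by (auto simp: Near_def mem_nbhd_iff)
        define k where "k = (LEAST k. 1 \<le> k \<and> \<omega> \<in> Near N k)"
        have k: "1 \<le> k \<and> \<omega> \<in> Near N k" "k \<le> i"
          unfolding k_def using near i_pos by (auto intro: LeastI2 Least_le)
        have "\<omega> \<notin> Near N j" if "j \<in> {1..<k}" for j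
          using not_less_Least[of j "\<lambda>k. 1 \<le> k \<and> \<omega> \<in> Near N k"] that unfolding k_def by auto
        then have "\<omega> \<in> E N k" using k \<omega> by (auto simp: E_def)
        then show "\<omega> \<in> F N" using k iN by (auto simp: F_def)
      qed
    qed
    moreover have "prob (stay t - stay (t + h)) = prob (stay t) - prob (stay (t + h))"
      using h by (intro finite_measure_Diff) (auto intro!: stay_mono sets_stay simp del: Diff_iff)
    ultimately show ?thesis by simp
  qed
  then show ?thesis unfolding rc using \<eta> by blast
qed

end

section \<open>Survival after an exit\<close>

lemma rate_const_pos: "0 < C \<Longrightarrow> 0 < \<gamma> \<Longrightarrow> 0 < rate_const TYPE('m::finite) C \<gamma>"
  using gmom_nonneg[where 'm='m, of 2] by (simp add: rate_const_def add_nonneg_pos)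

text \<open>Bounds a term of a Riemann sum for 1 / sqrt by a telescoping difference;
  \<open>sum_exit_bound\<close> uses this near the singularity at T.\<close>

lemma sqrt_diff_ge:
  assumes "0 < \<delta>" "\<delta> \<le> a"
  shows "\<delta> / sqrt a \<le> 2 * (sqrt a - sqrt (a - \<delta>))"
proof -
  have "\<delta> = (sqrt a - sqrt (a - \<delta>)) * (sqrt a + sqrt (a - \<delta>))"
    using assms by (simp add: algebra_simps)
  also have "\<dots> \<le> (sqrt a - sqrt (a - \<delta>)) * (2 * sqrt a)"
    using assms by (intro mult_left_mono) auto
  finally show ?thesis using assms by (simp add: pos_divide_le_eq mult_ac)
qed

text \<open>Meant for r = q sqrt h with h at most \<open>h0\<close>: the bounds linear in r are
  imposed at \<open>h0\<close>, while in 8 r^2 <= V h the factor h cancels. The scale sqrt h of r is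
  what yields a survival probability of order \<epsilon> / sqrt h.\<close>

definition forward_const :: "'m::finite itself \<Rightarrow> real \<Rightarrow> real \<Rightarrow> real \<Rightarrow> real \<Rightarrow> bool" where
  "forward_const _ K \<beta> h0 q \<longleftrightarrow> 0 < h0 \<and> 0 < q \<and> K * h0 \<le> \<beta> / 4 \<and> q * sqrt h0 \<le> \<beta>\<^sup>2 \<and>
     6 * (2 * \<beta> * K + gmom TYPE('m) 2) * (q * sqrt h0) \<le> \<beta>\<^sup>2 / (8 * (real CARD('m))\<^sup>2) \<and>
     8 * q\<^sup>2 \<le> \<beta>\<^sup>2 / (8 * (real CARD('m))\<^sup>2)"

lemma ex_forward_const:
  assumes "0 < K" "0 < \<beta>"
  shows "\<exists>h0 q. forward_const TYPE('m::finite) K \<beta> h0 q"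
proof -
  define V where "V = \<beta>\<^sup>2 / (8 * (real CARD('m))\<^sup>2)"
  define h0 where "h0 = \<beta> / (4 * K)"
  define Q where "Q = 2 * \<beta> * K + gmom TYPE('m) 2"
  define q where "q = min (sqrt (V / 8)) (min (\<beta>\<^sup>2 / sqrt h0) (V / (6 * Q * sqrt h0)))"
  have V: "0 < V" using assms by (simp add: V_def)
  have h0: "0 < h0" using assms by (simp add: h0_def)
  have Q: "0 < Q" unfolding Q_def using assms gmom_nonneg[where 'm='m, of 2] by (intro add_pos_nonneg) auto
  have q: "0 < q" "q \<le> sqrt (V / 8)" "q \<le> \<beta>\<^sup>2 / sqrt h0" "q \<le> V / (6 * Q * sqrt h0)"
    using V h0 Q assms by (auto simp: q_def)
  have 1: "8 * q\<^sup>2 \<le> V"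
  proof -
    have "q\<^sup>2 \<le> (sqrt (V / 8))\<^sup>2" using q by (intro power_mono) auto
    then show ?thesis using V by simp
  qed
  have 2: "q * sqrt h0 \<le> \<beta>\<^sup>2" using q(3) h0 by (simp add: pos_le_divide_eq)
  have "0 < 6 * Q * sqrt h0" using Q h0 by simp
  then have "q * (6 * Q * sqrt h0) \<le> V" using q(4) by (simp add: pos_le_divide_eq)
  then have 3: "6 * Q * (q * sqrt h0) \<le> V" by (simp add: mult_ac)
  have 4: "K * h0 \<le> \<beta> / 4" using assms by (simp add: h0_def)
  show ?thesis
    using h0 q(1) 1 2 3 4 unfolding forward_const_def V_def Q_def by blast
qed

section \<open>Time dependence of the staying probability, and survival past the exit\<close>

context tube begin

lemma stay_before_lim: "(\<lambda>n. prob (stay (t - 1 / real (Suc n)))) \<longlonglongrightarrow> prob (stay_before t)"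
proof -
  have "decseq (\<lambda>n. stay (t - 1 / real (Suc n)))"
  proof (rule decseq_SucI)
    fix n
    have "1 / real (Suc (Suc n)) \<le> 1 / real (Suc n)" by (intro divide_left_mono) auto
    then show "stay (t - 1 / real (Suc (Suc n))) \<subseteq> stay (t - 1 / real (Suc n))"
      by (intro stay_mono) linarith
  qed
  moreover have "range (\<lambda>n. stay (t - 1 / real (Suc n))) \<subseteq> events" by (rule image_subsetI) (rule sets_stay)
  ultimately show ?thesis unfolding stay_before_eq by (intro finite_Lim_measure_decseq)
qed

lemma prob_stay_mono: "s \<le> t \<Longrightarrow> prob (stay t) \<le> prob (stay s)"
  by (intro finite_measure_mono stay_mono sets_stay)

text \<open>\<open>exit_rate\<close> controls increments to the right; left continuity comes from
  \<open>stay_before_lim\<close> together with \<open>stay_boundary_null\<close>.\<close>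

lemma stay_lipschitz:
  assumes sc: "strip_const TYPE('m) T K \<beta> C" and C: "0 < C" and ab: "T / 2 \<le> a" "a \<le> b" "b < T"
  shows "prob (stay a) - prob (stay b) \<le> rate_const TYPE('m) C \<gamma> * (b - a)"
proof (rule dini_bound[OF ab(2)])
  show "0 \<le> rate_const TYPE('m) C \<gamma>" using rate_const_pos[OF C \<gamma>] by (rule less_imp_le)
  show "\<exists>\<eta>>0. \<forall>h. 0 < h \<and> h < \<eta> \<longrightarrow> prob (stay t) - prob (stay (t + h)) \<le> rate_const TYPE('m) C \<gamma> * h"
    if "a \<le> t" "t < b" for t
    using that ab by (intro exit_rate[OF sc C]) auto
  fix t e :: real assume t: "a < t" "t \<le> b" and e: "0 < e"
  have "prob (stay_before t) = prob (stay t)" using t ab by (intro stay_boundary_null[OF sc C]) auto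
  with stay_before_lim[of t] have "(\<lambda>n. prob (stay (t - 1 / real (Suc n)))) \<longlonglongrightarrow> prob (stay t)" by simp
  then have "eventually (\<lambda>n. prob (stay (t - 1 / real (Suc n))) < prob (stay t) + e) sequentially"
    by (rule order_tendstoD) (use e in simp)
  then obtain n where n: "prob (stay (t - 1 / real (Suc n))) < prob (stay t) + e"
    unfolding eventually_sequentially by blast
  show "\<exists>\<delta>>0. \<forall>s. t - \<delta> < s \<and> s < t \<longrightarrow> prob (stay s) - prob (stay t) \<le> e"
  proof (intro exI[of _ "1 / real (Suc n)"] conjI allI impI)
    fix s assume "t - 1 / real (Suc n) < s \<and> s < t"
    then have "prob (stay s) \<le> prob (stay (t - 1 / real (Suc n)))" by (intro prob_stay_mono) auto
    then show "prob (stay s) - prob (stay t) \<le> e" using n by linarith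
  qed simp
qed

text \<open>The class conditions concern times before T only, so the end point is reached as a
  limit.\<close>

lemma stay_lipschitz_end:
  assumes sc: "strip_const TYPE('m) T K \<beta> C" and C: "0 < C" and a: "T / 2 \<le> a" "a < T"
  shows "prob (stay a) - prob (stay_before T) \<le> rate_const TYPE('m) C \<gamma> * (T - a)"
proof -
  have D: "0 < rate_const TYPE('m) C \<gamma>" by (rule rate_const_pos[OF C \<gamma>])
  have "(\<lambda>n. prob (stay a) - prob (stay (T - 1 / real (Suc n)))) \<longlonglongrightarrow> prob (stay a) - prob (stay_before T)"
    by (intro tendsto_diff tendsto_const stay_before_lim)
  moreover obtain n0 where n0: "1 / real (Suc n0) < T - a" using nat_approx_posE[of "T - a"] a by auto
  have "prob (stay a) - prob (stay (T - 1 / real (Suc n))) \<le> rate_const TYPE('m) C \<gamma> * (T - a)" if "n0 \<le> n" for n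
  proof -
    have "1 / real (Suc n) \<le> 1 / real (Suc n0)" using that by (intro divide_left_mono) auto
    moreover have "0 < 1 / real (Suc n)" by simp
    ultimately have n: "a \<le> T - 1 / real (Suc n)" "T - 1 / real (Suc n) < T" using n0 by linarith+
    have "prob (stay a) - prob (stay (T - 1 / real (Suc n))) \<le> rate_const TYPE('m) C \<gamma> * (T - 1 / real (Suc n) - a)"
      by (rule stay_lipschitz[OF sc C a(1) n])
    also have "\<dots> \<le> rate_const TYPE('m) C \<gamma> * (T - a)" using D n by (intro mult_left_mono) auto
    finally show ?thesis .
  qed
  ultimately show ?thesis by (intro LIMSEQ_le_const2[where X="\<lambda>n. prob (stay a) - prob (stay (T - 1 / real (Suc n)))"]) auto
qed

text \<open>The last clause keeps the enlarged tube after time t out of a ball around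
  \<open>y\<close> that shrinks with speed K. The centre is existentially quantified at each point,
  so no measurable choice of centres is involved.\<close>

definition near_ball :: "real \<Rightarrow> real \<Rightarrow> (real ^ 'm) set" where
  "near_ball \<epsilon> t = {x. \<exists>y. norm (x - y) \<le> \<beta> + 2 * \<epsilon> \<and> \<beta> - 2 * \<epsilon> \<le> norm (x - y) \<and>
     (\<forall>s. t < s \<and> s < T \<longrightarrow> (\<forall>z\<in>nbhd (Gs s) \<epsilon>. \<beta> - 2 * \<epsilon> - K * (s - t) \<le> norm (z - y)))}"

text \<open>Measurability of \<open>near_ball\<close> is not at hand, so the event is enclosed in a
  measurable \<open>F\<close>: a level set of the survival function takes the place of
  \<open>near_ball\<close>, and the path is observed on a grid only.\<close>

lemma survive_near_ball:
  assumes fc: "forward_const TYPE('m) K \<beta> h0 q" and t: "0 < t" "t < T" and \<epsilon>: "0 < \<epsilon>" "\<epsilon> \<le> \<beta> / 8"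
    and E: "E \<in> sets (past t)"
  shows "\<exists>F\<in>sets M. {\<omega> \<in> E. W t \<omega> \<in> near_ball \<epsilon> t \<and> (\<forall>s. t < s \<and> s < T \<longrightarrow> W s \<omega> \<in> nbhd (Gs s) \<epsilon>)} \<subseteq> F \<and>
     prob F \<le> prob E * (20 * \<beta> / q * \<epsilon> / sqrt (min h0 ((T - t) / 2)))"
proof -
  define V where "V = \<beta>\<^sup>2 / (8 * (real CARD('m))\<^sup>2)"
  have fc': "0 < h0" "0 < q" "K * h0 \<le> \<beta> / 4" "q * sqrt h0 \<le> \<beta>\<^sup>2"
     "6 * (2 * \<beta> * K + gmom TYPE('m) 2) * (q * sqrt h0) \<le> V" "8 * q\<^sup>2 \<le> V"
    using fc unfolding forward_const_def V_def by auto
  \<comment> \<open>At most half of the remaining time, so that the grid ends strictly before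
    T.\<close>
  define h where "h = min h0 ((T - t) / 2)"
  have h: "0 < h" "h \<le> h0" "t + h < T"
  proof -
    show "0 < h" "h \<le> h0" using fc' t by (auto simp: h_def)
    have "h \<le> (T - t) / 2" unfolding h_def by (rule min.cobounded2)
    then have "h * 2 \<le> T - t" by simp
    then show "t + h < T" using t by linarith
  qed
  define r where "r = q * sqrt h"
  have r: "0 < r" "r \<le> q * sqrt h0" using fc' h by (auto simp: r_def)
  have "0 \<le> K" "0 < \<beta> * \<epsilon>" using K \<beta> \<epsilon> by auto
  from ex_exterior_ball_step[where 'm='m, OF \<beta> this(1) h(1) order_refl this(2) r(1) order_refl]
  obtain \<delta>0 where \<delta>0': "exterior_ball_step TYPE('m) K \<beta> h 0 0 r (\<beta> * \<epsilon>) \<delta>0" ..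
  then have \<delta>0: "0 < \<delta>0" by (simp add: exterior_ball_step_def)
  obtain n :: nat where n: "h / \<delta>0 < real n" using reals_Archimedean2 by blast
  have "0 < h / \<delta>0" using h \<delta>0 by simp
  then have n0: "0 < n" using n by (metis less_trans of_nat_0_less_iff)
  define \<delta> where "\<delta> = h / real n"
  have \<delta>: "0 < \<delta>" "real n * \<delta> = h" "\<delta> \<le> \<delta>0"
    using n n0 h \<delta>0 by (auto simp: \<delta>_def field_simps)
  \<comment> \<open>\<open>surv\<close> started at index 0 never tests \<open>H 0\<close>, and the
    clause on the tube in \<open>near_ball\<close> begins strictly after t; the empty set meets the
    required inclusion.\<close>
  define H where "H i = (if i = 0 then {} else nbhd (Gs (t + real i * \<delta>)) \<epsilon>)" for i :: nat
  have H: "H i \<in> sets borel" for i by (simp add: H_def open_nbhd)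
  have iT: "t < t + real i * \<delta> \<and> t + real i * \<delta> < T" if "0 < i" "i \<le> n" for i
  proof -
    have "real i * \<delta> \<le> real n * \<delta>" using that \<delta> by (intro mult_right_mono) auto
    moreover have "0 < real i * \<delta>" using that \<delta> by simp
    ultimately show ?thesis using \<delta> h by linarith
  qed
  define b where "b = 20 * \<beta> / q * \<epsilon> / sqrt h"
  have b0: "0 \<le> b" using \<beta> \<epsilon> fc' h by (simp add: b_def)
  let ?S = "surv (\<lambda>_. 1) (\<lambda>_. sqrt \<delta>) H n 0"
  have Sm: "?S \<in> borel_measurable borel"
    using \<delta> H by (intro measurable_surv[where n=n]) auto
  have near: "?S x \<le> ennreal b" if x: "x \<in> near_ball \<epsilon> t" for x
  proof -
    obtain y where y: "norm (x - y) \<le> \<beta> + 2 * \<epsilon>" "\<beta> - 2 * \<epsilon> \<le> norm (x - y)"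
      "\<And>s z. t < s \<Longrightarrow> s < T \<Longrightarrow> z \<in> nbhd (Gs s) \<epsilon> \<Longrightarrow> \<beta> - 2 * \<epsilon> - K * (s - t) \<le> norm (z - y)"
      using x unfolding near_ball_def by blast
    have "?S x \<le> ennreal (2 * ((norm (x - y))\<^sup>2 - \<beta>\<^sup>2 + 2 * \<beta> * (2 * \<epsilon>) + \<beta> * \<epsilon>) / r)"
    proof (rule surv_exterior_ball[OF \<delta>0'])
      have "K * h \<le> K * h0" using K h by (intro mult_left_mono) auto
      then show "2 * \<epsilon> + K * h \<le> \<beta> / 2" using fc'(3) \<epsilon> by linarith
      show "H i \<subseteq> {x. \<beta> - 2 * \<epsilon> - K * (real i * \<delta>) \<le> norm (x - y)}" if "i \<le> n" for i
      proof (cases "i = 0")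
        case False
        then show ?thesis using y(3)[of "t + real i * \<delta>"] iT[of i] that by (auto simp: H_def)
      qed (simp add: H_def)
      show "r \<le> \<beta>\<^sup>2" using r fc' by linarith
      have "6 * (2 * \<beta> * K + gmom TYPE('m) 2) * r \<le> 6 * (2 * \<beta> * K + gmom TYPE('m) 2) * (q * sqrt h0)"
        using r \<beta> K gmom_nonneg[where 'm='m, of 2] by (intro mult_left_mono) auto
      then show "6 * ((4 * \<beta> + 1) * 0 * (norm y + 2 * \<beta>) + 2 * \<beta> * K + gmom TYPE('m) 2) * r \<le> \<beta>\<^sup>2 / (8 * (real CARD('m))\<^sup>2)"
        using fc'(5) unfolding V_def by simp
      have "8 * q\<^sup>2 * h \<le> V * h" using fc' h by (intro mult_right_mono) auto
      then show "8 * r\<^sup>2 \<le> \<beta>\<^sup>2 / (8 * (real CARD('m))\<^sup>2) * h"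
        using h by (simp add: r_def V_def power_mult_distrib mult.assoc)
      show "1 - 0 * \<delta> \<le> 1 \<and> (1::real) \<le> 1 \<and> 0 < sqrt \<delta> \<and> \<delta> / 2 \<le> (sqrt \<delta>)\<^sup>2 \<and> (sqrt \<delta>)\<^sup>2 \<le> \<delta>"
        using \<delta> by simp
    qed (use \<delta> \<epsilon> y in auto)
    also have "\<dots> \<le> ennreal b"
    proof (rule ennreal_leI)
      have "(norm (x - y))\<^sup>2 \<le> (\<beta> + 2 * \<epsilon>)\<^sup>2" using y(1) by (intro power_mono) auto
      also have "\<dots> \<le> \<beta>\<^sup>2 + 5 * \<beta> * \<epsilon>"
        using mult_right_mono[OF \<epsilon>(2), of \<epsilon>] \<epsilon> by (simp add: power2_eq_square algebra_simps)
      finally have "2 * ((norm (x - y))\<^sup>2 - \<beta>\<^sup>2 + 2 * \<beta> * (2 * \<epsilon>) + \<beta> * \<epsilon>) \<le> 20 * \<beta> * \<epsilon>" by simp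
      then have "2 * ((norm (x - y))\<^sup>2 - \<beta>\<^sup>2 + 2 * \<beta> * (2 * \<epsilon>) + \<beta> * \<epsilon>) / r \<le> 20 * \<beta> * \<epsilon> / r"
        using r by (intro divide_right_mono) auto
      also have "\<dots> = b" by (simp add: b_def r_def)
      finally show "2 * ((norm (x - y))\<^sup>2 - \<beta>\<^sup>2 + 2 * \<beta> * (2 * \<epsilon>) + \<beta> * \<epsilon>) / r \<le> b" .
    qed
    finally show ?thesis .
  qed
  define E' where "E' = E \<inter> (W t -` {x. ?S x \<le> ennreal b} \<inter> space M)"
  have E': "E' \<in> sets (past t)"
  proof -
    have "{x. ?S x \<le> ennreal b} \<in> sets borel" using Sm by measurable
    then have "W t -` {x. ?S x \<le> ennreal b} \<inter> space (past t) \<in> sets (past t)"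
      using t by (intro measurable_sets[OF measurable_past]) auto
    then show ?thesis using E by (simp add: E'_def)
  qed
  have EM: "E \<in> sets M" "E' \<in> sets M" using E E' past_le by auto
  define F where "F = {\<omega> \<in> E'. \<forall>i. 0 < i \<and> i \<le> 0 + n \<longrightarrow> W (t + real i * \<delta>) \<omega> \<in> H i}"
  have "emeasure M F = (\<integral>\<^sup>+\<omega>. indicator E' \<omega> * ?S (W (t + real 0 * \<delta>) \<omega>) \<partial>M)"
    unfolding F_def using t E' by (intro emeasure_forward \<delta>(1) H) auto
  also have "\<dots> \<le> (\<integral>\<^sup>+\<omega>. ennreal b * indicator E' \<omega> \<partial>M)"
    by (intro nn_integral_mono) (auto simp: E'_def indicator_def)
  also have "\<dots> = ennreal b * emeasure M E'" using EM by (simp add: nn_integral_cmult)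
  also have "\<dots> \<le> ennreal b * emeasure M E"
    using EM by (intro mult_left_mono emeasure_mono) (auto simp: E'_def)
  finally have "emeasure M F \<le> ennreal (prob E * b)"
    using b0 by (simp add: emeasure_eq_measure ennreal_mult[symmetric] mult.commute)
  then have pF: "prob F \<le> prob E * b" using b0 by (simp add: emeasure_eq_measure)
  have FM: "F \<in> sets M"
  proof -
    have "{\<omega> \<in> space M. \<forall>i. 0 < i \<and> i \<le> 0 + n \<longrightarrow> W (t + real i * \<delta>) \<omega> \<in> H i} \<in> sets M"
    proof (intro sets.sets_Collect_countable_All sets.sets_Collect_imp sets.sets_Collect_const)
      fix i
      have "0 \<le> t + real i * \<delta>" using t \<delta> by simp
      from measurable_sets[OF measurable_W[OF this] H[of i]]
      show "{\<omega> \<in> space M. W (t + real i * \<delta>) \<omega> \<in> H i} \<in> sets M" by (simp add: vimage_def Int_def conj_commute)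
    qed
    from sets.Int[OF EM(2) this] show ?thesis
      unfolding F_def E'_def by (rule back_subst[where P="\<lambda>x. x \<in> sets M"]) blast
  qed
  have "{\<omega> \<in> E. W t \<omega> \<in> near_ball \<epsilon> t \<and> (\<forall>s. t < s \<and> s < T \<longrightarrow> W s \<omega> \<in> nbhd (Gs s) \<epsilon>)} \<subseteq> F"
  proof
    fix \<omega> assume "\<omega> \<in> {\<omega> \<in> E. W t \<omega> \<in> near_ball \<epsilon> t \<and> (\<forall>s. t < s \<and> s < T \<longrightarrow> W s \<omega> \<in> nbhd (Gs s) \<epsilon>)}"
    then have "\<omega> \<in> E \<and> W t \<omega> \<in> near_ball \<epsilon> t \<and> (\<forall>s. t < s \<and> s < T \<longrightarrow> W s \<omega> \<in> nbhd (Gs s) \<epsilon>)"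
      by (rule CollectD)
    then have \<omega>: "\<omega> \<in> E" "W t \<omega> \<in> near_ball \<epsilon> t" "\<And>s. t < s \<and> s < T \<Longrightarrow> W s \<omega> \<in> nbhd (Gs s) \<epsilon>"
      by blast+
    have "\<omega> \<in> space M" using \<omega>(1) EM(1) sets.sets_into_space by blast
    have "\<omega> \<in> E'" using \<omega>(1) near[OF \<omega>(2)] \<open>\<omega> \<in> space M\<close> by (simp add: E'_def)
    moreover have "W (t + real i * \<delta>) \<omega> \<in> H i" if "0 < i" "i \<le> n" for i
      using \<omega>(3)[OF iT[OF that]] that by (simp add: H_def)
    ultimately show "\<omega> \<in> F" by (simp add: F_def)
  qed
  then show ?thesis using FM pF unfolding b_def h_def by blast
qed

end

section \<open>Locating the exit and summing over its time\<close>

lemma nbhd_dist_ge: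
  fixes z y :: "'a::metric_space"
  assumes "z \<in> nbhd A \<epsilon>" "\<And>z'. z' \<in> A \<Longrightarrow> r \<le> dist z' y"
  shows "r - \<epsilon> \<le> dist z y"
proof -
  obtain z' where z': "z' \<in> A" "dist z z' < \<epsilon>" using assms(1) by (auto simp: mem_nbhd_iff)
  have "r \<le> dist z' y" using assms(2) z'(1) .
  also have "\<dots> \<le> dist z' z + dist z y" by (rule dist_triangle)
  finally show ?thesis using z'(2) by (simp add: dist_commute)
qed

context tube begin

text \<open>Outside G but within \<epsilon> of it, the path is within \<epsilon> of a frontier
  point, whose exterior ball supplies the centre. Until the grid time t the path, and likewise the
  sections, move by at most \<epsilon>, which gives 2 \<epsilon> on either side.\<close>

lemma exit_near_ball:
  assumes s: "0 < s" "s \<le> t" "t < T" and \<epsilon>: "0 < \<epsilon>" and out: "x \<notin> Gs s" "x \<in> nbhd (Gs s) \<epsilon>"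
    and w: "dist w x \<le> \<epsilon>" "w \<in> nbhd (Gs t) \<epsilon>" and st: "K * (t - s) \<le> \<epsilon>"
  shows "w \<in> near_ball \<epsilon> t"
proof -
  obtain p where p: "p \<in> Gs s" "dist x p < \<epsilon>" using out(2) by (auto simp: mem_nbhd_iff)
  have "\<exists>g\<in>frontier (- Gs s). dist x g < \<epsilon>" by (rule near_frontier) (use out p in auto)
  then obtain g where g: "g \<in> frontier (Gs s)" "dist x g < \<epsilon>" by (auto simp: frontier_complement)
  obtain y where y: "ball y \<beta> \<subseteq> - Gs s" "dist g y = \<beta>"
    using exterior_ball[OF s(1) _ g(1)] s by auto
  have far: "\<beta> - 2 * \<epsilon> - K * (u - t) \<le> dist z y" if u: "t \<le> u" "u < T" and z: "z \<in> nbhd (Gs u) \<epsilon>" for u z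
  proof -
    have "\<beta> - K * \<bar>u - s\<bar> \<le> dist z' y" if "z' \<in> Gs u" for z'
      using s u that by (intro Gs_avoids_ball y(1)) auto
    then have "\<beta> - K * \<bar>u - s\<bar> - \<epsilon> \<le> dist z y" using nbhd_dist_ge[OF z] by blast
    moreover have "K * \<bar>u - s\<bar> = K * (u - t) + K * (t - s)" using u s by (simp add: algebra_simps)
    ultimately show ?thesis using st by linarith
  qed
  have "dist w y \<le> dist w x + dist x g + dist g y"
    using dist_triangle[of w y x] dist_triangle[of x y g] by linarith
  then have "dist w y \<le> \<beta> + 2 * \<epsilon>" using w g y by linarith
  moreover have "\<beta> - 2 * \<epsilon> \<le> dist w y" using far[OF order_refl s(3) w(2)] by simp
  moreover have "\<forall>u. t < u \<and> u < T \<longrightarrow> (\<forall>z\<in>nbhd (Gs u) \<epsilon>. \<beta> - 2 * \<epsilon> - K * (u - t) \<le> dist z y)"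
    using far by simp
  ultimately show ?thesis unfolding near_ball_def dist_norm by blast
qed

text \<open>In cells that start before T/2 at least T/4 of time remains, so the weights are bounded,
  and the exit probabilities sum to at most 1. Later a cell has probability at most \<open>D\<close>
  times its length, and the weights 1 / sqrt(remaining time) telescope. The last cell is left out,
  as no time remains after it.\<close>

lemma sum_exit_bound:
  fixes N :: nat and D h0 :: real
  defines "t \<equiv> \<lambda>i. real i * (T / real N)"
  assumes D: "\<And>a b. T / 2 \<le> a \<Longrightarrow> a \<le> b \<Longrightarrow> b < T \<Longrightarrow> prob (stay a) - prob (stay b) \<le> D * (b - a)" "0 < D"
    and N: "4 \<le> N" and h0: "0 < h0"
  shows "(\<Sum>i<N - 1. prob (stay (t i) - stay (t (Suc i))) / sqrt (min h0 ((T - t (Suc i)) / 2)))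
     \<le> 1 / sqrt h0 + 2 * sqrt 2 / sqrt T + 2 * sqrt 2 * D * sqrt T"
proof -
  define \<delta> where "\<delta> = T / real N"
  define P where "P i = prob (stay (t i) - stay (t (Suc i)))" for i
  define R where "R i = sqrt (T - t i)" for i
  have \<delta>: "0 < \<delta>" "real N * \<delta> = T" "\<delta> \<le> T / 4" using T N by (auto simp: \<delta>_def field_simps)
  have t_Suc: "t (Suc i) = t i + \<delta>" for i by (simp add: t_def \<delta>_def algebra_simps add_divide_distrib)
  have t_le: "t i \<le> t j" if "i \<le> j" for i j
    unfolding t_def using that T by (intro mult_right_mono) auto
  have P: "P i = prob (stay (t i)) - prob (stay (t (Suc i)))" for i
    unfolding P_def by (intro finite_measure_Diff sets_stay stay_mono t_le) simp
  have P0: "0 \<le> P i" for i by (simp add: P_def)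
  have tN: "t N = T" using N by (simp add: t_def)
  have sumP: "(\<Sum>i<N - 1. P i) \<le> 1"
  proof -
    have "(\<Sum>i<n. P i) = prob (stay (t 0)) - prob (stay (t n))" for n
      by (induction n) (auto simp: P)
    then show ?thesis using prob_le_1[of "stay (t 0)"] measure_nonneg[of M "stay (t (N - 1))"] by (simp add: diff_le_eq add_increasing2)
  qed
  have term_le: "P i / sqrt (min h0 ((T - t (Suc i)) / 2))
      \<le> P i * (1 / sqrt h0 + 2 * sqrt 2 / sqrt T) + 2 * sqrt 2 * D * (R (Suc i) - R (Suc (Suc i)))" if i: "i < N - 1" for i
  proof -
    define a where "a = T - t (Suc i)"
    have a\<delta>: "\<delta> \<le> a"
    proof -
      have "Suc (Suc i) \<le> N" using i by linarith
      from t_le[OF this] show ?thesis using tN t_Suc[of "Suc i"] by (simp add: a_def)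
    qed
    then have a: "0 < a" using \<delta> by linarith
    have min_le: "1 / sqrt (min h0 (a / 2)) \<le> 1 / sqrt h0 + sqrt 2 / sqrt a"
      using a h0 by (cases "h0 \<le> a / 2") (auto simp: min_def real_sqrt_divide)
    have R2: "R (Suc (Suc i)) = sqrt (a - \<delta>)" "R (Suc i) = sqrt a"
      unfolding R_def a_def t_Suc[of "Suc i"] by simp_all
    have Rd: "0 \<le> R (Suc i) - R (Suc (Suc i))" unfolding R2 using \<delta> by simp
    have key: "P i * (sqrt 2 / sqrt a) \<le> P i * (2 * sqrt 2 / sqrt T) + 2 * sqrt 2 * D * (R (Suc i) - R (Suc (Suc i)))"
    proof (cases "t i < T / 2")
      case True
      then have "T / 4 \<le> a" using \<delta> t_Suc[of i] by (simp add: a_def)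
      then have "sqrt (T / 4) \<le> sqrt a" by simp
      moreover have "sqrt (T / 4) = sqrt T / 2" by (simp add: real_sqrt_divide)
      ultimately have "sqrt T / 2 \<le> sqrt a" by simp
      then have "sqrt 2 / sqrt a \<le> sqrt 2 / (sqrt T / 2)" using T a by (intro divide_left_mono mult_pos_pos) auto
      then have "sqrt 2 / sqrt a \<le> 2 * sqrt 2 / sqrt T" by (simp add: mult.commute)
      then have "P i * (sqrt 2 / sqrt a) \<le> P i * (2 * sqrt 2 / sqrt T)" using P0 by (intro mult_left_mono) auto
      moreover have "0 \<le> 2 * sqrt 2 * D * (R (Suc i) - R (Suc (Suc i)))" using D(2) Rd by (intro mult_nonneg_nonneg) auto
      ultimately show ?thesis by linarith
    next
      case False
      have "P i \<le> D * \<delta>"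
        using D(1)[of "t i" "t (Suc i)"] False t_Suc[of i] a \<delta> by (simp add: P a_def)
      then have "P i * (sqrt 2 / sqrt a) \<le> D * \<delta> * (sqrt 2 / sqrt a)" using a by (intro mult_right_mono) auto
      also have "\<dots> = D * sqrt 2 * (\<delta> / sqrt a)" by simp
      also have "\<dots> \<le> D * sqrt 2 * (2 * (sqrt a - sqrt (a - \<delta>)))"
        using D(2) sqrt_diff_ge[OF \<delta>(1) a\<delta>] by (intro mult_left_mono) auto
      also have "\<dots> = 2 * sqrt 2 * D * (R (Suc i) - R (Suc (Suc i)))" unfolding R2 by simp
      finally show ?thesis using P0[of i] T by (simp add: add_increasing)
    qed
    have "P i / sqrt (min h0 (a / 2)) = P i * (1 / sqrt (min h0 (a / 2)))" by simp
    also have "\<dots> \<le> P i * (1 / sqrt h0 + sqrt 2 / sqrt a)" by (rule mult_left_mono[OF min_le P0])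
    also have "\<dots> = P i * (1 / sqrt h0) + P i * (sqrt 2 / sqrt a)" by (rule distrib_left)
    also have "\<dots> \<le> P i * (1 / sqrt h0) + (P i * (2 * sqrt 2 / sqrt T) + 2 * sqrt 2 * D * (R (Suc i) - R (Suc (Suc i))))"
      by (rule add_left_mono[OF key])
    finally show ?thesis unfolding a_def by (simp only: distrib_left add.assoc)
  qed
  have "(\<Sum>i<N - 1. P i / sqrt (min h0 ((T - t (Suc i)) / 2)))
      \<le> (\<Sum>i<N - 1. P i * (1 / sqrt h0 + 2 * sqrt 2 / sqrt T) + 2 * sqrt 2 * D * (R (Suc i) - R (Suc (Suc i))))"
    by (rule sum_mono) (rule term_le, simp)
  also have "\<dots> = (\<Sum>i<N - 1. P i) * (1 / sqrt h0 + 2 * sqrt 2 / sqrt T) + 2 * sqrt 2 * D * (\<Sum>i<N - 1. R (Suc i) - R (Suc (Suc i)))"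
    by (simp only: sum.distrib sum_distrib_left sum_distrib_right)
  also have "(\<Sum>i<N - 1. R (Suc i) - R (Suc (Suc i))) = R (Suc 0) - R (Suc (N - 1))"
    by (rule sum_lessThan_telescope')
  also have "\<dots> \<le> sqrt T"
  proof -
    have "t (Suc 0) \<ge> 0" "Suc (N - 1) = N" using T N by (auto simp: t_def)
    then show ?thesis by (simp add: R_def tN)
  qed
  finally have *: "(\<Sum>i<N - 1. P i / sqrt (min h0 ((T - t (Suc i)) / 2)))
      \<le> (\<Sum>i<N - 1. P i) * (1 / sqrt h0 + 2 * sqrt 2 / sqrt T) + 2 * sqrt 2 * D * sqrt T"
    using D(2) by simp
  have "(\<Sum>i<N - 1. P i) * (1 / sqrt h0 + 2 * sqrt 2 / sqrt T) \<le> 1 * (1 / sqrt h0 + 2 * sqrt 2 / sqrt T)"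
    using sumP h0 T by (intro mult_right_mono) auto
  from order_trans[OF * add_right_mono[OF this]] show ?thesis
    unfolding P_def mult_1_left .
qed

lemma stay_prob_eq: "stay_prob M W T G = prob (stay_before T)"
  unfolding stay_prob_def stay_before_def mem_Gs Ball_def greaterThanLessThan_iff by (rule refl)

text \<open>A path in the enlarged tube that leaves G is sorted by the grid cell of its exit. Cells
  before the last go through \<open>exit_near_ball\<close> and \<open>survive_near_ball\<close>. The
  last cell has probability at most D T / N, hence at most \<epsilon> for large N, which is the
  origin of the summand 1.\<close>

lemma stay_prob_tube_le:
  assumes sc: "strip_const TYPE('m) T K \<beta> C" and C: "0 < C"
    and fc: "forward_const TYPE('m) K \<beta> h0 q" and \<epsilon>: "0 < \<epsilon>" "\<epsilon> \<le> \<beta> / 8"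
  defines "D \<equiv> rate_const TYPE('m) C \<gamma>"
  shows "stay_prob M W T (tube_nbhd T G \<epsilon>) \<le> stay_prob M W T G +
     (20 * \<beta> / q * (1 / sqrt h0 + 2 * sqrt 2 / sqrt T + 2 * sqrt 2 * D * sqrt T) + 1) * \<epsilon>"
proof -
  define Bd where "Bd = 1 / sqrt h0 + 2 * sqrt 2 / sqrt T + 2 * sqrt 2 * D * sqrt T"
  have D: "0 < D" unfolding D_def by (rule rate_const_pos[OF C \<gamma>])
  have h0: "0 < h0" "0 < q" using fc by (auto simp: forward_const_def)
  define X where "X = {\<omega> \<in> space M. \<forall>s. 0 < s \<and> s < T \<longrightarrow> W s \<omega> \<in> nbhd (Gs s) \<epsilon>}"
  have X_eq: "stay_prob M W T (tube_nbhd T G \<epsilon>) = prob X"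
  proof -
    have "(s, x) \<in> tube_nbhd T G \<epsilon> \<longleftrightarrow> x \<in> nbhd (Gs s) \<epsilon>" if "0 < s" "s < T" for s x
      using that by (simp add: tube_nbhd_def)
    then have "{\<omega> \<in> space M. \<forall>s\<in>{0<..<T}. (s, W s \<omega>) \<in> tube_nbhd T G \<epsilon>} = X"
      unfolding X_def greaterThanLessThan_iff Ball_def by blast
    then show ?thesis by (simp add: stay_prob_def)
  qed
  define t where "t N i = real i * (T / real N)" for N i :: nat
  define E where "E N i = stay (t N i) - stay (t N (Suc i))" for N i
  define Z where "Z N i = {\<omega> \<in> E N i. W (t N (Suc i)) \<omega> \<in> near_ball \<epsilon> (t N (Suc i)) \<and>
    (\<forall>s. t N (Suc i) < s \<and> s < T \<longrightarrow> W s \<omega> \<in> nbhd (Gs s) \<epsilon>)}" for N i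
  have t_le: "t N i \<le> t N j" if "i \<le> j" for N i j
    unfolding t_def using that T by (intro mult_right_mono) auto
  have tT: "0 < t N (Suc i) \<and> t N (Suc i) < T" if "i < N - 1" for N i
  proof -
    have N: "0 < real N" using that by simp
    have "real (Suc i) * (T / real N) < real N * (T / real N)" using that T N by (intro mult_strict_right_mono) auto
    moreover have "0 < real (Suc i) * (T / real N)" using T N by (intro mult_pos_pos) auto
    ultimately show ?thesis using N by (simp add: t_def)
  qed
  have E_past: "E N i \<in> sets (past (t N (Suc i)))" for N i
    unfolding E_def using stay_past past_mono[OF t_le[of i "Suc i" N]] by (intro sets.Diff) auto
  \<comment> \<open>Measurability is demanded for all indices, the estimate only before the last
    cell; this makes the choice of \<open>F\<close> total.\<close>
  define admissible where "admissible N i F \<longleftrightarrow> F \<in> sets M \<and> (i < N - 1 \<longrightarrow> Z N i \<subseteq> F \<and>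
     prob F \<le> prob (E N i) * (20 * \<beta> / q * \<epsilon> / sqrt (min h0 ((T - t N (Suc i)) / 2))))" for N i F
  have ex_admissible: "\<exists>F. admissible N i F" for N i
  proof (cases "i < N - 1")
    case True
    then show ?thesis
      using survive_near_ball[OF fc _ _ \<epsilon> E_past[of N i]] tT[OF True] True unfolding admissible_def Z_def by blast
  qed (auto simp: admissible_def)
  define F where "F N i = (SOME F. admissible N i F)" for N i
  have "admissible N i (F N i)" for N i unfolding F_def by (rule someI_ex[OF ex_admissible])
  then have F: "\<And>N i. F N i \<in> sets M" "\<And>N i. i < N - 1 \<Longrightarrow> Z N i \<subseteq> F N i"
    "\<And>N i. i < N - 1 \<Longrightarrow> prob (F N i) \<le> prob (E N i) * (20 * \<beta> / q * \<epsilon> / sqrt (min h0 ((T - t N (Suc i)) / 2)))"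
    unfolding admissible_def by blast+
  define A where "A N = (\<Union>i<N - 1. F N i) \<union> (stay (t N (N - 1)) - stay_before T)" for N
  have "prob (X - stay_before T) \<le> (20 * \<beta> / q * Bd + 1) * \<epsilon>"
  proof (rule measure_le_of_eventually[where F=A])
    show "A N \<in> sets M" for N unfolding A_def using F(1) by auto
    obtain N1 :: nat where N1: "D * T / \<epsilon> < real N1" using reals_Archimedean2 by blast
    show "eventually (\<lambda>N. prob (A N) \<le> (20 * \<beta> / q * Bd + 1) * \<epsilon>) sequentially"
      unfolding eventually_sequentially
    proof (intro exI[of _ "max N1 4"] allI impI)
      fix N assume "max N1 4 \<le> N"
      then have N: "4 \<le> N" "N1 \<le> N" by auto
      have Nr: "0 < real N" using N by simp
      have last: "prob (stay (t N (N - 1)) - stay_before T) \<le> \<epsilon>"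
      proof -
        have tl: "t N (N - 1) = T - T / real N"
          using N by (simp add: t_def of_nat_diff field_simps)
        have "T / real N \<le> T / 2" using N T by (intro divide_left_mono) auto
        then have a: "T / 2 \<le> t N (N - 1)" "t N (N - 1) < T" unfolding tl using divide_pos_pos[OF T Nr] by linarith+
        have sub: "stay_before T \<subseteq> stay (t N (N - 1))" using a(2) by (auto simp: stay_def stay_before_def)
        have "prob (stay (t N (N - 1)) - stay_before T) = prob (stay (t N (N - 1))) - prob (stay_before T)"
          by (rule finite_measure_Diff[OF sets_stay sets_stay_before sub])
        also have "\<dots> \<le> D * (T - t N (N - 1))" unfolding D_def by (rule stay_lipschitz_end[OF sc C a])
        also have "\<dots> = D * T / real N" unfolding tl by simp
        also have "\<dots> \<le> \<epsilon>"
        proof -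
          have "D * T / \<epsilon> \<le> real N" using N1 N(2) by simp
          then have "D * T \<le> real N * \<epsilon>" using \<epsilon> by (simp add: pos_divide_le_eq)
          then show ?thesis using Nr by (simp add: pos_divide_le_eq mult.commute)
        qed
        finally show ?thesis .
      qed
      have "prob (\<Union>i<N - 1. F N i) \<le> (\<Sum>i<N - 1. prob (F N i))"
        using F(1) by (intro finite_measure_subadditive_finite) auto
      also have "\<dots> \<le> (\<Sum>i<N - 1. 20 * \<beta> / q * \<epsilon> * (prob (E N i) / sqrt (min h0 ((T - t N (Suc i)) / 2))))"
      proof (rule sum_mono)
        fix i assume "i \<in> {..<N - 1}"
        then show "prob (F N i) \<le> 20 * \<beta> / q * \<epsilon> * (prob (E N i) / sqrt (min h0 ((T - t N (Suc i)) / 2)))"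
          using F(3)[of i N] by (simp add: mult_ac)
      qed
      also have "\<dots> = 20 * \<beta> / q * \<epsilon> * (\<Sum>i<N - 1. prob (E N i) / sqrt (min h0 ((T - t N (Suc i)) / 2)))"
        by (rule sum_distrib_left[symmetric])
      also have "\<dots> \<le> 20 * \<beta> / q * \<epsilon> * Bd"
      proof (rule mult_left_mono)
        show "(\<Sum>i<N - 1. prob (E N i) / sqrt (min h0 ((T - t N (Suc i)) / 2))) \<le> Bd"
          unfolding Bd_def E_def t_def
          by (rule sum_exit_bound[OF _ D N(1) h0(1)]) (unfold D_def, rule stay_lipschitz[OF sc C])
        show "0 \<le> 20 * \<beta> / q * \<epsilon>" using \<beta> h0 \<epsilon> by simp
      qed
      finally have "prob (\<Union>i<N - 1. F N i) \<le> 20 * \<beta> / q * \<epsilon> * Bd" .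
      moreover have "prob (A N) \<le> prob (\<Union>i<N - 1. F N i) + prob (stay (t N (N - 1)) - stay_before T)"
        unfolding A_def using F(1) by (intro measure_Un_le) auto
      moreover have "(20 * \<beta> / q * Bd + 1) * \<epsilon> = 20 * \<beta> / q * \<epsilon> * Bd + \<epsilon>" by (simp add: algebra_simps)
      ultimately show "prob (A N) \<le> (20 * \<beta> / q * Bd + 1) * \<epsilon>" using last by linarith
    qed
    fix \<omega> assume "\<omega> \<in> X - stay_before T"
    then have \<omega>: "\<omega> \<in> space M" "\<And>s. 0 < s \<and> s < T \<Longrightarrow> W s \<omega> \<in> nbhd (Gs s) \<epsilon>" "\<omega> \<notin> stay_before T"
      unfolding X_def by blast+
    have "continuous_on {0..T} (\<lambda>t. W t \<omega>)"
      by (intro continuous_on_subset[OF continuous_path[OF \<omega>(1)]]) auto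
    then have "uniformly_continuous_on {0..T} (\<lambda>t. W t \<omega>)"
      by (rule compact_uniformly_continuous) simp
    then obtain d where d: "0 < d" "\<And>x y. x \<in> {0..T} \<Longrightarrow> y \<in> {0..T} \<Longrightarrow> dist y x < d \<Longrightarrow> dist (W y \<omega>) (W x \<omega>) < \<epsilon>"
      using \<epsilon>(1) unfolding uniformly_continuous_on_def by meson
    \<comment> \<open>Within a cell shorter than \<open>m\<close> the path and the sections both
      move by at most \<epsilon>.\<close>
    define m where "m = min d (\<epsilon> / K)"
    have m: "0 < m" using d \<epsilon> K by (simp add: m_def)
    obtain N0 :: nat where N0: "T / m < real N0" using reals_Archimedean2 by blast
    show "eventually (\<lambda>N. \<omega> \<in> A N) sequentially"
      unfolding eventually_sequentially
    proof (intro exI[of _ N0] allI impI)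
      fix N assume N: "N0 \<le> N"
      have TN: "T / m < real N" using N0 N by simp
      moreover have "0 < T / m" using T m by simp
      ultimately have Npos: "0 < real N" by linarith
      have TNm: "T / real N < m" using TN Npos m by (simp add: field_simps)
      show "\<omega> \<in> A N"
      proof (cases "\<omega> \<in> stay (t N (N - 1))")
        case True
        then show ?thesis using \<omega>(3) by (simp add: A_def)
      next
        case False
        \<comment> \<open>The first grid time by which the path has left; the exit lies in the cell
          ending there.\<close>
        define k where "k = (LEAST k. \<omega> \<notin> stay (t N k))"
        have k: "\<omega> \<notin> stay (t N k)" "k \<le> N - 1"
          unfolding k_def by (rule LeastI[of "\<lambda>k. \<omega> \<notin> stay (t N k)", OF False], rule Least_le, rule False)
        have "\<omega> \<in> stay (t N 0)" using \<omega>(1) by (auto simp: stay_def t_def)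
        then obtain i where i: "k = Suc i" using k by (cases k) auto
        have iN: "i < N - 1" using k i by simp
        have "\<omega> \<in> stay (t N i)" using not_less_Least[of i "\<lambda>k. \<omega> \<notin> stay (t N k)"] i unfolding k_def by simp
        then have \<omega>E: "\<omega> \<in> E N i" using k i by (simp add: E_def)
        obtain s where s: "0 < s" "s \<le> t N (Suc i)" "W s \<omega> \<notin> Gs s"
          using k(1) \<omega>(1) unfolding i stay_def by blast
        have ts: "t N i < s" using \<open>\<omega> \<in> stay (t N i)\<close> s unfolding stay_def by (force simp: not_le[symmetric])
        have "t N (Suc i) = t N i + T / real N" by (simp add: t_def algebra_simps add_divide_distrib)
        then have ds: "t N (Suc i) - s < m" using ts TNm by linarith
        have tt: "0 < t N (Suc i)" "t N (Suc i) < T" using tT[OF iN] by auto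
        have "W (t N (Suc i)) \<omega> \<in> near_ball \<epsilon> (t N (Suc i))"
        proof (rule exit_near_ball[OF s(1,2) tt(2) \<epsilon>(1) s(3)])
          show "W s \<omega> \<in> nbhd (Gs s) \<epsilon>" using \<omega>(2) s tt by simp
          show "W (t N (Suc i)) \<omega> \<in> nbhd (Gs (t N (Suc i))) \<epsilon>" using \<omega>(2) tt by simp
          show "dist (W (t N (Suc i)) \<omega>) (W s \<omega>) \<le> \<epsilon>"
            using s tt ds by (intro less_imp_le d(2)) (auto simp: m_def dist_real_def)
          have "t N (Suc i) - s \<le> \<epsilon> / K" using ds by (simp add: m_def)
          then show "K * (t N (Suc i) - s) \<le> \<epsilon>" using K by (simp add: pos_le_divide_eq mult.commute)
        qed
        moreover have "\<forall>s. t N (Suc i) < s \<and> s < T \<longrightarrow> W s \<omega> \<in> nbhd (Gs s) \<epsilon>"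
          using \<omega>(2) tt by simp
        ultimately have "\<omega> \<in> Z N i" using \<omega>E unfolding Z_def by blast
        then have "\<omega> \<in> F N i" using F(2)[OF iN] by blast
        then show ?thesis using iN unfolding A_def by blast
      qed
    qed
  qed
  then have diff: "prob (X - stay_before T) \<le> (20 * \<beta> / q * Bd + 1) * \<epsilon>" .
  have "prob X \<le> prob (stay_before T) + (20 * \<beta> / q * Bd + 1) * \<epsilon>"
  \<comment> \<open>\<open>X\<close> is an uncountable intersection; if it is not measurable, its
    \<open>measure\<close> is 0 by convention.\<close>
  proof (cases "X \<in> sets M")
    case True
    have "prob X \<le> prob (stay_before T \<union> (X - stay_before T))"
      using True by (intro finite_measure_mono) auto
    also have "\<dots> \<le> prob (stay_before T) + prob (X - stay_before T)"
      using True by (intro measure_Un_le) auto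
    finally show ?thesis using diff by simp
  next
    case False
    then have "prob X = 0" by (rule measure_notin_sets)
    moreover have "0 \<le> (20 * \<beta> / q * Bd + 1) * \<epsilon>" using diff measure_nonneg[of M "X - stay_before T"] by linarith
    ultimately show ?thesis using measure_nonneg[of M "stay_before T"] by linarith
  qed
  then show ?thesis unfolding X_eq stay_prob_eq Bd_def .
qed

end

theorem theorem1:
  fixes T K \<beta> \<gamma> :: real
  assumes "T > 0" and "K > 0" and "\<beta> > 0" and "\<gamma> > 0"
  shows "\<exists>c::real. \<forall>(M :: 'w measure) (W :: real \<Rightarrow> 'w \<Rightarrow> real ^ 'm).
           standard_brownian_motion M W \<longrightarrow>
           (\<forall>G \<in> class_G_params M W T K \<beta> \<gamma>. \<forall>\<epsilon>>0.
              stay_prob M W T (tube_nbhd T G \<epsilon>) \<le> stay_prob M W T G + c * \<epsilon>)"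
proof -
  \<comment> \<open>The constants are fixed before the process and the set are introduced, so c
    depends on m, T, K, \<beta> and \<gamma> only.\<close>
  obtain C where C: "0 < C" "strip_const TYPE('m) T K \<beta> C"
    using ex_strip_const[where 'm='m, OF assms(1-3)] by blast
  obtain h0 q where fc: "forward_const TYPE('m) K \<beta> h0 q"
    using ex_forward_const[where 'm='m, OF assms(2,3)] by blast
  define c1 where "c1 = 20 * \<beta> / q * (1 / sqrt h0 + 2 * sqrt 2 / sqrt T + 2 * sqrt 2 * rate_const TYPE('m) C \<gamma> * sqrt T) + 1"
  show ?thesis
  \<comment> \<open>The second entry makes c \<epsilon> at least 1 once \<epsilon> exceeds \<beta> /
    8; there the bound 1 on any probability is enough.\<close>
  proof (intro exI[of _ "max c1 (8 / \<beta>)"] allI impI ballI)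
    fix M :: "'w measure" and W :: "real \<Rightarrow> 'w \<Rightarrow> real ^ 'm" and G and \<epsilon> :: real
    assume bm: "standard_brownian_motion M W" and G: "G \<in> class_G_params M W T K \<beta> \<gamma>" and \<epsilon>: "0 < \<epsilon>"
    interpret tube M W T K \<beta> \<gamma> G
      using bm G assms by unfold_locales auto
    show "stay_prob M W T (tube_nbhd T G \<epsilon>) \<le> stay_prob M W T G + max c1 (8 / \<beta>) * \<epsilon>"
    proof (cases "\<epsilon> \<le> \<beta> / 8")
      case True
      have "stay_prob M W T (tube_nbhd T G \<epsilon>) \<le> stay_prob M W T G + c1 * \<epsilon>"
        unfolding c1_def by (rule stay_prob_tube_le[OF C(2,1) fc \<epsilon> True])
      also have "c1 * \<epsilon> \<le> max c1 (8 / \<beta>) * \<epsilon>" using \<epsilon> by (intro mult_right_mono) auto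
      finally show ?thesis by simp
    next
      case False
      then have "1 \<le> 8 / \<beta> * \<epsilon>" using assms(3) by (simp add: field_simps)
      also have "\<dots> \<le> max c1 (8 / \<beta>) * \<epsilon>" using \<epsilon> by (intro mult_right_mono) auto
      finally have "1 \<le> max c1 (8 / \<beta>) * \<epsilon>" .
      moreover have "stay_prob M W T (tube_nbhd T G \<epsilon>) \<le> 1" "0 \<le> stay_prob M W T G"
        unfolding stay_prob_def by (auto intro: prob_le_1)
      ultimately show ?thesis by linarith
    qed
  qed
qed

end
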